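(* Let $X$ be a paracompact (Tychonoff) space. The following are equivalent: (a) $X$ is a finite $C$-space; (b) for any space $Y$ and any aspherical sequence of strongly lower semi-continuous maps $\phi_n\colon X\to 2^Y$ ($n\in\mathbb N$), there exists $m$ such that $\phi_m$ admits a continuous selection; (c) for any space $Y$ and any aspherical sequence $\phi_n\colon X\to 2^Y$ ($n\in\mathbb N$) of set-valued maps with open graph (i.e. $\{(x,y)\in X\times Y: y\in\phi_n(x)\}$ is open in $X\times Y$), there exists $m$ such that $\phi_m$ admits a continuous selection.
   Context: All spaces are Tychonoff. A set is functionally open if it is a cozero set. A space $X$ is a finite $C$-space if for every sequence $\{\omega_n\}_{n\in\mathbb N}$ of finite covers of $X$ by functionally open sets there exist $k$ and finite families $\gamma_1,\dots,\gamma_k$, each consisting of pairwise disjoint functionally open sets, such that each $\gamma_n$ refines $\omega_n$ and $\bigcup_{n=1}^k\gamma_n$ covers $X$. $2^Y$ denotes the family of nonempty subsets of $Y$. A map $\theta\colon X\to 2^Y$ is strongly lower semi-continuous if for every compact $K\subset Y$ the set $\{x\in X: K\subset\theta(x)\}$ is open in $X$. For $A\subset B$, $A$ is $C^m$-embedded in $B$ if every continuous image in $A$ of a $k$-sphere, $k\le m$, is contractible in $B$. A sequence $\theta_n\colon X\to 2^Y$ is aspherical if $\theta_n(x)\subset\theta_{n+1}(x)$ and $\theta_n(x)$ is $C^{n-1}$-embedded in $\theta_{n+1}(x)$ for all $x\in X$, $n\in\mathbb N$. A continuous selection for $\theta$ is a continuous $f\colon X\to Y$ with $f(x)\in\theta(x)$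 for all $x$. *)

theory Defs
  imports "HOL-Analysis.Analysis"
begin

definition tychonoff_space :: "'a topology \<Rightarrow> bool" where
  "tychonoff_space X \<longleftrightarrow> completely_regular_space X \<and> Hausdorff_space X"

definition paracompact_space :: "'a topology \<Rightarrow> bool" where
  "paracompact_space X \<longleftrightarrow>
     (\<forall>\<U>. (\<forall>U\<in>\<U>. openin X U) \<and> topspace X \<subseteq> \<Union>\<U> \<longrightarrow>
        (\<exists>\<V>. (\<forall>V\<in>\<V>. openin X V) \<and> topspace X \<subseteq> \<Union>\<V> \<and> locally_finite_in X \<V> \<and>
              (\<forall>V\<in>\<V>. \<exists>U\<in>\<U>. V \<subseteq> U)))"

definition functionally_open :: "'a topology \<Rightarrow> 'a set \<Rightarrow> bool" where
  "functionally_open X U \<longleftrightarrow>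
     (\<exists>f. continuous_map X euclideanreal f \<and> U = {x \<in> topspace X. f x \<noteq> 0})"

definition refines :: "'a set set \<Rightarrow> 'a set set \<Rightarrow> bool" where
  "refines \<gamma> \<omega> \<longleftrightarrow> (\<forall>V\<in>\<gamma>. \<exists>U\<in>\<omega>. V \<subseteq> U)"

text \<open>Sequences are indexed by n >= 1 (the natural numbers start at 1).\<close>
definition finite_C_space :: "'a topology \<Rightarrow> bool" where
  "finite_C_space X \<longleftrightarrow>
     (\<forall>\<omega> :: nat \<Rightarrow> 'a set set.
        (\<forall>n\<ge>1. finite (\<omega> n) \<and> (\<forall>U\<in>\<omega> n. functionally_open X U) \<and> \<Union>(\<omega> n) = topspace X)
        \<longrightarrow> (\<exists>k. \<exists>\<gamma> :: nat \<Rightarrow> 'a set set.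
               (\<forall>n\<in>{1..k}. finite (\<gamma> n) \<and> (\<forall>V\<in>\<gamma> n. functionally_open X V) \<and>
                            pairwise disjnt (\<gamma> n) \<and> refines (\<gamma> n) (\<omega> n)) \<and>
               topspace X \<subseteq> (\<Union>n\<in>{1..k}. \<Union>(\<gamma> n))))"

definition setvalued_map :: "'a topology \<Rightarrow> 'b topology \<Rightarrow> ('a \<Rightarrow> 'b set) \<Rightarrow> bool" where
  "setvalued_map X Y \<theta> \<longleftrightarrow> (\<forall>x\<in>topspace X. \<theta> x \<noteq> {} \<and> \<theta> x \<subseteq> topspace Y)"

definition strongly_lsc :: "'a topology \<Rightarrow> 'b topology \<Rightarrow> ('a \<Rightarrow> 'b set) \<Rightarrow> bool" where
  "strongly_lsc X Y \<theta> \<longleftrightarrow>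
     (\<forall>K. compactin Y K \<longrightarrow> openin X {x \<in> topspace X. K \<subseteq> \<theta> x})"

definition open_graph :: "'a topology \<Rightarrow> 'b topology \<Rightarrow> ('a \<Rightarrow> 'b set) \<Rightarrow> bool" where
  "open_graph X Y \<theta> \<longleftrightarrow>
     openin (prod_topology X Y) {(x, y). x \<in> topspace X \<and> y \<in> topspace Y \<and> y \<in> \<theta> x}"

definition C_embedded :: "nat \<Rightarrow> 'b topology \<Rightarrow> 'b set \<Rightarrow> 'b set \<Rightarrow> bool" where
  "C_embedded m Y A B \<longleftrightarrow>
     (\<forall>k\<le>m. \<forall>f. continuous_map (nsphere k) (subtopology Y A) f \<longrightarrow>
        (\<exists>c\<in>B. homotopic_with (\<lambda>h. True) (nsphere k) (subtopology Y B) f (\<lambda>z. c)))"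

definition aspherical :: "'a topology \<Rightarrow> 'b topology \<Rightarrow> (nat \<Rightarrow> 'a \<Rightarrow> 'b set) \<Rightarrow> bool" where
  "aspherical X Y \<theta> \<longleftrightarrow>
     (\<forall>n\<ge>1. \<forall>x\<in>topspace X. \<theta> n x \<subseteq> \<theta> (Suc n) x \<and> C_embedded (n - 1) Y (\<theta> n x) (\<theta> (Suc n) x))"

definition continuous_selection :: "'a topology \<Rightarrow> 'b topology \<Rightarrow> ('a \<Rightarrow> 'b set) \<Rightarrow> ('a \<Rightarrow> 'b) \<Rightarrow> bool" where
  "continuous_selection X Y \<theta> f \<longleftrightarrow> continuous_map X Y f \<and> (\<forall>x\<in>topspace X. f x \<in> \<theta> x)"

definition slsc_selection_property :: "'a topology \<Rightarrow> 'b topology \<Rightarrow> bool" where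
  "slsc_selection_property X Y \<longleftrightarrow>
     (\<forall>\<phi> :: nat \<Rightarrow> 'a \<Rightarrow> 'b set.
        (\<forall>n\<ge>1. setvalued_map X Y (\<phi> n) \<and> strongly_lsc X Y (\<phi> n)) \<and> aspherical X Y \<phi>
        \<longrightarrow> (\<exists>m\<ge>1. \<exists>f. continuous_selection X Y (\<phi> m) f))"

definition open_graph_selection_property :: "'a topology \<Rightarrow> 'b topology \<Rightarrow> bool" where
  "open_graph_selection_property X Y \<longleftrightarrow>
     (\<forall>\<phi> :: nat \<Rightarrow> 'a \<Rightarrow> 'b set.
        (\<forall>n\<ge>1. setvalued_map X Y (\<phi> n) \<and> open_graph X Y (\<phi> n)) \<and> aspherical X Y \<phi>
        \<longrightarrow> (\<exists>m\<ge>1. \<exists>f. continuous_selection X Y (\<phi> m) f))"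

end

theory Submission
  imports Defs
begin

text \<open>
  For a paracompact finite \<open>C\<close>-space the defining property extends from finite functionally open covers to
  arbitrary open covers. If a continuous \<open>h\<close> had strips \<open>{i \<le> h \<le> i + 1}\<close> of unbounded dimension, then essential
  families on a discrete sequence of strips would merge into binary covers without disjoint refinements; so
  each such \<open>h\<close> has a finite-dimensional superlevel set. Outside such sets an open cover can be replaced by a
  finite one, and on them finitely many of the remaining covers suffice.

  For an aspherical sequence one chooses open covers level by level together with maps of the simplices having
  one vertex on each level: the next vertex \<open>x\<close> is obtained by coning the part of the complex near \<open>x\<close> inside
  the values at \<open>x\<close>, and strong lower semicontinuity at the compact image bounds the size of the new cover
  elements. Disjoint refinements of finitely many of these covers have a nerve consisting of such simplices, and
  a partition of unity turns the map of the nerve into a selection.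

  Conversely, given covers \<open>\<omega> n\<close>, let \<open>\<phi> n x\<close> be an open neighbourhood of the join of the discrete sets
  \<open>{U \<in> \<omega> i. x \<in> U}\<close> with \<open>i \<le> n\<close>. It is contractible in \<open>\<phi> (n + 1) x\<close>, which contains a cone over it, and the
  coordinates of a selection of \<open>\<phi> m\<close> yield the disjoint refinements.
\<close>

section \<open>Locally finite families and partitions of unity\<close>

text \<open>In the direct implication the number \<open>k\<close> of covers that suffice is known
  only after the whole sequence of covers is given. So a cover is never changed once it is chosen,
  while the map on the complex may be rebuilt at every level; \<open>k\<close>, and with it the
  index \<open>1 + k * k\<close> of the selected map, is read off at the end. A new cover depends on
  the values at all points of \<open>X\<close> and is infinite in general, whereas a finite C-space
  is defined by finite covers. What makes the passage to infinite covers possible is that the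
  exceptional superlevel sets are refined by a number of families that is the same for all covers:
  it can be fixed before the remaining covers are looked at. In the converse, the condition defining
  \<open>join_map\<close> is imposed only on coordinates that reach half of the maximum. Imposed on
  all nonzero coordinates it would give the exact join, whose graph is not open in general, because
  an arbitrarily small new coordinate may violate it. Any constant larger than 1 would serve in
  place of the factor 2.\<close>

text \<open>Indices are counted, not sets: a nonempty set repeated at infinitely many indices is
  excluded, as sums over partitions of unity require.\<close>

definition locally_finite_family :: "'a topology \<Rightarrow> 'i set \<Rightarrow> ('i \<Rightarrow> 'a set) \<Rightarrow> bool" where
  "locally_finite_family X I U \<longleftrightarrow>
     (\<forall>x\<in>topspace X. \<exists>N. openin X N \<and> x \<in> N \<and> finite {i \<in> I. U i \<inter> N \<noteq> {}})"

lemma locally_finite_family_mono: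
  assumes "locally_finite_family X I U" "\<And>i. i \<in> I \<Longrightarrow> V i \<subseteq> U i"
  shows "locally_finite_family X I V"
  unfolding locally_finite_family_def
proof
  fix x assume "x \<in> topspace X"
  then obtain N where N: "openin X N" "x \<in> N" "finite {i \<in> I. U i \<inter> N \<noteq> {}}"
    using assms(1) unfolding locally_finite_family_def by blast
  have "{i \<in> I. V i \<inter> N \<noteq> {}} \<subseteq> {i \<in> I. U i \<inter> N \<noteq> {}}"
    using assms(2) by blast
  with N show "\<exists>N. openin X N \<and> x \<in> N \<and> finite {i \<in> I. V i \<inter> N \<noteq> {}}"
    using finite_subset by blast
qed

lemma locally_finite_family_closure:
  assumes "locally_finite_family X I U"
  shows "locally_finite_family X I (\<lambda>i. X closure_of U i)"
  unfolding locally_finite_family_def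
proof
  fix x assume "x \<in> topspace X"
  then obtain N where N: "openin X N" "x \<in> N" "finite {i \<in> I. U i \<inter> N \<noteq> {}}"
    using assms(1) unfolding locally_finite_family_def by blast
  have "{i \<in> I. X closure_of U i \<inter> N \<noteq> {}} = {i \<in> I. U i \<inter> N \<noteq> {}}"
    using openin_Int_closure_of_eq_empty[OF N(1)] by (metis Int_commute)
  with N show "\<exists>N. openin X N \<and> x \<in> N \<and> finite {i \<in> I. X closure_of U i \<inter> N \<noteq> {}}"
    by auto
qed

lemma locally_finite_family_finite_at:
  assumes "locally_finite_family X I U" "x \<in> topspace X"
  shows "finite {i \<in> I. x \<in> U i}"
proof -
  obtain N where N: "openin X N" "x \<in> N" "finite {i \<in> I. U i \<inter> N \<noteq> {}}"
    using assms unfolding locally_finite_family_def by blast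
  have "{i \<in> I. x \<in> U i} \<subseteq> {i \<in> I. U i \<inter> N \<noteq> {}}" using N by blast
  then show ?thesis using N finite_subset by blast
qed

lemma locally_finite_family_imp_locally_finite_in:
  assumes "locally_finite_family X I U" "\<And>i. i \<in> I \<Longrightarrow> U i \<subseteq> topspace X"
  shows "locally_finite_in X (U ` I)"
  unfolding locally_finite_in_def
proof (intro conjI ballI)
  show "\<Union> (U ` I) \<subseteq> topspace X" using assms(2) by blast
  fix x assume "x \<in> topspace X"
  then obtain N where N: "openin X N" "x \<in> N" "finite {i \<in> I. U i \<inter> N \<noteq> {}}"
    using assms(1) unfolding locally_finite_family_def by blast
  have "{V \<in> U ` I. V \<inter> N \<noteq> {}} \<subseteq> U ` {i \<in> I. U i \<inter> N \<noteq> {}}" by blast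
  with N show "\<exists>V. openin X V \<and> x \<in> V \<and> finite {A \<in> U ` I. A \<inter> V \<noteq> {}}"
    by (meson finite_imageI finite_subset)
qed

lemma closedin_locally_finite_family_Union:
  assumes "locally_finite_family X I U" "\<And>i. i \<in> I \<Longrightarrow> closedin X (U i)"
  shows "closedin X (\<Union>i\<in>I. U i)"
  using closedin_locally_finite_Union[OF _ locally_finite_family_imp_locally_finite_in[OF assms(1)]]
    assms(2) closedin_subset by (metis imageE)

text \<open>Regularity gives a cover by open sets whose closures lie in some \<open>W i\<close>.
  Each member of a locally finite refinement is assigned to one such index, and \<open>U i\<close>
  unites the members assigned to \<open>i\<close>; its closure stays in \<open>W i\<close> because
  closures commute with locally finite unions.\<close>

lemma locally_finite_shrinking:
  assumes par: "paracompact_space X" and reg: "regular_space X"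
    and W: "\<forall>i\<in>I. openin X (W i)" "topspace X \<subseteq> (\<Union>i\<in>I. W i)"
  shows "\<exists>U. (\<forall>i\<in>I. openin X (U i) \<and> X closure_of U i \<subseteq> W i) \<and>
    locally_finite_family X I U \<and> topspace X = (\<Union>i\<in>I. U i)"
proof -
  define \<O> where "\<O> = {O'. openin X O' \<and> (\<exists>i\<in>I. X closure_of O' \<subseteq> W i)}"
  have "topspace X \<subseteq> \<Union>\<O>"
  proof
    fix x assume x: "x \<in> topspace X"
    then obtain i where i: "i \<in> I" "x \<in> W i" using W by blast
    have "closedin X (topspace X - W i)" using W(1) i(1) by blast
    then obtain O' where "openin X O'" "x \<in> O'" "disjnt (topspace X - W i) (X closure_of O')"
      using reg x i unfolding regular_space by (metis DiffD2 DiffI)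
    moreover have "X closure_of O' \<subseteq> topspace X" by (rule closure_of_subset_topspace)
    ultimately show "x \<in> \<Union>\<O>" unfolding \<O>_def using i by (auto simp: disjnt_iff)
  qed
  moreover have "\<forall>U\<in>\<O>. openin X U" unfolding \<O>_def by blast
  ultimately have "\<exists>\<V>. (\<forall>V\<in>\<V>. openin X V) \<and> topspace X \<subseteq> \<Union>\<V> \<and>
      locally_finite_in X \<V> \<and> (\<forall>V\<in>\<V>. \<exists>U\<in>\<O>. V \<subseteq> U)"
    using par unfolding paracompact_space_def by presburger
  then obtain \<V> where V: "\<forall>V\<in>\<V>. openin X V" "topspace X \<subseteq> \<Union>\<V>" "locally_finite_in X \<V>"
    "\<forall>V\<in>\<V>. \<exists>O'\<in>\<O>. V \<subseteq> O'"
    by blast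
  have "\<forall>V\<in>\<V>. \<exists>i\<in>I. X closure_of V \<subseteq> W i"
  proof
    fix V assume "V \<in> \<V>"
    then obtain O' i where "V \<subseteq> O'" "i \<in> I" "X closure_of O' \<subseteq> W i"
      using V(4) unfolding \<O>_def by blast
    then show "\<exists>i\<in>I. X closure_of V \<subseteq> W i" using closure_of_mono[of V O' X] by blast
  qed
  then obtain c where c: "\<And>V. V \<in> \<V> \<Longrightarrow> c V \<in> I \<and> X closure_of V \<subseteq> W (c V)" by metis
  define U where "U = (\<lambda>i. \<Union>{V \<in> \<V>. c V = i})"
  show ?thesis
  proof (intro exI[of _ U] conjI ballI)
    fix i assume i: "i \<in> I"
    show "openin X (U i)" unfolding U_def using V(1) by blast
    have "locally_finite_in X {V \<in> \<V>. c V = i}"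
      using V(3) by (rule locally_finite_in_subset) auto
    then show "X closure_of U i \<subseteq> W i"
      unfolding U_def using c by (auto simp: closure_of_locally_finite_Union)
  next
    show "topspace X = (\<Union>i\<in>I. U i)"
    proof
      show "topspace X \<subseteq> (\<Union>i\<in>I. U i)" unfolding U_def using V(2) c by blast
      show "(\<Union>i\<in>I. U i) \<subseteq> topspace X" unfolding U_def using V(1) openin_subset by blast
    qed
    show "locally_finite_family X I U" unfolding locally_finite_family_def
    proof
      fix x assume "x \<in> topspace X"
      then obtain N where N: "openin X N" "x \<in> N" "finite {V \<in> \<V>. V \<inter> N \<noteq> {}}"
        using V(3) unfolding locally_finite_in_def by blast
      have "{i \<in> I. U i \<inter> N \<noteq> {}} \<subseteq> c ` {V \<in> \<V>. V \<inter> N \<noteq> {}}" unfolding U_def by blast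
      with N show "\<exists>N. openin X N \<and> x \<in> N \<and> finite {i \<in> I. U i \<inter> N \<noteq> {}}"
        by (meson finite_imageI finite_subset)
    qed
  qed
qed

text \<open>Shrink the cover by the complements of the two closed sets. The complements of the two
  new closures contain \<open>A\<close> and \<open>B\<close>, and they are disjoint because the
  shrunken sets still cover.\<close>

lemma paracompact_regular_imp_normal_space:
  assumes "paracompact_space X" "regular_space X"
  shows "normal_space X"
  unfolding normal_space_def
proof (intro allI impI, elim conjE)
  fix A B assume AB: "closedin X A" "closedin X B" "disjnt A B"
  define W where "W = (\<lambda>b. topspace X - (if b then A else B))"
  have W: "\<forall>i\<in>UNIV. openin X (W i)" using AB unfolding W_def by auto
  have Wc: "topspace X \<subseteq> (\<Union>i\<in>UNIV. W i)"
    unfolding W_def UNIV_bool using AB(3) by (auto simp: disjnt_iff)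
  obtain U where U': "\<forall>i\<in>UNIV. openin X (U i) \<and> X closure_of U i \<subseteq> W i"
    and U3: "topspace X = (\<Union>i\<in>UNIV. U i)"
    using locally_finite_shrinking[OF assms W Wc] by (elim exE conjE) (rule that)
  have U: "openin X (U i)" "X closure_of U i \<subseteq> W i" for i
    using U' by simp_all
  have A: "A \<subseteq> topspace X" "B \<subseteq> topspace X" using AB closedin_subset by auto
  let ?P = "topspace X - X closure_of U True" let ?Q = "topspace X - X closure_of U False"
  have "openin X ?P" "openin X ?Q" by auto
  moreover have "A \<subseteq> ?P" "B \<subseteq> ?Q"
    using U(2)[of True] U(2)[of False] A unfolding W_def by auto
  moreover have "disjnt ?P ?Q"
  proof -
    have "x \<in> U True \<or> x \<in> U False" if "x \<in> topspace X" for x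
      using that unfolding U3 by (metis (full_types) UN_E)
    moreover have "U b \<subseteq> X closure_of U b" for b
      by (rule closure_of_subset[OF openin_subset[OF U(1)]])
    ultimately show ?thesis unfolding disjnt_iff by blast
  qed
  ultimately show "\<exists>U V. openin X U \<and> openin X V \<and> A \<subseteq> U \<and> B \<subseteq> V \<and> disjnt U V"
    by (intro exI[of _ ?P] exI[of _ ?Q] conjI)
qed

lemma normal_space_Urysohn_function:
  assumes "normal_space X" "closedin X A" "closedin X B" "A \<inter> B = {}"
  shows "\<exists>f. continuous_map X euclideanreal f \<and> (\<forall>x\<in>topspace X. 0 \<le> f x \<and> f x \<le> 1) \<and>
    (\<forall>x\<in>A. f x = 0) \<and> (\<forall>x\<in>B. f x = 1)"
proof -
  have d: "disjnt A B" using assms(4) by (simp add: disjnt_def)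
  obtain f where f: "continuous_map X (top_of_set {0..1::real}) f" "f ` A \<subseteq> {0}" "f ` B \<subseteq> {1}"
    using Urysohn_lemma[OF assms(1-3) d zero_le_one[where ?'a=real]] by blast
  then have "continuous_map X euclideanreal f" "\<forall>x\<in>topspace X. 0 \<le> f x \<and> f x \<le> 1"
    by (auto simp: continuous_map_in_subtopology)
  with f show ?thesis by (intro exI[of _ f]) auto
qed

lemma continuous_map_locally:
  assumes "\<And>x. x \<in> topspace X \<Longrightarrow> \<exists>N. openin X N \<and> x \<in> N \<and> continuous_map (subtopology X N) Y f"
  shows "continuous_map X Y f"
proof -
  obtain N where N: "\<And>x. x \<in> topspace X \<Longrightarrow> openin X (N x) \<and> x \<in> N x \<and> continuous_map (subtopology X (N x)) Y f"
    using assms by metis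
  show ?thesis
    by (rule pasting_lemma[of "topspace X" X N Y "\<lambda>_. f"]) (use N in auto)
qed

text \<open>The summation range varies with \<open>x\<close>, but on a small neighbourhood it may be
  replaced by one fixed finite set.\<close>

lemma continuous_map_locally_finite_sum:
  fixes f :: "'i \<Rightarrow> 'a \<Rightarrow> real"
  assumes cont: "\<And>i. i \<in> I \<Longrightarrow> continuous_map X euclideanreal (f i)"
    and lf: "locally_finite_family X I (\<lambda>i. {x \<in> topspace X. f i x \<noteq> 0})"
  shows "continuous_map X euclideanreal (\<lambda>x. \<Sum>i\<in>{i \<in> I. f i x \<noteq> 0}. f i x)"
proof (rule continuous_map_locally)
  fix x assume "x \<in> topspace X"
  then obtain N where N: "openin X N" "x \<in> N" "finite {i \<in> I. {x \<in> topspace X. f i x \<noteq> 0} \<inter> N \<noteq> {}}"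
    using lf unfolding locally_finite_family_def by blast
  define J where "J = {i \<in> I. {x \<in> topspace X. f i x \<noteq> 0} \<inter> N \<noteq> {}}"
  have "continuous_map (subtopology X N) euclideanreal (\<lambda>x. \<Sum>i\<in>J. f i x)"
    by (intro continuous_map_sum continuous_map_from_subtopology cont) (use N J_def in auto)
  moreover have "(\<Sum>i\<in>J. f i y) = (\<Sum>i\<in>{i \<in> I. f i y \<noteq> 0}. f i y)" if "y \<in> topspace (subtopology X N)" for y
    by (rule sum.mono_neutral_right) (use that N(3) in \<open>auto simp: J_def\<close>)
  ultimately have "continuous_map (subtopology X N) euclideanreal (\<lambda>x. \<Sum>i\<in>{i \<in> I. f i x \<noteq> 0}. f i x)"
    by (rule continuous_map_eq)
  with N show "\<exists>N. openin X N \<and> x \<in> N \<and>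
      continuous_map (subtopology X N) euclideanreal (\<lambda>x. \<Sum>i\<in>{i \<in> I. f i x \<noteq> 0}. f i x)" by blast
qed

definition partition_of_unity :: "'a topology \<Rightarrow> 'i set \<Rightarrow> ('i \<Rightarrow> 'a \<Rightarrow> real) \<Rightarrow> bool" where
  "partition_of_unity X I l \<longleftrightarrow>
     (\<forall>i\<in>I. continuous_map X euclideanreal (l i)) \<and> (\<forall>i\<in>I. \<forall>x\<in>topspace X. 0 \<le> l i x) \<and>
     locally_finite_family X I (\<lambda>i. {x \<in> topspace X. l i x \<noteq> 0}) \<and>
     (\<forall>x\<in>topspace X. (\<Sum>i\<in>{i \<in> I. l i x \<noteq> 0}. l i x) = 1)"

text \<open>The cover is shrunk twice: the outer sets \<open>U i\<close> keep the supports locally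
  finite, and the inner sets \<open>V i\<close>, on which \<open>u i\<close> is 1, make the sum
  positive everywhere.\<close>

lemma partition_of_unity_exists:
  assumes par: "paracompact_space X" and reg: "regular_space X"
    and W: "\<forall>i\<in>I. openin X (W i)" "topspace X \<subseteq> (\<Union>i\<in>I. W i)"
  shows "\<exists>l. partition_of_unity X I l \<and> (\<forall>i\<in>I. \<forall>x\<in>topspace X. l i x \<noteq> 0 \<longrightarrow> x \<in> W i)"
proof -
  obtain U where U': "\<forall>i\<in>I. openin X (U i) \<and> X closure_of U i \<subseteq> W i"
    and U3: "locally_finite_family X I U" and U4: "topspace X = (\<Union>i\<in>I. U i)"
    using locally_finite_shrinking[OF par reg W] by (elim exE conjE) (rule that)
  have U: "openin X (U i)" "X closure_of U i \<subseteq> W i" if "i \<in> I" for i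
    using U' that by simp_all
  have U1: "\<forall>i\<in>I. openin X (U i)" using U' by blast
  obtain V where V': "\<forall>i\<in>I. openin X (V i) \<and> X closure_of V i \<subseteq> U i"
    and V3: "topspace X = (\<Union>i\<in>I. V i)"
    using locally_finite_shrinking[OF par reg U1 equalityD1[OF U4]] by (elim exE conjE) (rule that)
  have V: "openin X (V i)" "X closure_of V i \<subseteq> U i" if "i \<in> I" for i
    using V' that by simp_all
  have "\<forall>i\<in>I. \<exists>f. continuous_map X euclideanreal f \<and> (\<forall>x\<in>topspace X. 0 \<le> f x \<and> f x \<le> 1) \<and>
      (\<forall>x\<in>topspace X - U i. f x = 0) \<and> (\<forall>x\<in>X closure_of V i. f x = 1)"
  proof
    fix i assume i: "i \<in> I"
    have "(topspace X - U i) \<inter> (X closure_of V i) = {}" using V(2)[OF i] by auto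
    moreover have "closedin X (topspace X - U i)" using U(1)[OF i] by blast
    ultimately show "\<exists>f. continuous_map X euclideanreal f \<and> (\<forall>x\<in>topspace X. 0 \<le> f x \<and> f x \<le> 1) \<and>
      (\<forall>x\<in>topspace X - U i. f x = 0) \<and> (\<forall>x\<in>X closure_of V i. f x = 1)"
      by (intro normal_space_Urysohn_function paracompact_regular_imp_normal_space par reg closedin_closure_of)
  qed
  from bchoice[OF this] obtain u where u: "\<forall>i\<in>I. continuous_map X euclideanreal (u i) \<and>
      (\<forall>x\<in>topspace X. 0 \<le> u i x \<and> u i x \<le> 1) \<and>
      (\<forall>x\<in>topspace X - U i. u i x = 0) \<and> (\<forall>x\<in>X closure_of V i. u i x = 1)"
    by (elim exE) (rule that)
  have uc: "continuous_map X euclideanreal (u i)" if "i \<in> I" for i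
    using u that by simp
  have u0: "0 \<le> u i x" if "i \<in> I" "x \<in> topspace X" for i x
    using u that by simp
  have uU: "x \<in> U i" if "i \<in> I" "x \<in> topspace X" "u i x \<noteq> 0" for i x
    using u that by blast
  have ulf: "locally_finite_family X I (\<lambda>i. {x \<in> topspace X. u i x \<noteq> 0})"
    by (rule locally_finite_family_mono[OF U3]) (use uU in auto)
  define S where "S = (\<lambda>x. \<Sum>i\<in>{i \<in> I. u i x \<noteq> 0}. u i x)"
  have Sc: "continuous_map X euclideanreal S"
    unfolding S_def by (rule continuous_map_locally_finite_sum[OF uc ulf])
  have fin: "finite {i \<in> I. u i x \<noteq> 0}" if "x \<in> topspace X" for x
    using locally_finite_family_finite_at[OF ulf that] that by simp
  have S0: "S x > 0" if x: "x \<in> topspace X" for x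
  proof -
    obtain i where i: "i \<in> I" "x \<in> V i" using V3 x by blast
    then have "u i x = 1" using u closure_of_subset[OF openin_subset[OF V(1)[OF i(1)]]] i(1) by blast
    then have "1 \<le> S x" unfolding S_def
      using member_le_sum[of i "{i \<in> I. u i x \<noteq> 0}" "\<lambda>i. u i x"] i fin[OF x] u0[OF _ x] by simp
    then show ?thesis by simp
  qed
  define l where "l = (\<lambda>i x. u i x / S x)"
  have lu: "l i x \<noteq> 0 \<longleftrightarrow> u i x \<noteq> 0" if "x \<in> topspace X" for i x
    unfolding l_def using S0[OF that] by simp
  show ?thesis
  proof (intro exI[of _ l] conjI ballI impI)
    show "partition_of_unity X I l" unfolding partition_of_unity_def
    proof (intro conjI ballI)
      show "continuous_map X euclideanreal (l i)" if "i \<in> I" for i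
        unfolding l_def using S0 by (intro continuous_map_real_divide uc Sc that) force
      show "0 \<le> l i x" if "i \<in> I" "x \<in> topspace X" for i x
        unfolding l_def using S0[OF that(2)] u0[OF that] by simp
      show "locally_finite_family X I (\<lambda>i. {x \<in> topspace X. l i x \<noteq> 0})"
        by (rule locally_finite_family_mono[OF ulf]) (use lu in auto)
      show "(\<Sum>i\<in>{i \<in> I. l i x \<noteq> 0}. l i x) = 1" if x: "x \<in> topspace X" for x
      proof -
        have "(\<Sum>i\<in>{i \<in> I. u i x \<noteq> 0}. u i x / S x) = S x / S x"
          unfolding S_def by (rule sum_divide_distrib[symmetric])
        then show ?thesis unfolding lu[OF x] unfolding l_def using S0[OF x] by simp
      qed
    qed
    show "x \<in> W i" if "i \<in> I" "x \<in> topspace X" "l i x \<noteq> 0" for i x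
      using uU that lu U(2) closure_of_subset[OF openin_subset[OF U(1)]] by blast
  qed
qed

lemma partition_of_unity_finite:
  assumes "partition_of_unity X I l" "x \<in> topspace X"
  shows "finite {i \<in> I. l i x \<noteq> 0}"
  using locally_finite_family_finite_at[of X I "\<lambda>i. {x \<in> topspace X. l i x \<noteq> 0}" x] assms
  unfolding partition_of_unity_def by simp

section \<open>Dominance cells\<close>

lemma openin_Collect_less_real:
  assumes "continuous_map X euclideanreal f" "continuous_map X euclideanreal g"
  shows "openin X {x \<in> topspace X. f x < g x}"
proof -
  have "continuous_map X euclideanreal (\<lambda>x. g x - f x)"
    by (intro continuous_map_diff assms)
  from openin_continuous_map_preimage[OF this, of "{0<..}"] show ?thesis by simp
qed

text \<open>For a partition of unity and nonempty \<open>s\<close> this is the preimage of the open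
  star of the barycentre of \<open>s\<close> in the barycentric subdivision of the nerve.\<close>

definition dominance_cell :: "'a topology \<Rightarrow> 'i set \<Rightarrow> ('i \<Rightarrow> 'a \<Rightarrow> real) \<Rightarrow> 'i set \<Rightarrow> 'a set" where
  "dominance_cell X I l s =
     {x \<in> topspace X. (\<forall>i\<in>s. 0 < l i x) \<and> (\<forall>i\<in>s. \<forall>j\<in>I - s. l j x < l i x)}"

text \<open>Near \<open>x\<close> only finitely many functions are nonzero; the others lie below
  those of \<open>s\<close> as soon as the latter are positive, so finitely many comparisons
  remain.\<close>

lemma openin_dominance_cell:
  assumes cont: "\<forall>i\<in>I. continuous_map X euclideanreal (l i)"
    and lf: "locally_finite_family X I (\<lambda>i. {x \<in> topspace X. l i x \<noteq> 0})"
    and s: "finite s" "s \<subseteq> I"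
  shows "openin X (dominance_cell X I l s)"
proof (subst openin_subopen, intro ballI)
  fix x assume x: "x \<in> dominance_cell X I l s"
  then have "x \<in> topspace X" unfolding dominance_cell_def by simp
  then obtain N where N: "openin X N" "x \<in> N" "finite {i \<in> I. {x \<in> topspace X. l i x \<noteq> 0} \<inter> N \<noteq> {}}"
    using lf unfolding locally_finite_family_def by blast
  define J where "J = {i \<in> I. {x \<in> topspace X. l i x \<noteq> 0} \<inter> N \<noteq> {}}"
  define M where "M = N \<inter> ((\<Inter>i\<in>s. {x \<in> topspace X. 0 < l i x}) \<inter> topspace X) \<inter>
    ((\<Inter>p\<in>s \<times> (J - s). {x \<in> topspace X. l (snd p) x < l (fst p) x}) \<inter> topspace X)"
  have J: "finite J" "J \<subseteq> I" using N(3) by (auto simp: J_def)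
  have o1: "openin X ((\<Inter>i\<in>s. {x \<in> topspace X. 0 < l i x}) \<inter> topspace X)"
    by (rule openin_INT[OF s(1)], rule openin_Collect_less_real) (use cont s(2) in auto)
  have o2: "openin X ((\<Inter>p\<in>s \<times> (J - s). {x \<in> topspace X. l (snd p) x < l (fst p) x}) \<inter> topspace X)"
    by (rule openin_INT, use s(1) J(1) in blast, rule openin_Collect_less_real) (use cont s(2) J(2) in auto)
  have "openin X M" unfolding M_def by (rule openin_Int[OF openin_Int[OF N(1) o1] o2])
  moreover have "x \<in> M" using x N(2) J(2) unfolding M_def dominance_cell_def by auto
  moreover have "M \<subseteq> dominance_cell X I l s"
  proof
    fix y assume y: "y \<in> M"
    have 1: "y \<in> topspace X" "y \<in> N" "\<forall>i\<in>s. 0 < l i y" "\<forall>i\<in>s. \<forall>j\<in>J - s. l j y < l i y"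
      using y unfolding M_def by auto
    have "l j y < l i y" if "i \<in> s" "j \<in> I - s" for i j
    proof (cases "j \<in> J")
      case False
      then have "l j y = 0" using 1 that unfolding J_def by blast
      then show ?thesis using 1 that by simp
    qed (use 1 that in blast)
    with 1 show "y \<in> dominance_cell X I l s" unfolding dominance_cell_def by blast
  qed
  ultimately show "\<exists>T. openin X T \<and> x \<in> T \<and> T \<subseteq> dominance_cell X I l s"
    by (intro exI[of _ M] conjI)
qed

text \<open>Different sets of equal size are incomparable, so some \<open>l i\<close> and
  \<open>l j\<close> would each have to exceed the other.\<close>

lemma dominance_cell_disjoint:
  assumes "finite s" "finite t" "card s = card t" "s \<noteq> t" "s \<subseteq> I" "t \<subseteq> I"
  shows "dominance_cell X I l s \<inter> dominance_cell X I l t = {}"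
proof -
  have "\<not> s \<subseteq> t" using card_subset_eq[of t s] assms by metis
  moreover have "\<not> t \<subseteq> s" using card_subset_eq[of s t] assms by metis
  ultimately obtain i j where "i \<in> s - t" "j \<in> t - s" by blast
  then have "l i x < l j x" "l j x < l i x" if "x \<in> dominance_cell X I l s \<inter> dominance_cell X I l t" for x
    using that assms(5,6) unfolding dominance_cell_def by blast+
  then show ?thesis by (meson disjoint_iff IntI less_asym)
qed

lemma in_dominance_cell:
  assumes "x \<in> topspace X" "\<forall>i\<in>I. 0 \<le> l i x"
  shows "x \<in> dominance_cell X I l {i \<in> I. l i x \<noteq> 0}"
  using assms unfolding dominance_cell_def by (auto simp: less_le)

section \<open>Inessential families of pairs\<close>

abbreviation separates ::
  "'a topology \<Rightarrow> nat \<Rightarrow> (nat \<Rightarrow> 'a set) \<Rightarrow> (nat \<Rightarrow> 'a set) \<Rightarrow> (nat \<Rightarrow> 'a set) \<Rightarrow> (nat \<Rightarrow> 'a set) \<Rightarrow> bool" where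
  "separates X k A B P Q \<equiv>
     \<forall>i<k. openin X (P i) \<and> openin X (Q i) \<and> A i \<subseteq> P i \<and> B i \<subseteq> Q i \<and> P i \<inter> Q i = {}"

text \<open>For closed \<open>F\<close> in a normal space this says that \<open>F\<close> has covering dimension less than \<open>k\<close>.\<close>

definition inessential :: "'a topology \<Rightarrow> nat \<Rightarrow> 'a set \<Rightarrow> bool" where
  "inessential X k F \<longleftrightarrow>
     (\<forall>A B. (\<forall>i<k. closedin X (A i) \<and> closedin X (B i) \<and> A i \<subseteq> F \<and> B i \<subseteq> F \<and> A i \<inter> B i = {}) \<longrightarrow>
        (\<exists>P Q. separates X k A B P Q \<and>
               F \<subseteq> (\<Union>i<k. P i \<union> Q i)))"

lemma inessentialD:
  assumes "inessential X k F"
    "\<forall>i<k. closedin X (A i) \<and> closedin X (B i) \<and> A i \<subseteq> F \<and> B i \<subseteq> F \<and> A i \<inter> B i = {}"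
  shows "\<exists>P Q. separates X k A B P Q \<and>
               F \<subseteq> (\<Union>i<k. P i \<union> Q i)"
  using assms(1)[unfolded inessential_def, THEN spec[of _ A], THEN spec[of _ B]] assms(2) by (rule mp)

lemma inessential_subset:
  assumes "inessential X k F" "G \<subseteq> F"
  shows "inessential X k G"
  unfolding inessential_def
proof (intro allI impI)
  fix A B assume AB: "\<forall>i<k. closedin X (A i) \<and> closedin X (B i) \<and> A i \<subseteq> G \<and> B i \<subseteq> G \<and> A i \<inter> B i = {}"
  then have AB': "\<forall>i<k. closedin X (A i) \<and> closedin X (B i) \<and> A i \<subseteq> F \<and> B i \<subseteq> F \<and> A i \<inter> B i = {}"
    using assms(2) by blast
  obtain P Q where "separates X k A B P Q"
    "F \<subseteq> (\<Union>i<k. P i \<union> Q i)"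
    using inessentialD[OF assms(1) AB'] by (elim exE conjE) (rule that)
  with assms(2) show "\<exists>P Q. separates X k A B P Q \<and>
               G \<subseteq> (\<Union>i<k. P i \<union> Q i)" by (intro exI[of _ P] exI[of _ Q]) auto
qed

text \<open>Separations are found on each \<open>S j\<close> independently and cut down to
  \<open>N j\<close>; disjointness of the \<open>N j\<close> prevents a \<open>P\<close> of one
  piece from meeting a \<open>Q\<close> of another.\<close>

lemma inessential_discrete_Union:
  assumes iness: "\<forall>j\<in>I. inessential X k (S j)"
    and S: "\<forall>j\<in>I. closedin X (S j) \<and> openin X (N j) \<and> S j \<subseteq> N j" "disjoint_family_on N I"
  shows "inessential X k (\<Union>j\<in>I. S j)"
  unfolding inessential_def
proof (intro allI impI)
  fix A B assume AB: "\<forall>i<k. closedin X (A i) \<and> closedin X (B i) \<and> A i \<subseteq> (\<Union>j\<in>I. S j) \<and>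
    B i \<subseteq> (\<Union>j\<in>I. S j) \<and> A i \<inter> B i = {}"
  have "\<forall>j\<in>I. \<exists>PQ. (\<forall>i<k. openin X (fst PQ i) \<and> openin X (snd PQ i) \<and> A i \<inter> S j \<subseteq> fst PQ i \<and>
      B i \<inter> S j \<subseteq> snd PQ i \<and> fst PQ i \<inter> snd PQ i = {}) \<and> S j \<subseteq> (\<Union>i<k. fst PQ i \<union> snd PQ i)"
  proof
    fix j assume j: "j \<in> I"
    have "\<forall>i<k. closedin X (A i \<inter> S j) \<and> closedin X (B i \<inter> S j) \<and> A i \<inter> S j \<subseteq> S j \<and> B i \<inter> S j \<subseteq> S j \<and>
      (A i \<inter> S j) \<inter> (B i \<inter> S j) = {}"
      using AB S(1) j by (auto intro!: closedin_Int)
    from inessentialD[OF bspec[OF iness j] this] obtain P Q where "(\<forall>i<k. openin X (P i) \<and> openin X (Q i) \<and> A i \<inter> S j \<subseteq> P i \<and>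
      B i \<inter> S j \<subseteq> Q i \<and> P i \<inter> Q i = {}) \<and> S j \<subseteq> (\<Union>i<k. P i \<union> Q i)"
      by (elim exE) (rule that)
    then show "\<exists>PQ. (\<forall>i<k. openin X (fst PQ i) \<and> openin X (snd PQ i) \<and> A i \<inter> S j \<subseteq> fst PQ i \<and>
      B i \<inter> S j \<subseteq> snd PQ i \<and> fst PQ i \<inter> snd PQ i = {}) \<and> S j \<subseteq> (\<Union>i<k. fst PQ i \<union> snd PQ i)"
      by (intro exI[of _ "(P, Q)"]) simp
  qed
  from bchoice[OF this] obtain PQ where PQ: "\<forall>j\<in>I. (\<forall>i<k. openin X (fst (PQ j) i) \<and> openin X (snd (PQ j) i) \<and>
      A i \<inter> S j \<subseteq> fst (PQ j) i \<and> B i \<inter> S j \<subseteq> snd (PQ j) i \<and> fst (PQ j) i \<inter> snd (PQ j) i = {}) \<and>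
      S j \<subseteq> (\<Union>i<k. fst (PQ j) i \<union> snd (PQ j) i)" by (elim exE) (rule that)
  define P where "P = (\<lambda>i. \<Union>j\<in>I. N j \<inter> fst (PQ j) i)"
  define Q where "Q = (\<lambda>i. \<Union>j\<in>I. N j \<inter> snd (PQ j) i)"
  show "\<exists>P Q. separates X k A B P Q \<and>
               (\<Union>j\<in>I. S j) \<subseteq> (\<Union>i<k. P i \<union> Q i)"
  proof (rule exI[of _ P], rule exI[of _ Q], intro conjI allI impI)
    fix i assume i: "i < k"
    show "openin X (P i)" "openin X (Q i)"
      unfolding P_def Q_def using PQ S(1) i by (auto intro!: openin_Union openin_Int)
    have sub: "A i \<subseteq> (\<Union>j\<in>I. S j)" "B i \<subseteq> (\<Union>j\<in>I. S j)" using AB i by simp_all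
    have PQi: "A i \<inter> S j \<subseteq> fst (PQ j) i" "B i \<inter> S j \<subseteq> snd (PQ j) i" "S j \<subseteq> N j" if "j \<in> I" for j
      using PQ S(1) that i by simp_all
    show "A i \<subseteq> P i"
    proof
      fix x assume x: "x \<in> A i"
      then obtain j where "j \<in> I" "x \<in> S j" using sub by blast
      then show "x \<in> P i" unfolding P_def using PQi[of j] x by blast
    qed
    show "B i \<subseteq> Q i"
    proof
      fix x assume x: "x \<in> B i"
      then obtain j where "j \<in> I" "x \<in> S j" using sub by blast
      then show "x \<in> Q i" unfolding Q_def using PQi[of j] x by blast
    qed
    show "P i \<inter> Q i = {}"
    proof -
      { fix x assume "x \<in> P i \<inter> Q i"
        then obtain j j' where j: "j \<in> I" "j' \<in> I" "x \<in> N j" "x \<in> N j'" "x \<in> fst (PQ j) i" "x \<in> snd (PQ j') i"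
          unfolding P_def Q_def by blast
        then have "j = j'" using S(2) unfolding disjoint_family_on_def by blast
        then have False using PQ j i by blast }
      then show ?thesis by blast
    qed
  next
    show "(\<Union>j\<in>I. S j) \<subseteq> (\<Union>i<k. P i \<union> Q i)"
    proof
      fix x assume "x \<in> (\<Union>j\<in>I. S j)"
      then obtain j where j: "j \<in> I" "x \<in> S j" by blast
      then have "x \<in> N j" using S(1) by blast
      moreover obtain i where "i < k" "x \<in> fst (PQ j) i \<or> x \<in> snd (PQ j) i" using PQ j by blast
      ultimately show "x \<in> (\<Union>i<k. P i \<union> Q i)" unfolding P_def Q_def using j(1) by blast
    qed
  qed
qed

lemma normal_space_separation_family:
  assumes "normal_space X" "\<forall>i<k. closedin X (A i) \<and> closedin X (B i) \<and> A i \<inter> B i = {}"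
  shows "\<exists>P Q. \<forall>i<(k::nat). openin X (P i) \<and> openin X (Q i) \<and> A i \<subseteq> P i \<and> B i \<subseteq> Q i \<and> P i \<inter> Q i = {}"
proof -
  have "\<forall>i\<in>{..<k}. \<exists>PQ. openin X (fst PQ) \<and> openin X (snd PQ) \<and> A i \<subseteq> fst PQ \<and> B i \<subseteq> snd PQ \<and> fst PQ \<inter> snd PQ = {}"
  proof
    fix i assume "i \<in> {..<k}"
    then have "closedin X (A i)" "closedin X (B i)" "disjnt (A i) (B i)"
      using assms(2) by (auto simp: disjnt_def)
    then obtain P Q where "openin X P" "openin X Q" "A i \<subseteq> P" "B i \<subseteq> Q" "disjnt P Q"
      using assms(1) unfolding normal_space_def by meson
    then show "\<exists>PQ. openin X (fst PQ) \<and> openin X (snd PQ) \<and> A i \<subseteq> fst PQ \<and> B i \<subseteq> snd PQ \<and> fst PQ \<inter> snd PQ = {}"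
      by (intro exI[of _ "(P, Q)"]) (simp add: disjnt_def)
  qed
  from bchoice[OF this] obtain PQ where
    "\<forall>i\<in>{..<k}. openin X (fst (PQ i)) \<and> openin X (snd (PQ i)) \<and> A i \<subseteq> fst (PQ i) \<and> B i \<subseteq> snd (PQ i) \<and> fst (PQ i) \<inter> snd (PQ i) = {}"
    by (elim exE) (rule that)
  then show ?thesis by (intro exI[of _ "\<lambda>i. fst (PQ i)"] exI[of _ "\<lambda>i. snd (PQ i)"]) simp
qed

lemma functionally_open_imp_openin:
  assumes "functionally_open X U" shows "openin X U"
proof -
  obtain f where f: "continuous_map X euclideanreal f" "U = {x \<in> topspace X. f x \<noteq> 0}"
    using assms unfolding functionally_open_def by blast
  from openin_continuous_map_preimage[OF f(1), of "- {0}"] f(2) show ?thesis by (simp add: open_Compl)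
qed

lemma finite_C_spaceD:
  assumes "finite_C_space X"
    "\<forall>n\<ge>1. finite (\<omega> n) \<and> (\<forall>U\<in>\<omega> n. functionally_open X U) \<and> \<Union>(\<omega> n) = topspace X"
  shows "\<exists>k. \<exists>\<gamma> :: nat \<Rightarrow> 'a set set.
               (\<forall>n\<in>{1..k}. finite (\<gamma> n) \<and> (\<forall>V\<in>\<gamma> n. functionally_open X V) \<and>
                            pairwise disjnt (\<gamma> n) \<and> refines (\<gamma> n) (\<omega> n)) \<and>
               topspace X \<subseteq> (\<Union>n\<in>{1..k}. \<Union>(\<gamma> n))"
  using assms(1)[unfolded finite_C_space_def, THEN spec[of _ \<omega>]] assms(2) by (rule mp)

text \<open>If infinitely many of the \<open>S j\<close> had essential families of unbounded length, these could be
  merged, the family being discrete, into a sequence of binary covers without disjoint refinements.\<close>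

lemma finite_C_inessential_eventually:
  fixes S :: "nat \<Rightarrow> 'a set"
  assumes fin: "finite_C_space X" and par: "paracompact_space X" and reg: "regular_space X"
    and clo: "\<And>j. closedin X (S j)" and disj: "disjoint_family S"
    and lf: "locally_finite_family X UNIV S"
  shows "\<exists>J. \<forall>j\<ge>J. inessential X J (S j)"
proof (rule ccontr)
  assume neg: "\<nexists>J. \<forall>j\<ge>J. inessential X J (S j)"
  have nor: "normal_space X" by (rule paracompact_regular_imp_normal_space[OF par reg])
  define bad where "bad = (\<lambda>k j. \<not> inessential X k (S j))"
  have bad: "\<exists>j\<ge>J. bad J j" for J using neg unfolding bad_def by blast
  \<comment> \<open>Lengths are capped by \<open>j\<close> so that a largest failing length exists.
    If \<open>S j\<close> fails for some \<open>k \<le> j\<close>, then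
    \<open>k \<le> \<kappa> j\<close>; the negated claim supplies such a \<open>j\<close> for every
    \<open>k\<close>.\<close>
  have "\<forall>j. \<exists>k. (\<exists>k'\<le>j. bad k' j) \<longrightarrow> bad k j \<and> (\<forall>k'\<le>j. bad k' j \<longrightarrow> k' \<le> k)"
  proof
    fix j
    show "\<exists>k. (\<exists>k'\<le>j. bad k' j) \<longrightarrow> bad k j \<and> (\<forall>k'\<le>j. bad k' j \<longrightarrow> k' \<le> k)"
    proof (cases "\<exists>k'\<le>j. bad k' j")
      case True
      let ?K = "{k'. k' \<le> j \<and> bad k' j}"
      have K: "finite ?K" "?K \<noteq> {}" using True by auto
      have "Max ?K \<in> ?K" by (rule Max_in[OF K])
      moreover have "\<forall>k'\<le>j. bad k' j \<longrightarrow> k' \<le> Max ?K" using Max_ge[OF K(1)] by simp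
      ultimately show ?thesis by blast
    qed blast
  qed
  then obtain \<kappa> where \<kappa>: "\<forall>j. (\<exists>k'\<le>j. bad k' j) \<longrightarrow> bad (\<kappa> j) j \<and> (\<forall>k'\<le>j. bad k' j \<longrightarrow> k' \<le> \<kappa> j)"
    by metis
  define good where "good = (\<lambda>(k::nat) j A B. \<forall>i<k. closedin X (A i) \<and> closedin X (B i) \<and> A i \<subseteq> S j \<and> B i \<subseteq> S j \<and> A i \<inter> B i = {})"
  define sep where "sep = (\<lambda>(k::nat) j A B. \<exists>P Q. separates X k A B P Q \<and>
               S j \<subseteq> (\<Union>i<k. P i \<union> Q i))"
  have bad_iff: "bad k j \<longleftrightarrow> (\<exists>A B. good k j A B \<and> \<not> sep k j A B)" for k j
    unfolding bad_def inessential_def good_def sep_def by simp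
  define G where "G = {j. bad (\<kappa> j) j}"
  have "\<forall>j\<in>G. \<exists>A B. good (\<kappa> j) j A B \<and> \<not> sep (\<kappa> j) j A B"
    unfolding G_def bad_iff by blast
  then obtain A B where AB: "\<forall>j\<in>G. good (\<kappa> j) j (A j) (B j) \<and> \<not> sep (\<kappa> j) j (A j) (B j)"
    by metis
  have AB1: "closedin X (A j i)" "closedin X (B j i)" "A j i \<subseteq> S j" "B j i \<subseteq> S j" "A j i \<inter> B j i = {}"
    if "j \<in> G" "i < \<kappa> j" for i j
    using AB that unfolding good_def by simp_all
  define A' where "A' = (\<lambda>i. \<Union>j\<in>{j \<in> G. i < \<kappa> j}. A j i)"
  define B' where "B' = (\<lambda>i. \<Union>j\<in>{j \<in> G. i < \<kappa> j}. B j i)"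
  have lf': "locally_finite_family X {j \<in> G. i < \<kappa> j} S" for i
    using lf unfolding locally_finite_family_def by (auto intro: rev_finite_subset)
  have cA: "closedin X (A' i)" for i
    unfolding A'_def
    by (rule closedin_locally_finite_family_Union[OF locally_finite_family_mono[OF lf'[of i]]]) (use AB1 in auto)
  have cB: "closedin X (B' i)" for i
    unfolding B'_def
    by (rule closedin_locally_finite_family_Union[OF locally_finite_family_mono[OF lf'[of i]]]) (use AB1 in auto)
  have dAB: "A' i \<inter> B' i = {}" for i
  proof -
    { fix x assume "x \<in> A' i" "x \<in> B' i"
      then obtain j j' where j: "j \<in> G" "i < \<kappa> j" "x \<in> A j i" "j' \<in> G" "i < \<kappa> j'" "x \<in> B j' i"
        unfolding A'_def B'_def by blast
      then have "x \<in> S j \<inter> S j'" using AB1 by blast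
      then have "j = j'" using disj unfolding disjoint_family_on_def by blast
      then have False using AB1(5)[OF j(1,2)] j by blast }
    then show ?thesis by blast
  qed
  have "\<forall>i. \<exists>u. continuous_map X euclideanreal u \<and> (\<forall>x\<in>A' i. u x = 0) \<and> (\<forall>x\<in>B' i. u x = 1)"
    using normal_space_Urysohn_function[OF nor cA cB dAB] by blast
  then obtain u where u: "\<forall>i. continuous_map X euclideanreal (u i) \<and> (\<forall>x\<in>A' i. u i x = 0) \<and> (\<forall>x\<in>B' i. u i x = (1::real))"
    by metis
  \<comment> \<open>Covers are counted from 1 and pairs from 0, hence \<open>n - 1\<close>.\<close>
  define \<omega> where "\<omega> = (\<lambda>n. {{x \<in> topspace X. u (n - 1) x \<noteq> 0}, {x \<in> topspace X. u (n - 1) x - 1 \<noteq> 0}})"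
  have "\<forall>n\<ge>1. finite (\<omega> n) \<and> (\<forall>U\<in>\<omega> n. functionally_open X U) \<and> \<Union>(\<omega> n) = topspace X"
  proof (intro allI impI conjI ballI)
    fix n :: nat
    show "finite (\<omega> n)" unfolding \<omega>_def by simp
    show "\<Union>(\<omega> n) = topspace X" unfolding \<omega>_def by auto
    fix U assume U: "U \<in> \<omega> n"
    have "continuous_map X euclideanreal (u (n - 1))" "continuous_map X euclideanreal (\<lambda>x. u (n - 1) x - 1)"
      using u by (auto intro!: continuous_map_diff)
    then show "functionally_open X U" using U unfolding \<omega>_def functionally_open_def by blast
  qed
  from finite_C_spaceD[OF fin this] obtain k \<gamma> where
    \<gamma>: "\<forall>n\<in>{1..k}. finite (\<gamma> n) \<and> (\<forall>V\<in>\<gamma> n. functionally_open X V) \<and>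
                            pairwise disjnt (\<gamma> n) \<and> refines (\<gamma> n) (\<omega> n)"
      "topspace X \<subseteq> (\<Union>n\<in>{1..k}. \<Union>(\<gamma> n))" by (elim exE conjE) (rule that)
  \<comment> \<open>The flag \<open>b\<close> records whether a member avoids the value 1 of
    \<open>u n\<close>. A member that does not must lie in the other set of the binary cover and so
    avoids the value 0.\<close>
  define V where "V = (\<lambda>(n, b). \<Union>{V \<in> \<gamma> (Suc n). b \<longleftrightarrow> V \<subseteq> {x \<in> topspace X. u n x - 1 \<noteq> 0}})"
  have Vo: "\<forall>p\<in>{..<k} \<times> UNIV. openin X (V p)"
  proof
    fix p :: "nat \<times> bool" assume "p \<in> {..<k} \<times> UNIV"
    then have "Suc (fst p) \<in> {1..k}" by auto
    then have "\<forall>V\<in>\<gamma> (Suc (fst p)). openin X V"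
      using \<gamma>(1) functionally_open_imp_openin by blast
    then show "openin X (V p)" unfolding V_def by (cases p) (auto intro!: openin_Union)
  qed
  have Vc: "topspace X \<subseteq> (\<Union>p\<in>{..<k} \<times> UNIV. V p)"
  proof
    fix x assume "x \<in> topspace X"
    then obtain n W where n: "n \<in> {1..k}" "W \<in> \<gamma> n" "x \<in> W" using \<gamma>(2) by blast
    then have "x \<in> V (n - 1, W \<subseteq> {x \<in> topspace X. u (n - 1) x - 1 \<noteq> 0})" unfolding V_def by auto
    moreover have "n - 1 < k" using n(1) by auto
    ultimately show "x \<in> (\<Union>p\<in>{..<k} \<times> UNIV. V p)" by blast
  qed
  have Vd: "V (n, True) \<inter> V (n, False) = {}" if "n < k" for n
  proof -
    have "pairwise disjnt (\<gamma> (Suc n))" using \<gamma>(1) that by simp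
    then show ?thesis unfolding V_def pairwise_def disjnt_def by auto
  qed
  have V1: "u n x \<noteq> 1" if "x \<in> V (n, True)" for n x
    using that unfolding V_def by auto
  have V2: "u n x \<noteq> 0" if nk: "n < k" and xV: "x \<in> V (n, False)" for n x
  proof -
    obtain W where W: "W \<in> \<gamma> (Suc n)" "\<not> W \<subseteq> {x \<in> topspace X. u n x - 1 \<noteq> 0}" "x \<in> W"
      using xV unfolding V_def by auto
    have "refines (\<gamma> (Suc n)) (\<omega> (Suc n))" using \<gamma>(1) nk by simp
    then have "W \<subseteq> {x \<in> topspace X. u n x \<noteq> 0}"
      using W unfolding refines_def \<omega>_def by auto
    with W(3) show ?thesis by blast
  qed
  obtain U where U': "\<forall>p\<in>{..<k} \<times> UNIV. openin X (U p) \<and> X closure_of U p \<subseteq> V p"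
    and U4: "topspace X = (\<Union>p\<in>{..<k} \<times> UNIV. U p)"
    using locally_finite_shrinking[OF par reg Vo Vc] by (elim exE conjE) (rule that)
  obtain j where j: "k \<le> j" "bad k j" using bad by blast
  then have "j \<in> G" "k \<le> \<kappa> j" using \<kappa> unfolding G_def by auto
  \<comment> \<open>\<open>u i\<close> is 0 on \<open>A j i\<close> and 1 on \<open>B j i\<close>,
    so enlarging the pair by the closed sets taken from the cover keeps it disjoint. A separation of
    the enlarged pairs covers \<open>S j\<close> by the indices below \<open>k\<close> alone,
    contradicting the choice of the pairs.\<close>
  define A2 where "A2 = (\<lambda>i. A j i \<union> (if i < k then X closure_of U (i, True) else {}))"
  define B2 where "B2 = (\<lambda>i. B j i \<union> (if i < k then X closure_of U (i, False) else {}))"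
  have "\<forall>i<\<kappa> j. closedin X (A2 i) \<and> closedin X (B2 i) \<and> A2 i \<inter> B2 i = {}"
  proof (intro allI impI conjI)
    fix i assume i: "i < \<kappa> j"
    note AB1 = AB1[OF \<open>j \<in> G\<close> i]
    show "closedin X (A2 i)" "closedin X (B2 i)" unfolding A2_def B2_def using AB1 by auto
    have "A j i \<subseteq> A' i" "B j i \<subseteq> B' i" unfolding A'_def B'_def using \<open>j \<in> G\<close> i by auto
    then have u01: "u i x = 0" if "x \<in> A j i" for x using u that by blast
    have u1: "u i x = 1" if "x \<in> B j i" for x using u \<open>B j i \<subseteq> B' i\<close> that by blast
    have "A j i \<inter> X closure_of U (i, False) = {} \<and> X closure_of U (i, True) \<inter> B j i = {} \<and>
        X closure_of U (i, True) \<inter> X closure_of U (i, False) = {}" if "i < k"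
    proof -
      have "X closure_of U (i, b) \<subseteq> V (i, b)" for b using U' that by blast
      then show ?thesis using V1[of _ i] V2[OF that] Vd[OF that] u01 u1 by blast
    qed
    then show "A2 i \<inter> B2 i = {}"
      unfolding A2_def B2_def using AB1(5) by (cases "i < k") (simp_all, blast)
  qed
  from normal_space_separation_family[OF nor this] obtain P Q where
    PQ: "\<forall>i<\<kappa> j. openin X (P i) \<and> openin X (Q i) \<and> A2 i \<subseteq> P i \<and> B2 i \<subseteq> Q i \<and> P i \<inter> Q i = {}"
    by (elim exE) (rule that)
  have "S j \<subseteq> (\<Union>i<\<kappa> j. P i \<union> Q i)"
  proof
    fix x assume "x \<in> S j"
    then have "x \<in> topspace X" using closedin_subset[OF clo] by blast
    then obtain i b where i: "i < k" "x \<in> U (i, b)" using U4 by auto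
    then have "x \<in> X closure_of U (i, b)"
      using U' closure_of_subset[OF openin_subset, of X "U (i, b)"] by blast
    then have "x \<in> A2 i \<union> B2 i" unfolding A2_def B2_def using i(1) by (cases b) auto
    moreover have "i < \<kappa> j" using i(1) \<open>k \<le> \<kappa> j\<close> by simp
    ultimately show "x \<in> (\<Union>i<\<kappa> j. P i \<union> Q i)" using PQ by blast
  qed
  moreover have "\<forall>i<\<kappa> j. openin X (P i) \<and> openin X (Q i) \<and> A j i \<subseteq> P i \<and> B j i \<subseteq> Q i \<and> P i \<inter> Q i = {}"
    using PQ unfolding A2_def B2_def by simp
  ultimately have "sep (\<kappa> j) j (A j) (B j)"
    unfolding sep_def by (intro exI[of _ P] exI[of _ Q] conjI)
  then show False using AB \<open>j \<in> G\<close> by blast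
qed

section \<open>Strips\<close>

text \<open>Bands of equal parity \<open>e\<close> are at distance 1 in the values of
  \<open>h\<close>. The margin 1/2 of the open bands below is the largest that keeps them
  disjoint.\<close>

definition strip :: "'a topology \<Rightarrow> ('a \<Rightarrow> real) \<Rightarrow> nat \<Rightarrow> nat \<Rightarrow> 'a set" where
  "strip X h e j = {x \<in> topspace X. real (2 * j + e) \<le> h x \<and> h x \<le> real (2 * j + e) + 1}"

definition open_strip :: "'a topology \<Rightarrow> ('a \<Rightarrow> real) \<Rightarrow> nat \<Rightarrow> nat \<Rightarrow> 'a set" where
  "open_strip X h e j = {x \<in> topspace X. real (2 * j + e) - 1 / 2 < h x \<and> h x < real (2 * j + e) + 3 / 2}"

lemma closedin_strip:
  assumes "continuous_map X euclideanreal h" shows "closedin X (strip X h e j)"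
  using closedin_continuous_map_preimage[OF assms, of "{real (2 * j + e)..real (2 * j + e) + 1}"]
  unfolding strip_def by simp

lemma openin_open_strip:
  assumes "continuous_map X euclideanreal h" shows "openin X (open_strip X h e j)"
  using openin_continuous_map_preimage[OF assms, of "{real (2 * j + e) - 1 / 2<..<real (2 * j + e) + 3 / 2}"]
  unfolding open_strip_def by simp

lemma strip_subset_open_strip: "strip X h e j \<subseteq> open_strip X h e j"
  unfolding strip_def open_strip_def by auto

lemma disjoint_family_open_strip: "disjoint_family (open_strip X h e)"
  unfolding disjoint_family_on_def
proof (intro ballI impI)
  fix i j :: nat assume "i \<noteq> j"
  then have "real i + 1 \<le> real j \<or> real j + 1 \<le> real i" by linarith
  then show "open_strip X h e i \<inter> open_strip X h e j = {}"
    unfolding open_strip_def by auto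
qed

lemma locally_finite_strip:
  assumes h: "continuous_map X euclideanreal h"
  shows "locally_finite_family X UNIV (strip X h e)"
  unfolding locally_finite_family_def
proof
  fix x assume x: "x \<in> topspace X"
  let ?N = "{y \<in> topspace X. h y \<in> {..<h x + 1}}"
  have "openin X ?N" by (rule openin_continuous_map_preimage[OF h]) simp
  moreover have "{j \<in> UNIV. strip X h e j \<inter> ?N \<noteq> {}} \<subseteq> {..nat \<lceil>h x + 1\<rceil>}"
  proof
    fix j assume "j \<in> {j \<in> UNIV. strip X h e j \<inter> ?N \<noteq> {}}"
    then obtain y where "real (2 * j + e) \<le> h y" "h y < h x + 1" unfolding strip_def by auto
    then have "real j \<le> h x + 1" by simp
    then show "j \<in> {..nat \<lceil>h x + 1\<rceil>}" by (simp add: le_nat_iff) linarith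
  qed
  ultimately show "\<exists>N. openin X N \<and> x \<in> N \<and> finite {j \<in> UNIV. strip X h e j \<inter> N \<noteq> {}}"
    using x by (intro exI[of _ ?N] conjI) (auto intro: finite_subset)
qed

lemma strip_cover:
  assumes "x \<in> topspace X" "real m \<le> h x"
  shows "\<exists>e<2. \<exists>j. m \<le> 2 * j + e \<and> x \<in> strip X h e j"
proof -
  define n where "n = nat \<lfloor>h x\<rfloor>"
  have n: "real n \<le> h x" "h x \<le> real n + 1" "m \<le> n"
    using assms(2) unfolding n_def by linarith+
  have "2 * (n div 2) + n mod 2 = n" by simp
  then have "x \<in> strip X h (n mod 2) (n div 2)"
    unfolding strip_def using n assms(1) by simp
  then show ?thesis using n(3) \<open>2 * (n div 2) + n mod 2 = n\<close>
    by (intro exI[of _ "n mod 2"] conjI exI[of _ "n div 2"]) auto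
qed

text \<open>The tail starts at the same \<open>J\<close> that bounds the lengths, so its strips are
  inessential for one common length and form a discrete family.\<close>

lemma finite_C_inessential_strips:
  assumes fin: "finite_C_space X" and par: "paracompact_space X" and reg: "regular_space X"
    and h: "continuous_map X euclideanreal h"
  shows "\<exists>J. inessential X J (\<Union>j\<in>{J..}. strip X h e j)"
proof -
  have d: "disjoint_family (strip X h e)"
    using disjoint_family_open_strip[of X h e] strip_subset_open_strip[of X h e]
    unfolding disjoint_family_on_def by blast
  obtain J where J: "\<forall>j\<ge>J. inessential X J (strip X h e j)"
    using finite_C_inessential_eventually[OF fin par reg closedin_strip[OF h] d locally_finite_strip[OF h]]
    by (elim exE) (rule that)
  have "inessential X J (\<Union>j\<in>{J..}. strip X h e j)"
  proof (rule inessential_discrete_Union)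
    show "\<forall>j\<in>{J..}. inessential X J (strip X h e j)" using J by simp
    show "\<forall>j\<in>{J..}. closedin X (strip X h e j) \<and> openin X (open_strip X h e j) \<and> strip X h e j \<subseteq> open_strip X h e j"
      by (intro ballI conjI closedin_strip openin_open_strip h strip_subset_open_strip)
    show "disjoint_family_on (open_strip X h e) {J..}"
      using disjoint_family_open_strip[of X h e] unfolding disjoint_family_on_def by blast
  qed
  then show ?thesis by blast
qed

section \<open>From pairs to covers\<close>

text \<open>This is the usual passage from pairs to covers: \<open>F - W i\<close> is paired with a
  closed part of \<open>W i\<close>. Only \<open>k\<close> of the \<open>k + 1\<close> sets yield
  pairs; the last one absorbs what their separations leave over.\<close>

lemma inessential_shrink_Inter:
  assumes par: "paracompact_space X" and reg: "regular_space X"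
    and iness: "inessential X k F" and F: "closedin X F"
    and W: "\<forall>i\<le>k. openin X (W i)" "F \<subseteq> (\<Union>i\<le>k. W i)"
  shows "\<exists>W'. (\<forall>i\<le>k. openin X (W' i) \<and> W' i \<subseteq> W i) \<and> F \<subseteq> (\<Union>i\<le>k. W' i) \<and> (\<Inter>i\<le>k. W' i) = {}"
proof -
  \<comment> \<open>The index \<open>Suc k\<close> carries the complement of \<open>F\<close>, which
    completes the sets to a cover of \<open>X\<close>.\<close>
  define W0 where "W0 = (\<lambda>i. if i \<le> k then W i else topspace X - F)"
  have W0: "\<forall>i\<in>{..Suc k}. openin X (W0 i)" unfolding W0_def using W(1) F by auto
  have W0c: "topspace X \<subseteq> (\<Union>i\<in>{..Suc k}. W0 i)"
  proof
    fix x assume x: "x \<in> topspace X"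
    show "x \<in> (\<Union>i\<in>{..Suc k}. W0 i)"
    proof (cases "x \<in> F")
      case True
      then obtain i where "i \<le> k" "x \<in> W i" using W(2) by blast
      then have "x \<in> W0 i" "i \<in> {..Suc k}" unfolding W0_def by auto
      then show ?thesis by blast
    next
      case False
      then have "x \<in> W0 (Suc k)" unfolding W0_def using x by simp
      then show ?thesis by blast
    qed
  qed
  obtain U where U: "\<forall>i\<in>{..Suc k}. openin X (U i) \<and> X closure_of U i \<subseteq> W0 i"
    and Uc: "topspace X = (\<Union>i\<in>{..Suc k}. U i)"
    using locally_finite_shrinking[OF par reg W0 W0c] by (elim exE conjE) (rule that)
  define A where "A = (\<lambda>i. F - W i)"
  define B where "B = (\<lambda>i. X closure_of U i \<inter> F)"
  have Bsub: "B i \<subseteq> W i" if "i \<le> k" for i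
  proof -
    have "X closure_of U i \<subseteq> W0 i" using U that by simp
    then show ?thesis using that unfolding B_def W0_def by auto
  qed
  have Bc: "\<exists>i\<le>k. x \<in> B i" if "x \<in> F" for x
  proof -
    have "x \<in> topspace X" using that closedin_subset[OF F] by blast
    then obtain i where i: "i \<le> Suc k" "x \<in> U i" unfolding Uc by blast
    then have "x \<in> X closure_of U i" using U closure_of_subset[OF openin_subset, of X "U i"] by blast
    moreover have "i \<noteq> Suc k"
    proof
      assume "i = Suc k"
      then have "x \<in> W0 (Suc k)" using U calculation by blast
      then show False using that unfolding W0_def by simp
    qed
    ultimately show ?thesis using i(1) that unfolding B_def by (intro exI[of _ i]) auto
  qed
  have AB: "\<forall>i<k. closedin X (A i) \<and> closedin X (B i) \<and> A i \<subseteq> F \<and> B i \<subseteq> F \<and> A i \<inter> B i = {}"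
  proof (intro allI impI conjI)
    fix i assume i: "i < k"
    show "closedin X (A i)" unfolding A_def using F W(1) i by (intro closedin_diff) auto
    show "closedin X (B i)" unfolding B_def using F by (intro closedin_Int) auto
    show "A i \<inter> B i = {}" unfolding A_def using Bsub[of i] i by auto
  qed (auto simp: A_def B_def)
  obtain P Q where PQ: "separates X k A B P Q"
    and PQc: "F \<subseteq> (\<Union>i<k. P i \<union> Q i)"
    using inessentialD[OF iness AB] by (elim exE conjE) (rule that)
  \<comment> \<open>A point of \<open>F\<close> in no \<open>Q i\<close> lies in no
    \<open>B i\<close> with \<open>i < k\<close>, hence in \<open>W k\<close> and in some
    \<open>P i\<close>. Conversely, a point of \<open>W' k\<close> lies in some \<open>P i\<close>,
    hence outside \<open>Q i\<close> and \<open>W' i\<close>.\<close>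
  define W' where "W' = (\<lambda>i. if i < k then Q i \<inter> W i else W i \<inter> (\<Union>i<k. P i))"
  show ?thesis
  proof (intro exI[of _ W'] conjI allI impI)
    fix i assume i: "i \<le> k"
    show "openin X (W' i)" unfolding W'_def using PQ W(1) i by (auto intro!: openin_Int openin_Union)
    show "W' i \<subseteq> W i" unfolding W'_def by auto
  next
    show "F \<subseteq> (\<Union>i\<le>k. W' i)"
    proof
      fix x assume x: "x \<in> F"
      show "x \<in> (\<Union>i\<le>k. W' i)"
      proof (cases "\<exists>i<k. x \<in> Q i")
        case True
        then obtain i where i: "i < k" "x \<in> Q i" by blast
        then have "x \<notin> A i" using PQ by blast
        then have "x \<in> W' i" unfolding W'_def A_def using i x by simp
        then show ?thesis using i(1) by auto
      next
        case False
        then have "x \<notin> B i" if "i < k" for i using PQ that by blast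
        then have "x \<in> B k" using Bc[OF x] by (metis le_neq_implies_less)
        then have "x \<in> W k" using Bsub by blast
        moreover have "x \<in> (\<Union>i<k. P i)" using PQc x False by blast
        ultimately have "x \<in> W' k" unfolding W'_def by simp
        then show ?thesis by auto
      qed
    qed
    show "(\<Inter>i\<le>k. W' i) = {}"
    proof -
      { fix x assume x: "x \<in> (\<Inter>i\<le>k. W' i)"
        then have "x \<in> W' k" by simp
        then obtain i where i: "i < k" "x \<in> P i" unfolding W'_def by auto
        have "x \<in> W' i" using x i(1) by simp
        then have "x \<in> Q i" unfolding W'_def using i(1) by simp
        then have False using PQ i by blast }
      then show ?thesis by blast
    qed
  qed
qed

text \<open>The sets \<open>T\<close> of \<open>k + 1\<close> indices are treated one by one. Sets
  only shrink on the way, so an intersection once made empty stays empty.\<close>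

lemma inessential_shrink_order:
  assumes par: "paracompact_space X" and reg: "regular_space X"
    and iness: "inessential X k F" and F: "closedin X F" and I: "finite I"
    and W: "\<forall>i\<in>I. openin X (W i)" "F \<subseteq> (\<Union>i\<in>I. W i)"
  shows "\<exists>W'. (\<forall>i\<in>I. openin X (W' i) \<and> W' i \<subseteq> W i) \<and> F \<subseteq> (\<Union>i\<in>I. W' i) \<and>
           (\<forall>T\<subseteq>I. card T = Suc k \<longrightarrow> (\<Inter>i\<in>T. W' i) = {})"
proof -
  define \<S> where "\<S> = {T. T \<subseteq> I \<and> card T = Suc k}"
  have "finite \<S>" unfolding \<S>_def using I by simp
  have "\<exists>W'. (\<forall>i\<in>I. openin X (W' i) \<and> W' i \<subseteq> W i) \<and> F \<subseteq> (\<Union>i\<in>I. W' i) \<and> (\<forall>T\<in>\<T>. (\<Inter>i\<in>T. W' i) = {})"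
    if "finite \<T>" "\<T> \<subseteq> \<S>" for \<T>
    using that
  proof (induction \<T>)
    case empty
    then show ?case using W by (intro exI[of _ W]) simp
  next
    case (insert T \<T>)
    then have T: "T \<subseteq> I" "card T = Suc k" unfolding \<S>_def by auto
    have T\<T>: "\<T> \<subseteq> \<S>" using insert.prems by simp
    obtain W1 where W1: "\<forall>i\<in>I. openin X (W1 i) \<and> W1 i \<subseteq> W i" "F \<subseteq> (\<Union>i\<in>I. W1 i)"
      "\<forall>T\<in>\<T>. (\<Inter>i\<in>T. W1 i) = {}"
      using insert.IH[OF T\<T>] by (elim exE conjE) (rule that)
    have "finite T" using T(1) I finite_subset by blast
    from ex_bij_betw_nat_finite[OF this] obtain t where t: "bij_betw t {0..<Suc k} T"
      unfolding T(2) by (elim exE) (rule that)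
    define s where "s = the_inv_into {0..<Suc k} t"
    have s: "s (t j) = j" "t j \<in> T" if "j \<le> k" for j
      using t that unfolding s_def bij_betw_def by (auto simp: the_inv_into_f_f)
    \<comment> \<open>The indices outside \<open>T\<close> are grouped with the last member of
      \<open>T\<close>, so that exactly \<open>k + 1\<close> sets cover \<open>F\<close>. Below,
      \<open>r\<close> finds the group of an index, and its set is cut down to the shrunken
      group.\<close>
    define Z where "Z = (\<lambda>j. if j < k then W1 (t j) else W1 (t j) \<union> (\<Union>i\<in>I - T. W1 i))"
    have Z1: "\<forall>j\<le>k. openin X (Z j)"
    proof (intro allI impI)
      fix j assume "j \<le> k"
      then have "openin X (W1 (t j))" using W1(1) s(2) T(1) by blast
      moreover have "openin X (\<Union>i\<in>I - T. W1 i)" using W1(1) by blast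
      ultimately show "openin X (Z j)" unfolding Z_def by auto
    qed
    have Z2: "F \<subseteq> (\<Union>j\<le>k. Z j)"
    proof
      fix x assume "x \<in> F"
      then obtain i where i: "i \<in> I" "x \<in> W1 i" using W1(2) by blast
      show "x \<in> (\<Union>j\<le>k. Z j)"
      proof (cases "i \<in> T")
        case True
        then obtain j where "j \<in> {0..<Suc k}" "i = t j" using t unfolding bij_betw_def by blast
        then have "x \<in> Z j" "j \<le> k" unfolding Z_def using i by auto
        then show ?thesis by blast
      next
        case False
        then have "x \<in> Z k" unfolding Z_def using i by auto
        then show ?thesis by blast
      qed
    qed
    obtain Z' where Z': "\<forall>j\<le>k. openin X (Z' j) \<and> Z' j \<subseteq> Z j" "F \<subseteq> (\<Union>j\<le>k. Z' j)" "(\<Inter>j\<le>k. Z' j) = {}"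
      using inessential_shrink_Inter[OF par reg iness F Z1 Z2] by (elim exE conjE) (rule that)
    define r where "r = (\<lambda>i. if i \<in> T then s i else k)"
    have rk: "r i \<le> k" if "i \<in> I" for i
    proof (cases "i \<in> T")
      case True
      then obtain j where "j \<in> {0..<Suc k}" "i = t j" using t unfolding bij_betw_def by blast
      then show ?thesis unfolding r_def using s by auto
    qed (simp add: r_def)
    define W2 where "W2 = (\<lambda>i. W1 i \<inter> Z' (r i))"
    show ?case
    proof (intro exI[of _ W2] conjI ballI)
      fix i assume i: "i \<in> I"
      show "openin X (W2 i)" unfolding W2_def using W1(1) Z'(1) rk[OF i] i by blast
      show "W2 i \<subseteq> W i" unfolding W2_def using W1(1) i by blast
    next
      show "F \<subseteq> (\<Union>i\<in>I. W2 i)"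
      proof
        fix x assume "x \<in> F"
        then obtain j where j: "j \<le> k" "x \<in> Z' j" using Z'(2) by blast
        then have "x \<in> Z j" using Z'(1) by blast
        then have "x \<in> W1 (t j) \<or> j = k \<and> (\<exists>i\<in>I - T. x \<in> W1 i)"
          unfolding Z_def using j(1) by (auto split: if_splits)
        then obtain i where "i \<in> I" "x \<in> W1 i" "r i = j"
          using s[OF j(1)] T(1) unfolding r_def by auto
        then show "x \<in> (\<Union>i\<in>I. W2 i)" unfolding W2_def using j(2) by blast
      qed
      fix T' assume T': "T' \<in> insert T \<T>"
      show "(\<Inter>i\<in>T'. W2 i) = {}"
      proof (cases "T' = T")
        case True
        have "(\<Inter>i\<in>T. W2 i) \<subseteq> Z' j" if "j \<le> k" for j
        proof -
          have "r (t j) = j" using s[OF that] unfolding r_def by simp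
          then have "W2 (t j) \<subseteq> Z' j" unfolding W2_def by auto
          then show ?thesis using s(2)[OF that] by blast
        qed
        then have "(\<Inter>i\<in>T. W2 i) \<subseteq> (\<Inter>j\<le>k. Z' j)" by (intro INT_greatest) simp
        then show ?thesis using Z'(3) True by simp
      next
        case False
        then have "(\<Inter>i\<in>T'. W1 i) = {}" using T' W1(3) by blast
        moreover have "(\<Inter>i\<in>T'. W2 i) \<subseteq> (\<Inter>i\<in>T'. W1 i)" unfolding W2_def by auto
        ultimately show ?thesis by simp
      qed
    qed
  qed
  from this[OF \<open>finite \<S>\<close> order_refl] show ?thesis unfolding \<S>_def by (simp add: imp_conjL)
qed

definition disjoint_refinement :: "'a topology \<Rightarrow> 'a set set \<Rightarrow> 'a set set \<Rightarrow> bool" where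
  "disjoint_refinement X \<gamma> \<omega> \<longleftrightarrow> (\<forall>V\<in>\<gamma>. openin X V) \<and> pairwise disjnt \<gamma> \<and> refines \<gamma> \<omega>"

text \<open>Cells of one size are disjoint, and a cell lies in every member of its index set. Sizes
  start at 1 because the cell of the empty set is the whole space.\<close>

lemma dominance_cells_disjoint_refinement:
  assumes cont: "\<forall>U\<in>\<omega>. continuous_map X euclideanreal (l U)"
    and lf: "locally_finite_family X \<omega> (\<lambda>U. {x \<in> topspace X. l U x \<noteq> 0})"
    and sub: "\<forall>U\<in>\<omega>. \<forall>x\<in>topspace X. l U x \<noteq> 0 \<longrightarrow> x \<in> U"
  shows "disjoint_refinement X {dominance_cell X \<omega> l s |s. s \<subseteq> \<omega> \<and> card s = Suc c} \<omega>"
proof -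
  have fin: "finite s" if "card s = Suc c" for s :: "'a set set"
    using that card.infinite by fastforce
  show ?thesis unfolding disjoint_refinement_def
  proof (intro conjI)
    show "\<forall>V\<in>{dominance_cell X \<omega> l s |s. s \<subseteq> \<omega> \<and> card s = Suc c}. openin X V"
      using openin_dominance_cell[OF cont lf] fin by blast
    show "pairwise disjnt {dominance_cell X \<omega> l s |s. s \<subseteq> \<omega> \<and> card s = Suc c}"
      unfolding pairwise_def
    proof (intro ballI impI)
      fix A B assume "A \<in> {dominance_cell X \<omega> l s |s. s \<subseteq> \<omega> \<and> card s = Suc c}"
        "B \<in> {dominance_cell X \<omega> l s |s. s \<subseteq> \<omega> \<and> card s = Suc c}" and "A \<noteq> B"
      then obtain s t where st: "A = dominance_cell X \<omega> l s" "B = dominance_cell X \<omega> l t" "s \<subseteq> \<omega>" "t \<subseteq> \<omega>"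
        "card s = Suc c" "card t = Suc c" by blast
      with \<open>A \<noteq> B\<close> have "s \<noteq> t" by blast
      with st show "disjnt A B"
        unfolding disjnt_def st(1,2) by (intro dominance_cell_disjoint fin) simp_all
    qed
    show "refines {dominance_cell X \<omega> l s |s. s \<subseteq> \<omega> \<and> card s = Suc c} \<omega>"
      unfolding refines_def
    proof
      fix A assume "A \<in> {dominance_cell X \<omega> l s |s. s \<subseteq> \<omega> \<and> card s = Suc c}"
      then obtain s where s: "A = dominance_cell X \<omega> l s" "s \<subseteq> \<omega>" "card s = Suc c" by blast
      then obtain U where U: "U \<in> s" by fastforce
      have "A \<subseteq> U"
      proof
        fix x assume "x \<in> A"
        then have "x \<in> topspace X" "0 < l U x" using U s(1) unfolding dominance_cell_def by auto
        then show "x \<in> U" using sub U s(2) by (metis less_irrefl subsetD)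
      qed
      then show "\<exists>U\<in>\<omega>. A \<subseteq> U" using U s(2) by blast
    qed
  qed
qed

lemma finite_imp_locally_finite_family:
  assumes "finite I" shows "locally_finite_family X I U"
  unfolding locally_finite_family_def using assms by (auto intro: exI[of _ "topspace X"])

text \<open>After a shrinking in which no \<open>k + 1\<close> sets meet, at most \<open>k\<close>
  functions are nonzero at a point, so the cells of sizes 1 to \<open>k\<close> cover
  \<open>F\<close>.\<close>

lemma inessential_finite_cover:
  assumes par: "paracompact_space X" and reg: "regular_space X"
    and iness: "inessential X k F" and F: "closedin X F" and fin: "finite \<omega>"
    and \<omega>: "\<forall>U\<in>\<omega>. openin X U" "F \<subseteq> \<Union>\<omega>"
  shows "\<exists>\<gamma>. (\<forall>c<k. disjoint_refinement X (\<gamma> c) \<omega>) \<and> F \<subseteq> (\<Union>c<k. \<Union>(\<gamma> c))"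
proof -
  have \<omega>2: "F \<subseteq> (\<Union>U\<in>\<omega>. U)" using \<omega>(2) by simp
  obtain W where W: "\<forall>U\<in>\<omega>. openin X (W U) \<and> W U \<subseteq> U" "F \<subseteq> (\<Union>U\<in>\<omega>. W U)"
    "\<forall>T\<subseteq>\<omega>. card T = Suc k \<longrightarrow> (\<Inter>U\<in>T. W U) = {}"
    using inessential_shrink_order[OF par reg iness F fin \<omega>(1) \<omega>2] by (elim exE conjE) (rule that)
  \<comment> \<open>\<open>None\<close> carries the complement of \<open>F\<close>. Its function is
    dropped in \<open>l\<close>; on \<open>F\<close> it vanishes, so some function of
    \<open>l\<close> is nonzero at each point of \<open>F\<close>.\<close>
  define W0 where "W0 = case_option (topspace X - F) W"
  have W0: "\<forall>i\<in>insert None (Some ` \<omega>). openin X (W0 i)"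
    unfolding W0_def using W(1) F by auto
  have W0c: "topspace X \<subseteq> (\<Union>i\<in>insert None (Some ` \<omega>). W0 i)"
    unfolding W0_def using W(2) by auto
  obtain m where m: "partition_of_unity X (insert None (Some ` \<omega>)) m"
    "\<forall>i\<in>insert None (Some ` \<omega>). \<forall>x\<in>topspace X. m i x \<noteq> 0 \<longrightarrow> x \<in> W0 i"
    using partition_of_unity_exists[OF par reg W0 W0c] by (elim exE conjE) (rule that)
  define l where "l = (\<lambda>U. m (Some U))"
  have lcont: "\<forall>U\<in>\<omega>. continuous_map X euclideanreal (l U)"
    and l0: "\<forall>U\<in>\<omega>. \<forall>x\<in>topspace X. 0 \<le> l U x"
    using m(1) unfolding partition_of_unity_def l_def by simp_all
  have lW: "\<forall>U\<in>\<omega>. \<forall>x\<in>topspace X. l U x \<noteq> 0 \<longrightarrow> x \<in> W U"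
    using m(2) unfolding l_def W0_def by simp
  have lU: "\<forall>U\<in>\<omega>. \<forall>x\<in>topspace X. l U x \<noteq> 0 \<longrightarrow> x \<in> U" using lW W(1) by blast
  have lc: "\<exists>U\<in>\<omega>. l U x \<noteq> 0" if "x \<in> F" for x
  proof -
    have x: "x \<in> topspace X" using that closedin_subset[OF F] by blast
    then have "(\<Sum>i\<in>{i \<in> insert None (Some ` \<omega>). m i x \<noteq> 0}. m i x) = 1"
      using m(1) unfolding partition_of_unity_def by simp
    then have "{i \<in> insert None (Some ` \<omega>). m i x \<noteq> 0} \<noteq> {}" by (metis sum.empty zero_neq_one)
    then obtain i where i: "i \<in> insert None (Some ` \<omega>)" "m i x \<noteq> 0" by blast
    then have "x \<in> W0 i" using m(2) x by blast
    then have "i \<noteq> None" using that unfolding W0_def by (cases i) simp_all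
    then show ?thesis using i unfolding l_def by auto
  qed
  define \<gamma> where "\<gamma> = (\<lambda>c. {dominance_cell X \<omega> l s |s. s \<subseteq> \<omega> \<and> card s = Suc c})"
  show ?thesis
  proof (intro exI[of _ \<gamma>] conjI allI impI)
    show "disjoint_refinement X (\<gamma> c) \<omega>" for c
      unfolding \<gamma>_def
      by (rule dominance_cells_disjoint_refinement[OF lcont finite_imp_locally_finite_family[OF fin] lU])
    show "F \<subseteq> (\<Union>c<k. \<Union>(\<gamma> c))"
    proof
      fix x assume x: "x \<in> F"
      then have xX: "x \<in> topspace X" using closedin_subset[OF F] by blast
      define s where "s = {U \<in> \<omega>. l U x \<noteq> 0}"
      have s: "s \<subseteq> \<omega>" "finite s" "s \<noteq> {}" unfolding s_def using fin lc[OF x] by auto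
      have "card s \<le> k"
      proof (rule ccontr)
        assume "\<not> card s \<le> k"
        then have "Suc k \<le> card s" by simp
        then obtain T where T: "T \<subseteq> s" "card T = Suc k" by (meson obtain_subset_with_card_n)
        then have "(\<Inter>U\<in>T. W U) = {}" using W(3) s(1) by (metis subset_trans)
        moreover have "x \<in> W U" if "U \<in> T" for U using lW T(1) that xX unfolding s_def by blast
        ultimately show False by blast
      qed
      moreover have "card s > 0" using s by (simp add: card_gt_0_iff)
      ultimately have "card s = Suc (card s - 1)" "card s - 1 < k" by auto
      moreover have "x \<in> dominance_cell X \<omega> l s" unfolding s_def by (rule in_dominance_cell[OF xX]) (use l0 xX in blast)
      ultimately show "x \<in> (\<Union>c<k. \<Union>(\<gamma> c))" unfolding \<gamma>_def using s(1) by blast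
    qed
  qed
qed

section \<open>Disjoint refinements of arbitrary open covers\<close>

text \<open>Members of \<open>\<gamma>\<close> being disjoint, a different family may be used inside
  each. It therefore suffices to refine a coarse cover by unions of disjoint families.\<close>

lemma disjoint_refinement_Int:
  assumes \<gamma>: "\<forall>V\<in>\<gamma>. openin X V" "pairwise disjnt \<gamma>"
    and \<D>: "\<forall>V\<in>\<gamma>. disjoint_refinement X (\<D> V) \<omega>"
  shows "disjoint_refinement X {V \<inter> D |V D. V \<in> \<gamma> \<and> D \<in> \<D> V} \<omega>"
  unfolding disjoint_refinement_def
proof (intro conjI)
  show "\<forall>W\<in>{V \<inter> D |V D. V \<in> \<gamma> \<and> D \<in> \<D> V}. openin X W"
    using \<gamma>(1) \<D> unfolding disjoint_refinement_def by blast
  show "refines {V \<inter> D |V D. V \<in> \<gamma> \<and> D \<in> \<D> V} \<omega>"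
    unfolding refines_def
  proof
    fix W assume "W \<in> {V \<inter> D |V D. V \<in> \<gamma> \<and> D \<in> \<D> V}"
    then obtain V D where VD: "W = V \<inter> D" "V \<in> \<gamma>" "D \<in> \<D> V" by blast
    then obtain U where "U \<in> \<omega>" "D \<subseteq> U" using \<D> unfolding disjoint_refinement_def refines_def by blast
    then show "\<exists>U\<in>\<omega>. W \<subseteq> U" using VD(1) by blast
  qed
  show "pairwise disjnt {V \<inter> D |V D. V \<in> \<gamma> \<and> D \<in> \<D> V}"
    unfolding pairwise_def
  proof (intro ballI impI)
    fix A B assume "A \<in> {V \<inter> D |V D. V \<in> \<gamma> \<and> D \<in> \<D> V}" "B \<in> {V \<inter> D |V D. V \<in> \<gamma> \<and> D \<in> \<D> V}" "A \<noteq> B"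
    then obtain V D V' D' where AB: "A = V \<inter> D" "B = V' \<inter> D'" "V \<in> \<gamma>" "D \<in> \<D> V" "V' \<in> \<gamma>" "D' \<in> \<D> V'"
      by blast
    show "disjnt A B"
    proof (cases "V = V'")
      case True
      then have "D \<noteq> D'" using AB \<open>A \<noteq> B\<close> by blast
      then have "disjnt D D'" using \<D> AB True unfolding disjoint_refinement_def pairwise_def by blast
      then show ?thesis unfolding AB disjnt_def by blast
    next
      case False
      then have "disjnt V V'" using \<gamma>(2) AB unfolding pairwise_def by blast
      then show ?thesis unfolding AB disjnt_def by blast
    qed
  qed
qed

text \<open>The dominance cells, sorted by size, form countably many disjoint families. The function
  \<open>h\<close> averages the indices \<open>r\<close> with weights \<open>m r\<close>, so some
  index of nonzero weight is at most \<open>h x\<close>: where \<open>h\<close> is bounded, finitely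
  many families suffice.\<close>

lemma open_cover_sigma_disjoint_refinement:
  assumes par: "paracompact_space X" and reg: "regular_space X"
    and \<omega>: "\<forall>U\<in>\<omega>. openin X U" "topspace X \<subseteq> \<Union>\<omega>"
  shows "\<exists>(\<D> :: nat \<Rightarrow> 'a set set) (m :: nat \<Rightarrow> 'a \<Rightarrow> real) h. (\<forall>r. disjoint_refinement X (\<D> r) \<omega>) \<and>
    (\<forall>r. continuous_map X euclideanreal (m r)) \<and>
    (\<forall>r. \<forall>x\<in>topspace X. m r x \<noteq> 0 \<longrightarrow> x \<in> \<Union>(\<D> r)) \<and>
    continuous_map X euclideanreal h \<and> (\<forall>x\<in>topspace X. \<exists>r. m r x \<noteq> 0 \<and> real r \<le> h x)"
proof -
  have \<omega>2: "topspace X \<subseteq> (\<Union>U\<in>\<omega>. U)" using \<omega>(2) by simp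
  obtain l where l: "partition_of_unity X \<omega> l" "\<forall>U\<in>\<omega>. \<forall>x\<in>topspace X. l U x \<noteq> 0 \<longrightarrow> x \<in> U"
    using partition_of_unity_exists[OF par reg \<omega>(1) \<omega>2] by (elim exE conjE) (rule that)
  define \<D> where "\<D> = (\<lambda>r. {dominance_cell X \<omega> l s |s. s \<subseteq> \<omega> \<and> card s = Suc r})"
  have \<D>: "disjoint_refinement X (\<D> r) \<omega>" for r
    unfolding \<D>_def using l unfolding partition_of_unity_def
    by (intro dominance_cells_disjoint_refinement) simp_all
  have Do: "\<forall>r\<in>UNIV. openin X (\<Union>(\<D> r))"
    using \<D> unfolding disjoint_refinement_def by blast
  have Dc: "topspace X \<subseteq> (\<Union>r\<in>UNIV. \<Union>(\<D> r))"
  proof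
    fix x assume x: "x \<in> topspace X"
    define s where "s = {U \<in> \<omega>. l U x \<noteq> 0}"
    have "(\<Sum>U\<in>s. l U x) = 1" using l(1) x unfolding partition_of_unity_def s_def by simp
    then have "s \<noteq> {}" by (metis sum.empty zero_neq_one)
    moreover have "finite s" unfolding s_def by (rule partition_of_unity_finite[OF l(1) x])
    ultimately have "card s > 0" by (simp add: card_gt_0_iff)
    then have "card s = Suc (card s - 1)" by simp
    moreover have "x \<in> dominance_cell X \<omega> l s"
      unfolding s_def by (rule in_dominance_cell[OF x]) (use l(1) x in \<open>simp add: partition_of_unity_def\<close>)
    moreover have "s \<subseteq> \<omega>" unfolding s_def by blast
    ultimately have "x \<in> \<Union>(\<D> (card s - 1))" unfolding \<D>_def by auto
    then show "x \<in> (\<Union>r\<in>UNIV. \<Union>(\<D> r))" by blast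
  qed
  obtain m where m: "partition_of_unity X UNIV m" "\<forall>r\<in>UNIV. \<forall>x\<in>topspace X. m r x \<noteq> 0 \<longrightarrow> x \<in> \<Union>(\<D> r)"
    using partition_of_unity_exists[OF par reg Do Dc] by (elim exE conjE) (rule that)
  define h where "h = (\<lambda>x. \<Sum>r\<in>{r \<in> UNIV. real r * m r x \<noteq> 0}. real r * m r x)"
  have mc: "continuous_map X euclideanreal (m r)" for r
    using m(1) unfolding partition_of_unity_def by simp
  have hc: "continuous_map X euclideanreal h"
    unfolding h_def
  proof (rule continuous_map_locally_finite_sum)
    show "continuous_map X euclideanreal (\<lambda>x. real i * m i x)" for i
      by (intro continuous_map_real_mult_left mc)
    have "locally_finite_family X UNIV (\<lambda>i. {x \<in> topspace X. m i x \<noteq> 0})"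
      using m(1) unfolding partition_of_unity_def by simp
    then show "locally_finite_family X UNIV (\<lambda>i. {x \<in> topspace X. real i * m i x \<noteq> 0})"
      by (rule locally_finite_family_mono) auto
  qed
  have hr: "\<exists>r. m r x \<noteq> 0 \<and> real r \<le> h x" if x: "x \<in> topspace X" for x
  proof (rule ccontr)
    assume "\<not> ?thesis"
    then have less: "h x < real r" if "m r x \<noteq> 0" for r using that by force
    define s where "s = {r \<in> UNIV. m r x \<noteq> 0}"
    have s: "finite s" unfolding s_def by (rule partition_of_unity_finite[OF m(1) x])
    have s1: "(\<Sum>r\<in>s. m r x) = 1" using m(1) x unfolding partition_of_unity_def s_def by simp
    then have "s \<noteq> {}" by (metis sum.empty zero_neq_one)
    have pos: "0 < m r x" if "r \<in> s" for r
      using that m(1) x unfolding s_def partition_of_unity_def by (simp add: less_le)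
    have "h x = (\<Sum>r\<in>s. real r * m r x)"
      unfolding h_def by (rule sum.mono_neutral_left[OF s]) (auto simp: s_def)
    also have "\<dots> > (\<Sum>r\<in>s. h x * m r x)"
      by (rule sum_strict_mono[OF s \<open>s \<noteq> {}\<close>]) (use less pos in \<open>auto simp: s_def\<close>)
    also have "(\<Sum>r\<in>s. h x * m r x) = h x" by (simp add: sum_distrib_left[symmetric] s1)
    finally show False by simp
  qed
  show ?thesis using \<D> mc m(2) hc hr by blast
qed

section \<open>Refining every open cover by a fixed number of disjoint families\<close>

text \<open>A form of covering dimension less than \<open>k\<close>, relative to \<open>X\<close>.
  The point is that \<open>k\<close> is the same for all covers.\<close>

definition disjointly_refinable :: "'a topology \<Rightarrow> nat \<Rightarrow> 'a set \<Rightarrow> bool" where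
  "disjointly_refinable X k F \<longleftrightarrow>
     (\<forall>\<omega>. (\<forall>U\<in>\<omega>. openin X U) \<and> topspace X \<subseteq> \<Union>\<omega> \<longrightarrow>
        (\<exists>\<gamma>. (\<forall>c<k. disjoint_refinement X (\<gamma> c) \<omega>) \<and> F \<subseteq> (\<Union>c<k. \<Union>(\<gamma> c))))"

lemma disjointly_refinableD:
  assumes "disjointly_refinable X k F" "\<forall>U\<in>\<omega>. openin X U" "topspace X \<subseteq> \<Union>\<omega>"
  shows "\<exists>\<gamma>. (\<forall>c<k. disjoint_refinement X (\<gamma> c) \<omega>) \<and> F \<subseteq> (\<Union>c<k. \<Union>(\<gamma> c))"
  using assms unfolding disjointly_refinable_def by simp

lemma disjointly_refinable_subset:
  assumes "disjointly_refinable X k F" "G \<subseteq> F"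
  shows "disjointly_refinable X k G"
  unfolding disjointly_refinable_def
proof (intro allI impI)
  fix \<omega> assume "(\<forall>U\<in>\<omega>. openin X U) \<and> topspace X \<subseteq> \<Union>\<omega>"
  then obtain \<gamma> where \<gamma>: "\<forall>c<k. disjoint_refinement X (\<gamma> c) \<omega>" "F \<subseteq> (\<Union>c<k. \<Union>(\<gamma> c))"
    using disjointly_refinableD[OF assms(1), of \<omega>] by (elim conjE impE) auto
  then show "\<exists>\<gamma>. (\<forall>c<k. disjoint_refinement X (\<gamma> c) \<omega>) \<and> G \<subseteq> (\<Union>c<k. \<Union>(\<gamma> c))"
    using assms(2) by (intro exI[of _ \<gamma>]) simp
qed

lemma disjointly_refinable_Un:
  assumes F: "disjointly_refinable X k F" and G: "disjointly_refinable X l G"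
  shows "disjointly_refinable X (k + l) (F \<union> G)"
  unfolding disjointly_refinable_def
proof (intro allI impI, elim conjE)
  fix \<omega> assume \<omega>: "\<forall>U\<in>\<omega>. openin X U" "topspace X \<subseteq> \<Union>\<omega>"
  obtain \<gamma> where \<gamma>: "\<forall>c<k. disjoint_refinement X (\<gamma> c) \<omega>" "F \<subseteq> (\<Union>c<k. \<Union>(\<gamma> c))"
    using disjointly_refinableD[OF F \<omega>] by (elim exE conjE) (rule that)
  obtain \<delta> where \<delta>: "\<forall>c<l. disjoint_refinement X (\<delta> c) \<omega>" "G \<subseteq> (\<Union>c<l. \<Union>(\<delta> c))"
    using disjointly_refinableD[OF G \<omega>] by (elim exE conjE) (rule that)
  define \<epsilon> where "\<epsilon> = (\<lambda>c. if c < k then \<gamma> c else \<delta> (c - k))"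
  have "\<forall>c<k + l. disjoint_refinement X (\<epsilon> c) \<omega>"
    unfolding \<epsilon>_def using \<gamma>(1) \<delta>(1) by simp
  moreover have "F \<union> G \<subseteq> (\<Union>c<k + l. \<Union>(\<epsilon> c))"
  proof
    fix x assume "x \<in> F \<union> G"
    then consider c where "c < k" "x \<in> \<Union>(\<gamma> c)" | c where "c < l" "x \<in> \<Union>(\<delta> c)"
      using \<gamma>(2) \<delta>(2) by blast
    then show "x \<in> (\<Union>c<k + l. \<Union>(\<epsilon> c))"
    proof cases
      case 1
      then have "c < k + l" "x \<in> \<Union>(\<epsilon> c)" unfolding \<epsilon>_def by auto
      then show ?thesis by blast
    next
      case 2
      then have "k + c < k + l" "x \<in> \<Union>(\<epsilon> (k + c))" unfolding \<epsilon>_def by auto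
      then show ?thesis by blast
    qed
  qed
  ultimately show "\<exists>\<gamma>. (\<forall>c<k + l. disjoint_refinement X (\<gamma> c) \<omega>) \<and> F \<union> G \<subseteq> (\<Union>c<k + l. \<Union>(\<gamma> c))"
    by (intro exI[of _ \<epsilon>] conjI)
qed

lemma disjointly_refinable_Union:
  assumes "finite I" "\<forall>i\<in>I. \<exists>k. disjointly_refinable X k (F i)"
  shows "\<exists>k. disjointly_refinable X k (\<Union>i\<in>I. F i)"
  using assms
proof (induction I)
  case empty
  have "disjointly_refinable X 0 {}" unfolding disjointly_refinable_def by simp
  then show ?case by auto
next
  case (insert i I)
  then obtain k l where "disjointly_refinable X k (F i)" "disjointly_refinable X l (\<Union>i\<in>I. F i)" by blast
  from disjointly_refinable_Un[OF this] show ?case by auto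
qed

text \<open>On each strip of the exhaustion function finitely many of the countably many sets suffice, so the
  finite case applies; even and odd strips are treated separately.\<close>

lemma inessential_imp_disjointly_refinable:
  assumes par: "paracompact_space X" and reg: "regular_space X"
    and iness: "inessential X k F" and F: "closedin X F"
  shows "disjointly_refinable X (2 * k) F"
  unfolding disjointly_refinable_def
proof (intro allI impI, elim conjE)
  fix \<omega> assume \<omega>: "\<forall>U\<in>\<omega>. openin X U" "topspace X \<subseteq> \<Union>\<omega>"
  obtain \<D> :: "nat \<Rightarrow> 'a set set" and m :: "nat \<Rightarrow> 'a \<Rightarrow> real" and h
    where \<D>: "\<forall>r. disjoint_refinement X (\<D> r) \<omega>"
    and mD: "\<forall>r. continuous_map X euclideanreal (m r)" "\<forall>r. \<forall>x\<in>topspace X. m r x \<noteq> 0 \<longrightarrow> x \<in> \<Union>(\<D> r)"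
    and h: "continuous_map X euclideanreal h" and hm: "\<forall>x\<in>topspace X. \<exists>r. m r x \<noteq> 0 \<and> real r \<le> h x"
    using open_cover_sigma_disjoint_refinement[OF par reg \<omega>] by (elim exE conjE) (rule that)
  \<comment> \<open>On the strip \<open>h\<close> is at most \<open>2 * j + e + 1\<close>, so an
    index \<open>r\<close> up to this bound has nonzero weight, and these finitely many unions cover
    the strip.\<close>
  define \<omega>' where "\<omega>' = (\<lambda>e j. (\<lambda>r. \<Union>(\<D> r)) ` {..2 * j + e + 1 :: nat})"
  have Do: "openin X (\<Union>(\<D> r))" for r using \<D> unfolding disjoint_refinement_def by blast
  have "\<exists>\<gamma>. (\<forall>c<k. disjoint_refinement X (\<gamma> c) (\<omega>' e j)) \<and> F \<inter> strip X h e j \<subseteq> (\<Union>c<k. \<Union>(\<gamma> c))" for e j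
  proof (rule inessential_finite_cover[OF par reg])
    show "inessential X k (F \<inter> strip X h e j)" by (rule inessential_subset[OF iness]) simp
    show "closedin X (F \<inter> strip X h e j)" by (intro closedin_Int F closedin_strip h)
    show "finite (\<omega>' e j)" unfolding \<omega>'_def by simp
    show "\<forall>U\<in>\<omega>' e j. openin X U" unfolding \<omega>'_def using Do by blast
    show "F \<inter> strip X h e j \<subseteq> \<Union>(\<omega>' e j)"
    proof
      fix x assume "x \<in> F \<inter> strip X h e j"
      then have x: "x \<in> topspace X" "h x \<le> real (2 * j + e) + 1" unfolding strip_def by auto
      then obtain r where r: "m r x \<noteq> 0" "real r \<le> h x" using hm by blast
      then have "r \<le> 2 * j + e + 1" using x(2) by linarith
      moreover have "x \<in> \<Union>(\<D> r)" using mD(2) r(1) x(1) by blast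
      ultimately show "x \<in> \<Union>(\<omega>' e j)" unfolding \<omega>'_def by blast
    qed
  qed
  then obtain \<gamma> where \<gamma>: "(\<forall>c<k. disjoint_refinement X (\<gamma> e j c) (\<omega>' e j)) \<and> F \<inter> strip X h e j \<subseteq> (\<Union>c<k. \<Union>(\<gamma> e j c))" for e j
    by metis
  define r where "r = (\<lambda>V. SOME r. V \<subseteq> \<Union>(\<D> r))"
  define \<Gamma> where "\<Gamma> = (\<lambda>e c. {V \<inter> open_strip X h e j |V j. V \<in> \<gamma> e j c})"
  \<comment> \<open>Family \<open>c\<close> serves the strips of parity \<open>c mod 2\<close> and
    takes from each of them the family with number \<open>c div 2\<close>; hence the factor
    2.\<close>
  define \<epsilon> where "\<epsilon> = (\<lambda>c. {V \<inter> D |V D. V \<in> \<Gamma> (c mod 2) (c div 2) \<and> D \<in> \<D> (r V)})"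
  have r: "V \<subseteq> \<Union>(\<D> (r V))" if V: "V \<in> \<Gamma> e c" and c: "c < k" for V e c
  proof -
    obtain W j where W: "V = W \<inter> open_strip X h e j" "W \<in> \<gamma> e j c" using V unfolding \<Gamma>_def by blast
    have "refines (\<gamma> e j c) (\<omega>' e j)" using \<gamma> c unfolding disjoint_refinement_def by blast
    then have "\<exists>r. W \<subseteq> \<Union>(\<D> r)" using W(2) unfolding refines_def \<omega>'_def by blast
    then have "\<exists>r. V \<subseteq> \<Union>(\<D> r)" using W(1) by blast
    then show ?thesis unfolding r_def by (rule someI_ex)
  qed
  show "\<exists>\<gamma>. (\<forall>c<2 * k. disjoint_refinement X (\<gamma> c) \<omega>) \<and> F \<subseteq> (\<Union>c<2 * k. \<Union>(\<gamma> c))"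
  proof (intro exI[of _ \<epsilon>] conjI allI impI)
    fix c assume "c < 2 * k"
    then have c: "c div 2 < k" by simp
    let ?e = "c mod 2" let ?c = "c div 2"
    have \<gamma>c: "\<forall>V\<in>\<gamma> ?e j ?c. openin X V" "pairwise disjnt (\<gamma> ?e j ?c)" for j
      using \<gamma> c unfolding disjoint_refinement_def by blast+
    show "disjoint_refinement X (\<epsilon> c) \<omega>" unfolding \<epsilon>_def
    proof (rule disjoint_refinement_Int)
      show "\<forall>V\<in>\<Gamma> ?e ?c. openin X V"
        unfolding \<Gamma>_def using \<gamma>c(1) openin_open_strip[OF h] by blast
      show "pairwise disjnt (\<Gamma> ?e ?c)" unfolding pairwise_def
      proof (intro ballI impI)
        fix A B assume "A \<in> \<Gamma> ?e ?c" "B \<in> \<Gamma> ?e ?c" "A \<noteq> B"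
        then obtain V j V' j' where AB: "A = V \<inter> open_strip X h ?e j" "B = V' \<inter> open_strip X h ?e j'"
          "V \<in> \<gamma> ?e j ?c" "V' \<in> \<gamma> ?e j' ?c" unfolding \<Gamma>_def by blast
        show "disjnt A B"
        proof (cases "j = j'")
          case True
          then have "disjnt V V'" using \<gamma>c(2)[of j] AB \<open>A \<noteq> B\<close> unfolding pairwise_def by blast
          then show ?thesis unfolding AB disjnt_def by blast
        next
          case False
          then have "open_strip X h ?e j \<inter> open_strip X h ?e j' = {}"
            using disjoint_family_open_strip[of X h ?e] unfolding disjoint_family_on_def by blast
          then show ?thesis unfolding AB disjnt_def by blast
        qed
      qed
      show "\<forall>V\<in>\<Gamma> ?e ?c. disjoint_refinement X (\<D> (r V)) \<omega>" using \<D> by blast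
    qed
  next
    show "F \<subseteq> (\<Union>c<2 * k. \<Union>(\<epsilon> c))"
    proof
      fix x assume x: "x \<in> F"
      then have xX: "x \<in> topspace X" using closedin_subset[OF F] by blast
      obtain r0 where "real r0 \<le> h x" using hm xX by blast
      then have "real 0 \<le> h x" by (metis of_nat_0_le_iff of_nat_0 order_trans)
      then obtain e j where e: "e < 2" "x \<in> strip X h e j" using strip_cover[OF xX] by blast
      then obtain c V where c: "c < k" "V \<in> \<gamma> e j c" "x \<in> V" using \<gamma>[of e j] x by blast
      have V: "V \<inter> open_strip X h e j \<in> \<Gamma> e c" unfolding \<Gamma>_def using c(2) by blast
      have xV: "x \<in> V \<inter> open_strip X h e j" using c(3) e(2) strip_subset_open_strip[of X h e j] by blast
      then obtain D where D: "D \<in> \<D> (r (V \<inter> open_strip X h e j))" "x \<in> D" using r[OF V c(1)] by blast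
      have "(2 * c + e) mod 2 = e" "(2 * c + e) div 2 = c" using e(1) by auto
      then have "x \<in> \<Union>(\<epsilon> (2 * c + e))" unfolding \<epsilon>_def using V xV D by auto
      moreover have "2 * c + e < 2 * k" using c(1) e(1) by linarith
      ultimately show "x \<in> (\<Union>c<2 * k. \<Union>(\<epsilon> c))" by blast
    qed
  qed
qed

lemma finite_C_disjointly_refinable_superlevel:
  assumes fin: "finite_C_space X" and par: "paracompact_space X" and reg: "regular_space X"
    and h: "continuous_map X euclideanreal h"
  shows "\<exists>b k. disjointly_refinable X k {x \<in> topspace X. real b \<le> h x}"
proof -
  obtain J where J: "\<And>e. inessential X (J e) (\<Union>j\<in>{J e..}. strip X h e j)"
    using finite_C_inessential_strips[OF fin par reg h] by metis
  have clo: "closedin X (\<Union>j\<in>{J e..}. strip X h e j)" for e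
  proof (rule closedin_locally_finite_family_Union)
    show "locally_finite_family X {J e..} (strip X h e)"
      using locally_finite_strip[OF h, of e] unfolding locally_finite_family_def
      by (auto intro: rev_finite_subset)
  qed (rule closedin_strip[OF h])
  have "disjointly_refinable X (2 * J e) (\<Union>j\<in>{J e..}. strip X h e j)" for e
    by (rule inessential_imp_disjointly_refinable[OF par reg J clo])
  then obtain k where k: "disjointly_refinable X k (\<Union>e\<in>{..<2}. \<Union>j\<in>{J e..}. strip X h e j)"
    using disjointly_refinable_Union[of "{..<2}" X "\<lambda>e. \<Union>j\<in>{J e..}. strip X h e j"] by blast
  \<comment> \<open>Large enough that \<open>b \<le> 2 * j + e\<close> implies
    \<open>J e \<le> j\<close> for both parities.\<close>
  define b where "b = 2 * (J 0 + J 1) + 2"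
  have "{x \<in> topspace X. real b \<le> h x} \<subseteq> (\<Union>e\<in>{..<2}. \<Union>j\<in>{J e..}. strip X h e j)"
  proof
    fix x assume "x \<in> {x \<in> topspace X. real b \<le> h x}"
    then obtain e j where e: "e < 2" "b \<le> 2 * j + e" "x \<in> strip X h e j" using strip_cover[of x X b h] by blast
    have "e = 0 \<or> e = 1" using e(1) by auto
    then have "J e \<le> j" using e(2) unfolding b_def by auto
    then show "x \<in> (\<Union>e\<in>{..<2}. \<Union>j\<in>{J e..}. strip X h e j)" using e by blast
  qed
  from disjointly_refinable_subset[OF k this] show ?thesis by blast
qed

text \<open>A finite subfamily together with a superlevel set \<open>{h > b}\<close> of the exhaustion function makes every
  cover finite. What is left uncovered lies in finitely many superlevel sets, which are treated by
  the subsequent covers.\<close>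

lemma finite_C_space_open_covers:
  fixes \<omega> :: "nat \<Rightarrow> 'a set set"
  assumes fin: "finite_C_space X" and par: "paracompact_space X" and reg: "regular_space X"
    and \<omega>: "\<And>n. n \<ge> 1 \<Longrightarrow> (\<forall>U\<in>\<omega> n. openin X U) \<and> topspace X \<subseteq> \<Union>(\<omega> n)"
  shows "\<exists>(k::nat) \<gamma>. (\<forall>n\<in>{1..k}. disjoint_refinement X (\<gamma> n) (\<omega> n)) \<and> topspace X \<subseteq> (\<Union>n\<in>{1..k}. \<Union>(\<gamma> n))"
proof -
  define good where "good = (\<lambda>n (\<D> :: nat \<Rightarrow> 'a set set) (m :: nat \<Rightarrow> 'a \<Rightarrow> real) h b k.
    (\<forall>r. disjoint_refinement X (\<D> r) (\<omega> n)) \<and> (\<forall>r. continuous_map X euclideanreal (m r)) \<and>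
    (\<forall>r. \<forall>x\<in>topspace X. m r x \<noteq> 0 \<longrightarrow> x \<in> \<Union>(\<D> r)) \<and>
    continuous_map X euclideanreal h \<and> (\<forall>x\<in>topspace X. \<exists>r. m r x \<noteq> 0 \<and> real r \<le> h x) \<and>
    disjointly_refinable X k {x \<in> topspace X. real (b :: nat) \<le> h x})"
  have "\<exists>\<D> m h b k. n \<ge> 1 \<longrightarrow> good n \<D> m h b k" for n
  proof (cases "n \<ge> 1")
    case True
    obtain \<D> :: "nat \<Rightarrow> 'a set set" and m :: "nat \<Rightarrow> 'a \<Rightarrow> real" and h
      where 1: "\<forall>r. disjoint_refinement X (\<D> r) (\<omega> n)" "\<forall>r. continuous_map X euclideanreal (m r)"
        "\<forall>r. \<forall>x\<in>topspace X. m r x \<noteq> 0 \<longrightarrow> x \<in> \<Union>(\<D> r)"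
        "continuous_map X euclideanreal h" "\<forall>x\<in>topspace X. \<exists>r. m r x \<noteq> 0 \<and> real r \<le> h x"
      using open_cover_sigma_disjoint_refinement[OF par reg conjunct1[OF \<omega>[OF True]] conjunct2[OF \<omega>[OF True]]]
      by (elim exE conjE) (rule that)
    obtain b k where "disjointly_refinable X k {x \<in> topspace X. real b \<le> h x}"
      using finite_C_disjointly_refinable_superlevel[OF fin par reg 1(4)] by blast
    with 1 have "good n \<D> m h b k" unfolding good_def by simp
    then show ?thesis by blast
  qed simp
  then obtain \<D> m h b k where "\<And>n. n \<ge> 1 \<longrightarrow> good n (\<D> n) (m n) (h n) (b n) (k n)" by metis
  then have good: "good n (\<D> n) (m n) (h n) (b n) (k n)" if "n \<ge> 1" for n using that by blast
  \<comment> \<open>This is the set where \<open>h n\<close> exceeds \<open>b n\<close>; cutting off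
    at 0 presents it as a cozero set.\<close>
  define H where "H = (\<lambda>n. {x \<in> topspace X. max 0 (h n x - real (b n)) \<noteq> 0})"
  define \<omega>' where "\<omega>' = (\<lambda>n. insert (H n) ((\<lambda>r. {x \<in> topspace X. m n r x \<noteq> 0}) ` {..b n}))"
  have "\<forall>n\<ge>1. finite (\<omega>' n) \<and> (\<forall>U\<in>\<omega>' n. functionally_open X U) \<and> \<Union>(\<omega>' n) = topspace X"
  proof (intro allI impI conjI)
    fix n :: nat assume n: "n \<ge> 1"
    note g = good[OF n, unfolded good_def]
    show "finite (\<omega>' n)" unfolding \<omega>'_def by simp
    have "continuous_map X euclideanreal (\<lambda>x. max 0 (h n x - real (b n)))"
      using g by (intro continuous_map_real_max continuous_map_diff) simp_all
    then have "functionally_open X (H n)" unfolding functionally_open_def H_def by blast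
    moreover have "functionally_open X {x \<in> topspace X. m n r x \<noteq> 0}" for r
      unfolding functionally_open_def using g by blast
    ultimately show "\<forall>U\<in>\<omega>' n. functionally_open X U" unfolding \<omega>'_def by blast
    show "\<Union>(\<omega>' n) = topspace X"
    proof
      show "\<Union>(\<omega>' n) \<subseteq> topspace X" unfolding \<omega>'_def H_def by blast
      show "topspace X \<subseteq> \<Union>(\<omega>' n)"
      proof
        fix x assume x: "x \<in> topspace X"
        then obtain r where r: "m n r x \<noteq> 0" "real r \<le> h n x" using g by blast
        show "x \<in> \<Union>(\<omega>' n)"
        proof (cases "r \<le> b n")
          case True
          then show ?thesis unfolding \<omega>'_def using x r(1) by blast
        next
          case False
          then have "x \<in> H n" unfolding H_def using x r(2) by simp
          then show ?thesis unfolding \<omega>'_def by blast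
        qed
      qed
    qed
  qed
  from finite_C_spaceD[OF fin this] obtain K \<gamma> where
    \<gamma>: "\<forall>n\<in>{1..K}. finite (\<gamma> n) \<and> (\<forall>V\<in>\<gamma> n. functionally_open X V) \<and>
                            pairwise disjnt (\<gamma> n) \<and> refines (\<gamma> n) (\<omega>' n)"
      "topspace X \<subseteq> (\<Union>n\<in>{1..K}. \<Union>(\<gamma> n))" by (elim exE conjE) (rule that)
  \<comment> \<open>A member of \<open>\<gamma> n\<close> that is left out here can only lie in
    \<open>H n\<close>, hence in the set \<open>G\<close> below.\<close>
  define \<gamma>' where "\<gamma>' = (\<lambda>n. {V \<in> \<gamma> n. \<exists>r. V \<subseteq> \<Union>(\<D> n r)})"
  define r where "r = (\<lambda>n V. SOME r. V \<subseteq> \<Union>(\<D> n r))"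
  have r: "V \<subseteq> \<Union>(\<D> n (r n V))" if "V \<in> \<gamma>' n" for V n
    using that someI_ex[of "\<lambda>r. V \<subseteq> \<Union>(\<D> n r)"] unfolding \<gamma>'_def r_def by blast
  define \<delta> where "\<delta> = (\<lambda>n. {V \<inter> D |V D. V \<in> \<gamma>' n \<and> D \<in> \<D> n (r n V)})"
  have \<delta>: "disjoint_refinement X (\<delta> n) (\<omega> n)" if n: "n \<in> {1..K}" for n
    unfolding \<delta>_def
  proof (rule disjoint_refinement_Int)
    show "\<forall>V\<in>\<gamma>' n. openin X V" unfolding \<gamma>'_def using \<gamma>(1) n functionally_open_imp_openin by blast
    have "pairwise disjnt (\<gamma> n)" using \<gamma>(1) n by blast
    then show "pairwise disjnt (\<gamma>' n)" by (rule pairwise_subset) (auto simp: \<gamma>'_def)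
    show "\<forall>V\<in>\<gamma>' n. disjoint_refinement X (\<D> n (r n V)) (\<omega> n)"
      using good[of n] n unfolding good_def by simp
  qed
  define G where "G = (\<Union>n\<in>{1..K}. {x \<in> topspace X. real (b n) \<le> h n x})"
  have cov: "x \<in> (\<Union>n\<in>{1..K}. \<Union>(\<delta> n)) \<union> G" if x: "x \<in> topspace X" for x
  proof -
    obtain n V where n: "n \<in> {1..K}" "V \<in> \<gamma> n" "x \<in> V" using \<gamma>(2) x by blast
    show ?thesis
    proof (cases "V \<in> \<gamma>' n")
      case True
      then obtain D where "D \<in> \<D> n (r n V)" "x \<in> D" using r n(3) by blast
      then have "x \<in> \<Union>(\<delta> n)" unfolding \<delta>_def using True n(3) by blast
      then show ?thesis using n(1) by blast
    next
      case False
      have "refines (\<gamma> n) (\<omega>' n)" using \<gamma>(1) n(1) by blast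
      then obtain U where U: "U \<in> \<omega>' n" "V \<subseteq> U" using n(2) unfolding refines_def by blast
      have "{x \<in> topspace X. m n r x \<noteq> 0} \<subseteq> \<Union>(\<D> n r)" for r
        using good[of n] n(1) unfolding good_def by auto
      then have "U = H n" using U False n(2) unfolding \<omega>'_def \<gamma>'_def by blast
      then have "x \<in> H n" using U(2) n(3) by blast
      then have "real (b n) \<le> h n x" unfolding H_def by (auto simp: max_def split: if_splits)
      then show ?thesis unfolding G_def using n(1) x by blast
    qed
  qed
  have "\<exists>k. disjointly_refinable X k G" unfolding G_def
  proof (intro disjointly_refinable_Union ballI)
    fix n assume "n \<in> {1..K}"
    then show "\<exists>k. disjointly_refinable X k {x \<in> topspace X. real (b n) \<le> h n x}"
      using good[of n] unfolding good_def by auto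
  qed simp
  then obtain L where L: "disjointly_refinable X L G" by blast
  \<comment> \<open>Now that \<open>L\<close> is known, the covers with numbers \<open>K + 1\<close>
    to \<open>K + L\<close> are refined simultaneously; the \<open>c\<close>-th family obtained for
    \<open>G\<close> is then assigned to cover \<open>K + 1 + c\<close>.\<close>
  define \<omega>2 where "\<omega>2 = {U. openin X U \<and> (\<forall>n\<in>{Suc K..K + L}. \<exists>W\<in>\<omega> n. U \<subseteq> W)}"
  have o1: "\<forall>U\<in>\<omega>2. openin X U" unfolding \<omega>2_def by blast
  have o2: "topspace X \<subseteq> \<Union>\<omega>2"
  proof
    fix x assume x: "x \<in> topspace X"
    have "\<forall>n\<in>{Suc K..K + L}. \<exists>W. W \<in> \<omega> n \<and> x \<in> W"
    proof
      fix n assume "n \<in> {Suc K..K + L}"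
      then have "n \<ge> 1" by auto
      then show "\<exists>W. W \<in> \<omega> n \<and> x \<in> W" using \<omega>[of n] x by blast
    qed
    from bchoice[OF this] obtain W where W: "\<forall>n\<in>{Suc K..K + L}. W n \<in> \<omega> n \<and> x \<in> W n"
      by (elim exE) (rule that)
    define U where "U = (\<Inter>n\<in>{Suc K..K + L}. W n) \<inter> topspace X"
    have "openin X U" unfolding U_def
    proof (rule openin_INT)
      fix n assume n: "n \<in> {Suc K..K + L}"
      then have "n \<ge> 1" by auto
      then show "openin X (W n)" using \<omega>[of n] W n by blast
    qed simp
    moreover have "\<forall>n\<in>{Suc K..K + L}. \<exists>W\<in>\<omega> n. U \<subseteq> W" unfolding U_def using W by blast
    moreover have "x \<in> U" unfolding U_def using W x by blast
    ultimately show "x \<in> \<Union>\<omega>2" unfolding \<omega>2_def by blast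
  qed
  obtain \<epsilon> where \<epsilon>: "\<forall>c<L. disjoint_refinement X (\<epsilon> c) \<omega>2" "G \<subseteq> (\<Union>c<L. \<Union>(\<epsilon> c))"
    using disjointly_refinableD[OF L o1 o2] by (elim exE conjE) (rule that)
  define \<zeta> where "\<zeta> = (\<lambda>n. if n \<le> K then \<delta> n else \<epsilon> (n - Suc K))"
  show ?thesis
  proof (intro exI[of _ "K + L"] exI[of _ \<zeta>] conjI ballI)
    fix n assume n: "n \<in> {1..K + L}"
    show "disjoint_refinement X (\<zeta> n) (\<omega> n)"
    proof (cases "n \<le> K")
      case True
      then show ?thesis unfolding \<zeta>_def using \<delta>[of n] n by simp
    next
      case False
      then have "n - Suc K < L" using n by auto
      then have "disjoint_refinement X (\<epsilon> (n - Suc K)) \<omega>2" using \<epsilon>(1) by blast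
      moreover have "\<exists>W\<in>\<omega> n. U \<subseteq> W" if "U \<in> \<omega>2" for U
        using that n False unfolding \<omega>2_def by simp
      ultimately have "disjoint_refinement X (\<epsilon> (n - Suc K)) (\<omega> n)"
        unfolding disjoint_refinement_def refines_def by (meson subset_trans)
      then show ?thesis unfolding \<zeta>_def using False by simp
    qed
  next
    show "topspace X \<subseteq> (\<Union>n\<in>{1..K + L}. \<Union>(\<zeta> n))"
    proof
      fix x assume x: "x \<in> topspace X"
      from cov[OF x] consider n where "n \<in> {1..K}" "x \<in> \<Union>(\<delta> n)" | "x \<in> G" by blast
      then show "x \<in> (\<Union>n\<in>{1..K + L}. \<Union>(\<zeta> n))"
      proof cases
        case 1
        then have "x \<in> \<Union>(\<zeta> n)" "n \<in> {1..K + L}" unfolding \<zeta>_def by auto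
        then show ?thesis by blast
      next
        case 2
        then obtain c where "c < L" "x \<in> \<Union>(\<epsilon> c)" using \<epsilon>(2) by blast
        then have "x \<in> \<Union>(\<zeta> (Suc K + c))" "Suc K + c \<in> {1..K + L}" unfolding \<zeta>_def by auto
        then show ?thesis by blast
      qed
    qed
  qed
qed

section \<open>Maps on simplices\<close>

text \<open>Barycentric coordinates are total functions on the vertex type, so a face is literally a
  subset and one function \<open>g\<close> can serve all simplices of a complex at once.\<close>

definition simplex_on :: "'v set \<Rightarrow> ('v \<Rightarrow> real) set" where
  "simplex_on s = {t. (\<forall>v. 0 \<le> t v) \<and> (\<forall>v. v \<notin> s \<longrightarrow> t v = 0) \<and> (\<Sum>v\<in>s. t v) = 1}"

abbreviation simplex_topology :: "'v set \<Rightarrow> ('v \<Rightarrow> real) topology" where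
  "simplex_topology s \<equiv> subtopology (powertop_real UNIV) (simplex_on s)"

abbreviation simplex_map :: "'v set \<Rightarrow> 'b topology \<Rightarrow> 'b set \<Rightarrow> (('v \<Rightarrow> real) \<Rightarrow> 'b) \<Rightarrow> bool" where
  "simplex_map s Y A g \<equiv> continuous_map (simplex_topology s) (subtopology Y A) g"

lemma continuous_map_coordinate: "continuous_map (powertop_real UNIV) euclideanreal (\<lambda>t. t v)"
  by (rule continuous_map_product_projection) simp

lemma continuous_map_coordinate_subtopology:
  "continuous_map (subtopology (powertop_real UNIV) S) euclideanreal (\<lambda>t. t v)"
  by (rule continuous_map_from_subtopology[OF continuous_map_coordinate])

lemma compactin_simplex_on:
  assumes "finite s"
  shows "compactin (powertop_real UNIV) (simplex_on s)"
proof -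
  define K where "K = (\<lambda>v. if v \<in> s then {0..1} else {0::real})"
  have "t v \<in> K v" if "t \<in> simplex_on s" for t v
  proof (cases "v \<in> s")
    case True
    have "t v \<le> (\<Sum>v\<in>s. t v)" using that assms True unfolding simplex_on_def
      by (intro member_le_sum) auto
    then show ?thesis using that True unfolding simplex_on_def K_def by auto
  qed (use that in \<open>auto simp: simplex_on_def K_def\<close>)
  then have eq: "simplex_on s = {t \<in> topspace (powertop_real UNIV). (\<Sum>v\<in>s. t v) \<in> {1}} \<inter> PiE UNIV K"
  proof (intro subset_antisym subsetI)
    fix t assume "t \<in> {t \<in> topspace (powertop_real UNIV). (\<Sum>v\<in>s. t v) \<in> {1}} \<inter> PiE UNIV K"
    then have t: "(\<Sum>v\<in>s. t v) = 1" and "t v \<in> K v" for v by (auto simp: PiE_iff)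
    then have "0 \<le> t v" "v \<notin> s \<longrightarrow> t v = 0" for v
      unfolding K_def by (metis atLeastAtMost_iff order_refl singletonD, metis singletonD)
    with t show "t \<in> simplex_on s" unfolding simplex_on_def by blast
  qed (auto simp: simplex_on_def)
  have "closedin (powertop_real UNIV) {t \<in> topspace (powertop_real UNIV). (\<Sum>v\<in>s. t v) \<in> {1}}"
    by (rule closedin_continuous_map_preimage[of _ euclideanreal])
      (auto intro!: continuous_map_sum continuous_map_coordinate assms)
  moreover have "compactin (powertop_real UNIV) (PiE UNIV K)"
    unfolding compactin_PiE K_def by auto
  ultimately show ?thesis unfolding eq by (rule closed_Int_compactin)
qed

lemma closedin_simplex_on:
  assumes "finite s" shows "closedin (powertop_real UNIV) (simplex_on s)"
  by (rule compactin_imp_closedin[OF _ compactin_simplex_on[OF assms]])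
    (simp add: Hausdorff_space_product_topology)

lemma simplex_on_mono:
  assumes "s \<subseteq> u" "finite u" shows "simplex_on s \<subseteq> simplex_on u"
proof
  fix t assume t: "t \<in> simplex_on s"
  have "(\<Sum>v\<in>u. t v) = (\<Sum>v\<in>s. t v)"
    by (rule sum.mono_neutral_right) (use assms t in \<open>auto simp: simplex_on_def\<close>)
  then show "t \<in> simplex_on u" using t assms unfolding simplex_on_def by auto
qed

lemma simplex_on_remove:
  assumes "t \<in> simplex_on s" "t v = 0" "finite s" shows "t \<in> simplex_on (s - {v})"
proof -
  have "(\<Sum>v\<in>s - {v}. t v) = (\<Sum>v\<in>s. t v)"
    by (rule sum.mono_neutral_left) (use assms in \<open>auto simp: simplex_on_def\<close>)
  then show ?thesis using assms unfolding simplex_on_def by auto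
qed

lemma continuous_map_Max_real:
  assumes "finite s" "s \<noteq> {}" "\<And>v. v \<in> s \<Longrightarrow> continuous_map X euclideanreal (f v)"
  shows "continuous_map X euclideanreal (\<lambda>x. Max ((\<lambda>v. f v x) ` s))"
  using assms
proof (induction s rule: finite_ne_induct)
  case (insert v s)
  have "continuous_map X euclideanreal (\<lambda>x. max (f v x) (Max ((\<lambda>v. f v x) ` s)))"
    using insert by (intro continuous_map_real_max) auto
  then show ?case using insert.hyps by simp
qed simp

lemma continuous_map_on_facets:
  assumes fin: "finite s" and g: "\<And>v. v \<in> s \<Longrightarrow> continuous_map (simplex_topology (s - {v})) Y g"
  shows "continuous_map (subtopology (powertop_real UNIV) (\<Union>v\<in>s. simplex_on (s - {v}))) Y g"
proof (rule pasting_lemma_closed[of s _ "\<lambda>v. simplex_on (s - {v})" Y "\<lambda>_. g"])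
  fix v assume v: "v \<in> s"
  show "closedin (subtopology (powertop_real UNIV) (\<Union>v\<in>s. simplex_on (s - {v}))) (simplex_on (s - {v}))"
    by (rule closedin_subset_topspace[OF closedin_simplex_on]) (use fin v in auto)
  have "(\<Union>v\<in>s. simplex_on (s - {v})) \<inter> simplex_on (s - {v}) = simplex_on (s - {v})" using v by blast
  then show "continuous_map (subtopology (subtopology (powertop_real UNIV) (\<Union>v\<in>s. simplex_on (s - {v})))
      (simplex_on (s - {v}))) Y g"
    using g[OF v] by (simp add: subtopology_subtopology)
qed (use fin in auto)

lemma Max_pos_of_sum_eq_0:
  fixes u :: "'v \<Rightarrow> real"
  assumes "finite s" "(\<Sum>v\<in>s. u v) = 0" "v \<in> s" "u v \<noteq> 0"
  shows "0 < Max ((\<lambda>v. - u v) ` s)"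
proof (rule ccontr)
  assume "\<not> ?thesis"
  then have "Max ((\<lambda>v. - u v) ` s) \<le> 0" by simp
  then have "\<forall>w\<in>s. 0 \<le> u w" using assms(1,3) by (subst (asm) Max_le_iff) auto
  then have "\<forall>w\<in>s. u w = 0" using assms(1,2) by (simp add: sum_nonneg_eq_0_iff)
  then show False using assms(3,4) by blast
qed

text \<open>The radial projection from the barycentre identifies the boundary of the simplex with the sphere;
  \<open>r\<close> below is the radial coordinate, and the extension is constant for \<open>r \<le> 1/2\<close>.\<close>

lemma simplex_extension:
  assumes fin: "finite s" and card: "card s = Suc (Suc d)"
    and emb: "C_embedded d Y A B"
    and g: "\<And>v. v \<in> s \<Longrightarrow> simplex_map (s - {v}) Y A g"
  shows "\<exists>g'. simplex_map s Y B g' \<and>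
    (\<forall>v\<in>s. \<forall>t\<in>simplex_on (s - {v}). g' t = g t)"
proof -
  define N where "N = real (card s)"
  have N: "N > 0" "N = real d + 2" unfolding N_def card by auto
  obtain e where "bij_betw e {0..<card s} s" using ex_bij_betw_nat_finite[OF fin] by blast
  then have e: "bij_betw e {..Suc d} s"
    unfolding card by (metis atLeast0LessThan lessThan_Suc_atMost)
  have es: "e i \<in> s" if "i \<le> Suc d" for i using bij_betwE[OF e] that by simp
  have sum_s: "(\<Sum>v\<in>s. f v) = (\<Sum>i\<le>Suc d. f (e i))" for f :: "'a \<Rightarrow> real"
    using sum.reindex_bij_betw[OF e, of f] by simp
  define ei where "ei = the_inv_into {..Suc d} e"
  have ei: "ei (e i) = i" if "i \<le> Suc d" for i
    using e that unfolding ei_def bij_betw_def by (auto intro: the_inv_into_f_f)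
  have s_e: "\<exists>i\<le>Suc d. v = e i" if "v \<in> s" for v
    using e that unfolding bij_betw_def by (metis atMost_iff imageE)
  have s_ne: "s \<noteq> {}" using card by auto
  \<comment> \<open>The sphere has coordinates 0 to \<open>d\<close>. They are placed on
    \<open>d + 1\<close> of the \<open>d + 2\<close> vertices, and the last vertex gets the value
    that makes the sum 0.\<close>
  define w where "w = (\<lambda>(z :: nat \<Rightarrow> real) v. if ei v \<le> d then z (ei v) else - (\<Sum>i\<le>d. z i))"
  have w_e: "w z (e i) = (if i \<le> d then z i else - (\<Sum>i\<le>d. z i))" if "i \<le> Suc d" for z i
    unfolding w_def using ei[OF that] by simp
  have w_sum: "(\<Sum>v\<in>s. w z v) = 0" for z
    unfolding sum_s using w_e by simp
  define M where "M = (\<lambda>z. Max ((\<lambda>v. - w z v) ` s))"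
  \<comment> \<open>The point at which the ray from the barycentre in direction \<open>w z\<close>
    leaves the simplex: the factor \<open>1 / (N * M z)\<close> makes the smallest coordinate
    exactly 0.\<close>
  define b where "b = (\<lambda>z v. if v \<in> s then 1 / N + w z v / (N * M z) else 0)"
  have S: "z \<in> topspace (nsphere d) \<longleftrightarrow> (\<Sum>i\<le>d. (z i)\<^sup>2) = 1 \<and> (\<forall>i>d. z i = 0)" for z
    unfolding nsphere by (auto simp: not_le)
  have M_pos: "M z > 0" if "z \<in> topspace (nsphere d)" for z
  proof -
    have "\<exists>i\<le>d. z i \<noteq> 0"
    proof (rule ccontr)
      assume "\<nexists>i. i \<le> d \<and> z i \<noteq> 0"
      then have "(\<Sum>i\<le>d. (z i)\<^sup>2) = 0" by simp
      then show False using that S by simp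
    qed
    then obtain i where "i \<le> d" "z i \<noteq> 0" by blast
    then have "w z (e i) \<noteq> 0" "e i \<in> s" using w_e es by auto
    then show ?thesis unfolding M_def by (intro Max_pos_of_sum_eq_0[OF fin w_sum])
  qed
  have M_ge: "- w z v \<le> M z" if "v \<in> s" for z v
    unfolding M_def using that fin by simp
  define Bd where "Bd = (\<Union>v\<in>s. simplex_on (s - {v}))"
  have b_in: "b z \<in> Bd" if z: "z \<in> topspace (nsphere d)" for z
  proof -
    note Mz = M_pos[OF z]
    have "0 \<le> b z v" for v
    proof (cases "v \<in> s")
      case True
      have "0 \<le> (M z + w z v) / (N * M z)" using M_ge[OF True, of z] Mz N(1) by simp
      also have "\<dots> = b z v" unfolding b_def using True Mz N(1) by (simp add: field_simps)
      finally show ?thesis .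
    qed (simp add: b_def)
    moreover have "(\<Sum>v\<in>s. b z v) = 1"
    proof -
      have "(\<Sum>v\<in>s. b z v) = (\<Sum>v\<in>s. 1 / N) + (\<Sum>v\<in>s. w z v) / (N * M z)"
        unfolding b_def sum_divide_distrib by (simp add: sum.distrib)
      also have "\<dots> = 1" unfolding w_sum using N(1) by (simp add: N_def)
      finally show ?thesis .
    qed
    ultimately have 1: "b z \<in> simplex_on s" unfolding simplex_on_def by (auto simp: b_def)
    have "M z \<in> (\<lambda>v. - w z v) ` s" unfolding M_def using fin s_ne by (intro Max_in) auto
    then obtain v where v: "v \<in> s" "M z = - w z v" by blast
    then have "w z v / (N * M z) = - (1 / N)" using Mz by (simp add: field_simps)
    then have "b z v = 0" unfolding b_def using v(1) by simp
    from simplex_on_remove[OF 1 this fin] show ?thesis unfolding Bd_def using v(1) by blast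
  qed
  have w_cont: "continuous_map (nsphere d) euclideanreal (\<lambda>z. w z v)" for v
    unfolding w_def nsphere
    by (cases "ei v \<le> d") (auto intro!: continuous_map_coordinate_subtopology continuous_map_minus continuous_map_sum)
  have b_cont: "continuous_map (nsphere d) (subtopology (powertop_real UNIV) Bd) b"
    unfolding continuous_map_in_subtopology continuous_map_componentwise_UNIV
  proof (intro conjI allI)
    fix v
    have "continuous_map (nsphere d) euclideanreal M"
      unfolding M_def by (intro continuous_map_Max_real fin s_ne continuous_map_minus w_cont)
    then have "continuous_map (nsphere d) euclideanreal (\<lambda>z. 1 / N + w z v / (N * M z))"
      by (intro continuous_map_add continuous_map_real_divide continuous_map_real_mult_left w_cont)
        (use N(1) M_pos in \<open>auto simp: less_imp_neq[THEN not_sym]\<close>)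
    then show "continuous_map (nsphere d) euclideanreal (\<lambda>z. b z v)"
      unfolding b_def by (cases "v \<in> s") auto
  qed (use b_in in blast)
  have g_cont: "continuous_map (subtopology (powertop_real UNIV) Bd) (subtopology Y A) g"
    unfolding Bd_def by (rule continuous_map_on_facets[OF fin g])
  have "continuous_map (nsphere d) (subtopology Y A) (g \<circ> b)"
    by (rule continuous_map_compose[OF b_cont g_cont])
  then obtain c where c: "c \<in> B" "homotopic_with (\<lambda>h. True) (nsphere d) (subtopology Y B) (g \<circ> b) (\<lambda>z. c)"
    using emb unfolding C_embedded_def by blast
  then obtain H where H: "continuous_map (prod_topology (top_of_set {0..1::real}) (nsphere d)) (subtopology Y B) H"
    "\<And>z. H (0, z) = (g \<circ> b) z" "\<And>z. H (1, z) = c"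
    unfolding homotopic_with_def by auto
  \<comment> \<open>These maps invert \<open>b\<close>: \<open>u\<close> is the displacement from
    the barycentre, \<open>r\<close> its size, scaled to be 1 on the boundary, and \<open>n\<close>
    its direction, normalised by the Euclidean length \<open>R\<close> of the first
    \<open>d + 1\<close> coordinates.\<close>
  define u where "u = (\<lambda>(t :: 'a \<Rightarrow> real) v. t v - 1 / N)"
  define r where "r = (\<lambda>t. N * Max ((\<lambda>v. - u t v) ` s))"
  define R where "R = (\<lambda>t. sqrt (\<Sum>i\<le>d. (u t (e i))\<^sup>2))"
  define n where "n = (\<lambda>t i. if i \<le> d then u t (e i) / R t else 0)"
  have u_sum: "(\<Sum>v\<in>s. u t v) = 0" if "t \<in> simplex_on s" for t
    using that N(1) unfolding u_def simplex_on_def by (simp add: sum_subtractf N_def)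
  have r_le: "r t \<le> 1" if "t \<in> simplex_on s" for t
  proof -
    have "Max ((\<lambda>v. - u t v) ` s) \<le> 1 / N"
      using that fin s_ne unfolding u_def simplex_on_def by (subst Max_le_iff) auto
    then show ?thesis unfolding r_def using N(1) by (simp add: field_simps)
  qed
  have R_pos: "R t > 0" if t: "t \<in> simplex_on s" and r0: "r t \<noteq> 0" for t
  proof -
    have "\<exists>i\<le>d. u t (e i) \<noteq> 0"
    proof (rule ccontr)
      assume "\<nexists>i. i \<le> d \<and> u t (e i) \<noteq> 0"
      then have 0: "u t (e i) = 0" if "i \<le> d" for i using that by blast
      moreover have "u t (e (Suc d)) = 0" using u_sum[OF t] 0 unfolding sum_s by simp
      ultimately have "u t (e i) = 0" if "i \<le> Suc d" for i using that le_Suc_eq by metis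
      then have "u t v = 0" if "v \<in> s" for v using s_e[OF that] by blast
      then have "(\<lambda>v. - u t v) ` s = {0}" using s_ne by auto
      then show False using r0 unfolding r_def by simp
    qed
    then obtain i where "i \<le> d" "u t (e i) \<noteq> 0" by blast
    then have "0 < (\<Sum>i\<le>d. (u t (e i))\<^sup>2)" by (intro sum_pos2[of _ i]) auto
    then show ?thesis unfolding R_def by simp
  qed
  have n_in: "n t \<in> topspace (nsphere d)" if "t \<in> simplex_on s" "r t \<noteq> 0" for t
  proof -
    have "(\<Sum>i\<le>d. (n t i)\<^sup>2) = (\<Sum>i\<le>d. (u t (e i))\<^sup>2) / (R t)\<^sup>2"
      unfolding n_def sum_divide_distrib by (simp add: power_divide)
    also have "(R t)\<^sup>2 = (\<Sum>i\<le>d. (u t (e i))\<^sup>2)" unfolding R_def by (simp add: sum_nonneg)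
    finally show ?thesis unfolding S using R_pos[OF that] by (auto simp: n_def R_def)
  qed
  have u_cont: "continuous_map (simplex_topology s) euclideanreal (\<lambda>t. u t v)" for v
    unfolding u_def by (intro continuous_map_diff continuous_map_coordinate_subtopology) simp
  have r_cont: "continuous_map (simplex_topology s) euclideanreal r"
    unfolding r_def by (intro continuous_map_real_mult_left continuous_map_Max_real fin s_ne continuous_map_minus u_cont)
  let ?T = "subtopology (simplex_topology s) {t \<in> topspace (simplex_topology s). 1 / 2 \<le> r t}"
  have T: "t \<in> simplex_on s" "1 / 2 \<le> r t" if "t \<in> topspace ?T" for t using that by auto
  have RT: "R t \<noteq> 0" if "t \<in> topspace ?T" for t
    using R_pos[OF T(1)[OF that]] T(2)[OF that] by linarith
  have n_cont: "continuous_map ?T (nsphere d) n"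
    unfolding nsphere continuous_map_in_subtopology continuous_map_componentwise_UNIV
  proof (intro conjI allI)
    fix i
    have "continuous_map ?T euclideanreal R"
      unfolding R_def
      by (intro continuous_map_sqrt continuous_map_sum continuous_map_real_pow continuous_map_from_subtopology[OF u_cont]) auto
    then have "continuous_map ?T euclideanreal (\<lambda>t. u t (e i) / R t)"
      by (intro continuous_map_real_divide continuous_map_from_subtopology[OF u_cont] RT)
    then show "continuous_map ?T euclideanreal (\<lambda>t. n t i)"
      unfolding n_def by (cases "i \<le> d") auto
  next
    show "n \<in> topspace ?T \<rightarrow> {x. (\<Sum>i\<le>d. (x i)\<^sup>2) = 1 \<and> (\<forall>i>d. x i = 0)}"
    proof
      fix t assume t: "t \<in> topspace ?T"
      then have "r t \<noteq> 0" using T(2)[OF t] by auto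
      from n_in[OF T(1)[OF t] this] show "n t \<in> {x. (\<Sum>i\<le>d. (x i)\<^sup>2) = 1 \<and> (\<forall>i>d. x i = 0)}"
        unfolding S by simp
    qed
  qed
  \<comment> \<open>The homotopy is run through for \<open>1 / 2 \<le> r t \<le> 1\<close>: time
    \<open>2 - 2 * r t\<close> is 0 on the boundary, where \<open>H\<close> gives \<open>g\<close>,
    and 1 at \<open>r t = 1 / 2\<close>, where it gives \<open>c\<close>.\<close>
  define g' where "g' = (\<lambda>t. if r t \<le> 1 / 2 then c else H (2 - 2 * r t, n t))"
  have "simplex_map s Y B g'"
    unfolding g'_def
  proof (rule continuous_map_cases_le)
    show "continuous_map (subtopology (simplex_topology s) {t \<in> topspace (simplex_topology s). r t \<le> 1 / 2})
        (subtopology Y B) (\<lambda>t. c)"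
    proof -
      have "c \<in> topspace (subtopology Y B)"
      proof -
        \<comment> \<open>\<open>C_embedded\<close> only says \<open>c \<in> B\<close>. That
          \<open>c\<close> is also a point of \<open>Y\<close> follows from the value of
          \<open>H\<close> over a point of the sphere.\<close>
        define z0 where "z0 = (\<lambda>i::nat. if i = 0 then 1 else 0 :: real)"
        have "z0 \<in> topspace (nsphere d)"
          unfolding S z0_def by (simp add: if_distrib[of "\<lambda>x. x\<^sup>2"] cong: if_cong)
        then have "(1, z0) \<in> topspace (prod_topology (top_of_set {0..1::real}) (nsphere d))"
          unfolding topspace_prod_topology topspace_euclidean_subtopology by (intro SigmaI) simp_all
        then have "H (1, z0) \<in> topspace (subtopology Y B)"
          using continuous_map_image_subset_topspace[OF H(1)] by blast
        then show ?thesis using H(3) by metis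
      qed
      then show ?thesis by simp
    qed
    have "continuous_map ?T (top_of_set {0..1::real}) (\<lambda>t. 2 - 2 * r t)"
      unfolding continuous_map_in_subtopology
    proof
      show "continuous_map ?T euclidean (\<lambda>t. 2 - 2 * r t)"
        by (intro continuous_map_diff continuous_map_real_mult_left continuous_map_from_subtopology[OF r_cont]) simp
      show "(\<lambda>t. 2 - 2 * r t) \<in> topspace ?T \<rightarrow> {0..1}" using T r_le by fastforce
    qed
    then have "continuous_map ?T (prod_topology (top_of_set {0..1::real}) (nsphere d)) (\<lambda>t. (2 - 2 * r t, n t))"
      using n_cont by (simp add: continuous_map_paired)
    from continuous_map_compose[OF this H(1)]
    show "continuous_map ?T (subtopology Y B) (\<lambda>t. H (2 - 2 * r t, n t))" by (simp add: o_def)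
    show "c = H (2 - 2 * r t, n t)" if "r t = 1 / 2" for t
    proof -
      have "2 - 2 * r t = 1" using that by simp
      then show ?thesis using H(3) by simp
    qed
  qed (use r_cont in auto)
  moreover have "g' t = g t" if v: "v \<in> s" and t: "t \<in> simplex_on (s - {v})" for v t
  proof -
    have ts: "t \<in> simplex_on s" using simplex_on_mono[of "s - {v}" s] t fin by auto
    have tv: "t v = 0" using t unfolding simplex_on_def by simp
    have max: "Max ((\<lambda>v. - u t v) ` s) = 1 / N"
    proof (rule Max_eqI)
      show "1 / N \<in> (\<lambda>v. - u t v) ` s" using v tv unfolding u_def by force
      show "y \<le> 1 / N" if "y \<in> (\<lambda>v. - u t v) ` s" for y
        using that ts unfolding u_def simplex_on_def by auto
    qed (use fin in simp)
    then have r1: "r t = 1" unfolding r_def using N(1) by simp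
    have Rt: "R t > 0" using R_pos[OF ts] r1 by simp
    have wn: "w (n t) v' = u t v' / R t" if "v' \<in> s" for v'
    proof -
      obtain i where i: "i \<le> Suc d" "v' = e i" using s_e[OF \<open>v' \<in> s\<close>] by blast
      show ?thesis
      proof (cases "i \<le> d")
        case True
        then show ?thesis unfolding i(2) w_e[OF i(1)] n_def by simp
      next
        case False
        then have "i = Suc d" using i(1) by simp
        have "(\<Sum>i\<le>d. u t (e i)) + u t (e (Suc d)) = 0" using u_sum[OF ts] unfolding sum_s by simp
        then have "(\<Sum>i\<le>d. u t (e i)) = - u t (e i)" unfolding \<open>i = Suc d\<close> by linarith
        moreover have "(\<Sum>i\<le>d. n t i) = (\<Sum>i\<le>d. u t (e i)) / R t"
          unfolding n_def sum_divide_distrib by simp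
        ultimately have "(\<Sum>i\<le>d. n t i) = - u t (e i) / R t" by metis
        then show ?thesis unfolding i(2) w_e[OF i(1)] using False by simp
      qed
    qed
    have "M (n t) = Max ((\<lambda>v. - u t v / R t) ` s)"
      unfolding M_def using wn by (intro arg_cong[where f=Max] image_cong) auto
    also have "\<dots> = 1 / N / R t"
    proof (rule Max_eqI)
      show "1 / N / R t \<in> (\<lambda>v. - u t v / R t) ` s" using v tv unfolding u_def by force
      show "y \<le> 1 / N / R t" if y: "y \<in> (\<lambda>v. - u t v / R t) ` s" for y
      proof -
        obtain x where "y = - u t x / R t" using y by blast
        moreover have "- u t x \<le> 1 / N" using ts unfolding u_def simplex_on_def by simp
        ultimately show ?thesis using Rt divide_right_mono[of "- u t x" "1 / N" "R t"] by simp
      qed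
    qed (use fin in simp)
    finally have Mn: "M (n t) = 1 / N / R t" .
    have "b (n t) v' = t v'" for v'
    proof (cases "v' \<in> s")
      case True
      have "b (n t) v' = 1 / N + u t v' / R t / (N * (1 / N / R t))"
        unfolding b_def Mn using True wn by simp
      also have "\<dots> = 1 / N + u t v'" using N(1) Rt by simp
      finally show ?thesis unfolding u_def by simp
    next
      case False
      then show ?thesis unfolding b_def using ts unfolding simplex_on_def by simp
    qed
    then have "b (n t) = t" by blast
    then show ?thesis unfolding g'_def r1 using H(2) by simp
  qed
  ultimately show ?thesis by (intro exI[of _ g'] conjI ballI)
qed

lemma C_embedded_antimono:
  assumes "C_embedded m Y A B" "k \<le> m" shows "C_embedded k Y A B"
  using assms unfolding C_embedded_def by (meson order_trans)

lemma chain_mono: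
  fixes \<phi> :: "nat \<Rightarrow> 'b set"
  assumes "\<And>n. n \<ge> 1 \<Longrightarrow> \<phi> n \<subseteq> \<phi> (Suc n)" "1 \<le> i" "i \<le> j"
  shows "\<phi> i \<subseteq> \<phi> j"
  using assms(3)
proof (induction rule: dec_induct)
  case (step n)
  then show ?case using assms(1)[of n] assms(2) by (meson order_trans)
qed simp

lemma continuous_map_into_subtopology_mono:
  assumes "continuous_map X (subtopology Y A) f" "A \<subseteq> B"
  shows "continuous_map X (subtopology Y B) f"
  using assms unfolding continuous_map_in_subtopology by blast

text \<open>The cone is filled skeleton by skeleton. The boundary of
  \<open>insert v \<sigma>\<close> with \<open>card \<sigma> = Suc d\<close> is a
  \<open>d\<close>-sphere mapped into \<open>\<phi> (m + d)\<close>, and it contracts in the next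
  value because \<open>1 \<le> m\<close> gives \<open>d \<le> m + d - 1\<close>. The empty simplex
  stands for the apex, which is sent to \<open>y\<close>.\<close>

lemma cone_extension:
  fixes \<phi> :: "nat \<Rightarrow> 'b set"
  assumes asph: "\<And>n. n \<ge> 1 \<Longrightarrow> \<phi> n \<subseteq> \<phi> (Suc n) \<and> C_embedded (n - 1) Y (\<phi> n) (\<phi> (Suc n))"
    and y: "y \<in> \<phi> 1" "y \<in> topspace Y" and m: "1 \<le> m"
    and K: "\<And>\<sigma>. \<sigma> \<in> K \<Longrightarrow> finite \<sigma> \<and> v \<notin> \<sigma>"
    and K_down: "\<And>\<sigma> w. \<sigma> \<in> K \<Longrightarrow> \<sigma> - {w} \<in> insert {} K"
    and g: "\<And>\<sigma>. \<sigma> \<in> K \<Longrightarrow> simplex_map \<sigma> Y (\<phi> m) g"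
  shows "\<exists>g'. (\<forall>t. t v = 0 \<longrightarrow> g' t = g t) \<and>
    (\<forall>\<sigma>\<in>insert {} K. card \<sigma> \<le> d \<longrightarrow>
      simplex_map (insert v \<sigma>) Y (\<phi> (m + d)) g')"
proof (induction d)
  case 0
  define g' where "g' = (\<lambda>t. if t v = 0 then g t else y)"
  have "y \<in> \<phi> m" using y(1) chain_mono[of \<phi> 1 m] asph m by blast
  have "simplex_map {v} Y (\<phi> m) g'"
  proof (rule continuous_map_eq)
    show "simplex_map {v} Y (\<phi> m) (\<lambda>t. y)"
      using y(2) \<open>y \<in> \<phi> m\<close> by simp
    show "y = g' t" if "t \<in> topspace (simplex_topology {v})" for t
      using that unfolding g'_def simplex_on_def by auto
  qed
  moreover have "\<sigma> = {}" if "\<sigma> \<in> insert {} K" "card \<sigma> \<le> 0" for \<sigma>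
    using that K by (auto simp: card_eq_0_iff)
  ultimately show ?case by (intro exI[of _ g']) (auto simp: g'_def)
next
  case (Suc d)
  then obtain g' where g': "\<And>t. t v = 0 \<Longrightarrow> g' t = g t"
    and g'_cont: "\<And>\<sigma>. \<sigma> \<in> insert {} K \<Longrightarrow> card \<sigma> \<le> d \<Longrightarrow>
      simplex_map (insert v \<sigma>) Y (\<phi> (m + d)) g'"
    by blast
  have mono: "\<phi> m \<subseteq> \<phi> (m + d)" "\<phi> (m + d) \<subseteq> \<phi> (m + Suc d)"
    using chain_mono[of \<phi>] asph m by simp_all
  have "C_embedded (m + d - 1) Y (\<phi> (m + d)) (\<phi> (Suc (m + d)))" using asph[of "m + d"] m by simp
  then have emb: "C_embedded d Y (\<phi> (m + d)) (\<phi> (m + Suc d))"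
    using C_embedded_antimono[of "m + d - 1" Y _ _ d] m by simp
  define L where "L = {\<sigma> \<in> K. card \<sigma> = Suc d}"
  have "\<forall>\<sigma>\<in>L. \<exists>h. simplex_map (insert v \<sigma>) Y (\<phi> (m + Suc d)) h \<and>
    (\<forall>w\<in>insert v \<sigma>. \<forall>t\<in>simplex_on (insert v \<sigma> - {w}). h t = g' t)"
  proof
    fix \<sigma> assume \<sigma>: "\<sigma> \<in> L"
    then have fin: "finite \<sigma>" "v \<notin> \<sigma>" "\<sigma> \<in> K" "card \<sigma> = Suc d" using K unfolding L_def by auto
    show "\<exists>h. simplex_map (insert v \<sigma>) Y (\<phi> (m + Suc d)) h \<and>
      (\<forall>w\<in>insert v \<sigma>. \<forall>t\<in>simplex_on (insert v \<sigma> - {w}). h t = g' t)"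
    proof (rule simplex_extension[OF _ _ emb])
      show "finite (insert v \<sigma>)" "card (insert v \<sigma>) = Suc (Suc d)" using fin by auto
      fix w assume w: "w \<in> insert v \<sigma>"
      show "simplex_map (insert v \<sigma> - {w}) Y (\<phi> (m + d)) g'"
      proof (cases "w = v")
        case True
        then have "insert v \<sigma> - {w} = \<sigma>" using fin(2) by simp
        moreover have "simplex_map \<sigma> Y (\<phi> (m + d)) g'"
        proof (rule continuous_map_eq)
          show "simplex_map \<sigma> Y (\<phi> (m + d)) g"
            by (rule continuous_map_into_subtopology_mono[OF g[OF fin(3)] mono(1)])
          show "g t = g' t" if "t \<in> topspace (simplex_topology \<sigma>)" for t
            using that fin(2) g' unfolding simplex_on_def by simp
        qed
        ultimately show ?thesis by simp
      next
        case False
        then have "insert v \<sigma> - {w} = insert v (\<sigma> - {w})" by blast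
        moreover have "card (\<sigma> - {w}) \<le> d" using w False fin by simp
        ultimately show ?thesis using g'_cont[OF K_down[OF fin(3), of w]] by simp
      qed
    qed
  qed
  from bchoice[OF this] obtain h where h: "\<forall>\<sigma>\<in>L. simplex_map (insert v \<sigma>) Y (\<phi> (m + Suc d)) (h \<sigma>) \<and>
    (\<forall>w\<in>insert v \<sigma>. \<forall>t\<in>simplex_on (insert v \<sigma> - {w}). h \<sigma> t = g' t)" by (elim exE) (rule that)
  \<comment> \<open>\<open>\<tau> t\<close> is the base of the cone simplex that has
    \<open>t\<close> in its interior. If it is one of the new bases, the extension chosen for it is
    used; elsewhere \<open>g'\<close> is kept, with which all extensions agree on the
    facets.\<close>
  define \<tau> where "\<tau> = (\<lambda>t::'a \<Rightarrow> real. {w. t w \<noteq> 0} - {v})"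
  define g'' where "g'' = (\<lambda>t. if t v \<noteq> 0 \<and> \<tau> t \<in> L then h (\<tau> t) t else g' t)"
  have \<tau>_sub: "\<tau> t \<subseteq> \<sigma>" if "t \<in> simplex_on (insert v \<sigma>)" for t \<sigma>
    using that unfolding \<tau>_def simplex_on_def by blast
  have cont_L: "simplex_map (insert v \<sigma>) Y (\<phi> (m + Suc d)) g''" if \<sigma>: "\<sigma> \<in> L" for \<sigma>
  proof (rule continuous_map_eq)
    have fin: "finite \<sigma>" "v \<notin> \<sigma>" "\<sigma> \<in> K" "card \<sigma> = Suc d" using K \<sigma> unfolding L_def by auto
    show "simplex_map (insert v \<sigma>) Y (\<phi> (m + Suc d)) (h \<sigma>)" using h \<sigma> by blast
    fix t assume "t \<in> topspace (simplex_topology (insert v \<sigma>))"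
    then have t: "t \<in> simplex_on (insert v \<sigma>)" by simp
    show "h \<sigma> t = g'' t"
    proof (cases "t v \<noteq> 0 \<and> \<tau> t \<in> L")
      case True
      then have "card (\<tau> t) = Suc d" unfolding L_def by simp
      then have "\<tau> t = \<sigma>" using card_subset_eq[OF fin(1) \<tau>_sub[OF t]] fin(4) by simp
      then show ?thesis unfolding g''_def using True by simp
    next
      case False
      have "\<exists>w\<in>insert v \<sigma>. t w = 0"
      proof (rule ccontr)
        assume "\<not> ?thesis"
        then have "\<sigma> \<subseteq> \<tau> t" "t v \<noteq> 0" unfolding \<tau>_def using fin(2) by auto
        then have "\<tau> t = \<sigma>" using \<tau>_sub[OF t] by blast
        then show False using False \<sigma> \<open>t v \<noteq> 0\<close> by blast
      qed
      then obtain w where w: "w \<in> insert v \<sigma>" "t w = 0" by blast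
      then have "t \<in> simplex_on (insert v \<sigma> - {w})" using simplex_on_remove[OF t] fin(1) by simp
      then have "h \<sigma> t = g' t" using h \<sigma> w(1) by blast
      then show ?thesis unfolding g''_def using False by auto
    qed
  qed
  show ?case
  proof (intro exI[of _ g''] conjI allI impI ballI)
    show "g'' t = g t" if "t v = 0" for t unfolding g''_def using that g' by simp
    fix \<sigma> assume \<sigma>: "\<sigma> \<in> insert {} K" "card \<sigma> \<le> Suc d"
    show "simplex_map (insert v \<sigma>) Y (\<phi> (m + Suc d)) g''"
    proof (cases "\<sigma> \<in> L")
      case False
      then have card: "card \<sigma> \<le> d" using \<sigma> unfolding L_def by auto
      show ?thesis
      proof (rule continuous_map_eq)
        show "simplex_map (insert v \<sigma>) Y (\<phi> (m + Suc d)) g'"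
          by (rule continuous_map_into_subtopology_mono[OF g'_cont[OF \<sigma>(1) card] mono(2)])
        fix t assume "t \<in> topspace (simplex_topology (insert v \<sigma>))"
        then have "\<tau> t \<subseteq> \<sigma>" using \<tau>_sub by simp
        moreover have "finite \<sigma>" using \<sigma>(1) K by auto
        ultimately have "card (\<tau> t) \<le> d" using card card_mono by (metis order_trans)
        then show "g' t = g'' t" unfolding g''_def L_def by simp
      qed
    qed (rule cont_L)
  qed
qed

section \<open>Approximate selections\<close>

text \<open>Vertices are pairs of a level and a point of \<open>X\<close>; the simplices of interest have at most one vertex
  on each level.\<close>

definition level_simplex :: "'a topology \<Rightarrow> nat \<Rightarrow> (nat \<times> 'a) set \<Rightarrow> bool" where
  "level_simplex X n \<sigma> \<longleftrightarrow> finite \<sigma> \<and> \<sigma> \<noteq> {} \<and> inj_on fst \<sigma> \<and> \<sigma> \<subseteq> {1..n} \<times> topspace X"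

lemma card_level_simplex:
  assumes "level_simplex X n \<sigma>" shows "card \<sigma> \<le> n"
proof -
  have "card \<sigma> = card (fst ` \<sigma>)" using assms card_image unfolding level_simplex_def by metis
  also have "\<dots> \<le> card {1..n}"
    using assms by (intro card_mono) (auto simp: level_simplex_def)
  finally show ?thesis by simp
qed

lemma level_simplex_subset:
  assumes "level_simplex X n \<sigma>" "\<tau> \<subseteq> \<sigma>" "\<tau> \<noteq> {}" shows "level_simplex X n \<tau>"
  using assms unfolding level_simplex_def by (meson finite_subset inj_on_subset subset_trans)

text \<open>The bound \<open>1 + n * n\<close> comes from coning: each new level raises the index by at most the dimension
  reached so far.\<close>

definition approximate_selection ::
  "'a topology \<Rightarrow> 'b topology \<Rightarrow> (nat \<Rightarrow> 'a \<Rightarrow> 'b set) \<Rightarrow> nat \<Rightarrow>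
     (nat \<Rightarrow> 'a \<Rightarrow> 'a set) \<Rightarrow> ((nat \<times> 'a \<Rightarrow> real) \<Rightarrow> 'b) \<Rightarrow> bool" where
  "approximate_selection X Y \<phi> n U g \<longleftrightarrow>
     (\<forall>i\<in>{1..n}. locally_finite_family X (topspace X) (U i) \<and>
        (\<forall>x\<in>topspace X. openin X (U i x)) \<and> topspace X \<subseteq> (\<Union>x\<in>topspace X. U i x)) \<and>
     (\<forall>\<sigma> x. level_simplex X n \<sigma> \<and> x \<in> topspace X \<and> (\<forall>p\<in>\<sigma>. x \<in> X closure_of U (fst p) (snd p)) \<longrightarrow>
        simplex_map \<sigma> Y (\<phi> (1 + n * n) x) g)"

lemma asphericalD:
  assumes "aspherical X Y \<phi>" "x \<in> topspace X" "n \<ge> 1"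
  shows "\<phi> n x \<subseteq> \<phi> (Suc n) x \<and> C_embedded (n - 1) Y (\<phi> n x) (\<phi> (Suc n) x)"
  using assms unfolding aspherical_def by simp

lemma aspherical_mono:
  assumes "aspherical X Y \<phi>" "x \<in> topspace X" "1 \<le> i" "i \<le> j"
  shows "\<phi> i x \<subseteq> \<phi> j x"
  using chain_mono[of "\<lambda>n. \<phi> n x" i j] asphericalD[OF assms(1,2)] assms(3,4) by simp

text \<open>The cone over the part of the complex near \<open>x\<close> is mapped into \<open>\<phi> _ x\<close>; by compactness it is also
  mapped into \<open>\<phi> _ x'\<close> for all \<open>x'\<close> in a neighbourhood \<open>W x\<close>, and the sets \<open>W x\<close> are refined to obtain the
  next level.\<close>

lemma approximate_selection_Suc:
  assumes par: "paracompact_space X" and reg: "regular_space X"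
    and sv: "\<And>n. n \<ge> 1 \<Longrightarrow> setvalued_map X Y (\<phi> n)" and lsc: "\<And>n. n \<ge> 1 \<Longrightarrow> strongly_lsc X Y (\<phi> n)"
    and asph: "aspherical X Y \<phi>" and A: "approximate_selection X Y \<phi> n U g"
  shows "\<exists>U' g'. approximate_selection X Y \<phi> (Suc n) U' g' \<and> (\<forall>i\<in>{1..n}. U' i = U i)"
proof -
  define s where "s = 1 + n * n"
  define cl where "cl = (\<lambda>p. X closure_of U (fst p) (snd p))"
  define P where "P = {1..n} \<times> topspace X"
  have lf: "locally_finite_family X (topspace X) (U i)" if "i \<in> {1..n}" for i
    using A that unfolding approximate_selection_def by blast
  have g: "simplex_map \<sigma> Y (\<phi> s x) g"
    if "level_simplex X n \<sigma>" "x \<in> topspace X" "\<forall>p\<in>\<sigma>. x \<in> cl p" for \<sigma> x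
    using A that unfolding approximate_selection_def cl_def s_def by blast
  \<comment> \<open>The old vertices near \<open>x\<close>. Local finiteness of the closures makes
    this set finite, so the cone over the complex near \<open>x\<close> has finitely many simplices
    and needs only finitely many compactness conditions.\<close>
  define F where "F = (\<lambda>x. {p \<in> P. x \<in> cl p})"
  have F_fin: "finite (F x)" if "x \<in> topspace X" for x
  proof -
    have "F x \<subseteq> (\<Union>i\<in>{1..n}. Pair i ` {y \<in> topspace X. x \<in> X closure_of U i y})"
      unfolding F_def P_def cl_def by auto
    moreover have "finite {y \<in> topspace X. x \<in> X closure_of U i y}" if "i \<in> {1..n}" for i
      using locally_finite_family_finite_at[OF locally_finite_family_closure[OF lf[OF that]] \<open>x \<in> topspace X\<close>] .
    ultimately show ?thesis by (meson finite_UN_I finite_atLeastAtMost finite_imageI finite_subset)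
  qed
  define K where "K = (\<lambda>x. {\<sigma>. level_simplex X n \<sigma> \<and> \<sigma> \<subseteq> F x})"
  have K_fin: "finite (K x)" if "x \<in> topspace X" for x
    by (rule finite_subset[of _ "Pow (F x)"]) (use F_fin[OF that] in \<open>auto simp: K_def\<close>)
  define v where "v = (\<lambda>x::'a. (Suc n, x))"
  have vK: "v x' \<notin> \<sigma>" if "\<sigma> \<in> K x" for \<sigma> x x'
    using that unfolding K_def level_simplex_def v_def by auto
  have "\<forall>x\<in>topspace X. \<exists>h. (\<forall>t. t (v x) = 0 \<longrightarrow> h t = g t) \<and>
    (\<forall>\<sigma>\<in>insert {} (K x). card \<sigma> \<le> n \<longrightarrow>
      simplex_map (insert (v x) \<sigma>) Y (\<phi> (s + n) x) h)"
  proof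
    fix x assume x: "x \<in> topspace X"
    obtain y where y: "y \<in> \<phi> 1 x" "y \<in> topspace Y"
      using sv[of 1] x unfolding setvalued_map_def by blast
    show "\<exists>h. (\<forall>t. t (v x) = 0 \<longrightarrow> h t = g t) \<and>
      (\<forall>\<sigma>\<in>insert {} (K x). card \<sigma> \<le> n \<longrightarrow>
        simplex_map (insert (v x) \<sigma>) Y (\<phi> (s + n) x) h)"
    proof (rule cone_extension[of "\<lambda>n. \<phi> n x"])
      show "\<phi> n x \<subseteq> \<phi> (Suc n) x \<and> C_embedded (n - 1) Y (\<phi> n x) (\<phi> (Suc n) x)" if "n \<ge> 1" for n
        by (rule asphericalD[OF asph x that])
      show "y \<in> \<phi> 1 x" "y \<in> topspace Y" "1 \<le> s" using y unfolding s_def by auto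
      show "finite \<sigma> \<and> v x \<notin> \<sigma>" if "\<sigma> \<in> K x" for \<sigma>
        using that vK[OF that] unfolding K_def level_simplex_def by blast
      show "\<sigma> - {w} \<in> insert {} (K x)" if "\<sigma> \<in> K x" for \<sigma> w
        using that level_simplex_subset[of X n \<sigma> "\<sigma> - {w}"] unfolding K_def by blast
      show "simplex_map \<sigma> Y (\<phi> s x) g" if "\<sigma> \<in> K x" for \<sigma>
        using that x unfolding K_def F_def by (intro g) auto
    qed
  qed
  from bchoice[OF this] obtain h where h: "\<forall>x\<in>topspace X. (\<forall>t. t (v x) = 0 \<longrightarrow> h x t = g t) \<and>
    (\<forall>\<sigma>\<in>insert {} (K x). card \<sigma> \<le> n \<longrightarrow>
      simplex_map (insert (v x) \<sigma>) Y (\<phi> (s + n) x) (h x))"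
    by (elim exE) (rule that)
  have h_g: "h x t = g t" if "x \<in> topspace X" "t (v x) = 0" for x t
    using h that by blast
  have h_cont: "simplex_map (insert (v x) \<sigma>) Y (\<phi> (s + n) x) (h x)"
    if x: "x \<in> topspace X" and \<sigma>: "\<sigma> \<in> insert {} (K x)" for x \<sigma>
  proof -
    have "card \<sigma> \<le> n" using \<sigma> card_level_simplex unfolding K_def by auto
    then show ?thesis using h x \<sigma> by blast
  qed
  define W1 where "W1 = (\<lambda>x. (\<Inter>\<sigma>\<in>insert {} (K x). {x' \<in> topspace X. h x ` simplex_on (insert (v x) \<sigma>) \<subseteq> \<phi> (s + n) x'}))"
  \<comment> \<open>Every old vertex near a point of \<open>W2 x\<close> is also near
    \<open>x\<close>, so its simplices belong to the cone built at \<open>x\<close>. The union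
    removed is closed by local finiteness.\<close>
  define W2 where "W2 = (\<lambda>x. topspace X - (\<Union>i\<in>{1..n}. \<Union>y\<in>{y \<in> topspace X. x \<notin> X closure_of U i y}. X closure_of U i y))"
  have W: "\<forall>x\<in>topspace X. openin X (W1 x \<inter> W2 x)"
  proof
    fix x assume x: "x \<in> topspace X"
    have "openin X {x' \<in> topspace X. h x ` simplex_on (insert (v x) \<sigma>) \<subseteq> \<phi> (s + n) x'}"
      if \<sigma>: "\<sigma> \<in> insert {} (K x)" for \<sigma>
    proof -
      have fin: "finite (insert (v x) \<sigma>)" using \<sigma> unfolding K_def level_simplex_def by auto
      have "compactin (simplex_topology (insert (v x) \<sigma>)) (simplex_on (insert (v x) \<sigma>))"
        using compactin_simplex_on[OF fin] by (simp add: compactin_subtopology)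
      from image_compactin[OF this h_cont[OF x \<sigma>]]
      have "compactin Y (h x ` simplex_on (insert (v x) \<sigma>))" by (simp add: compactin_subtopology)
      then show ?thesis using lsc[of "s + n"] unfolding strongly_lsc_def s_def by simp
    qed
    then have "openin X (W1 x)" unfolding W1_def
      by (intro openin_Inter) (use K_fin[OF x] in auto)
    moreover have "openin X (W2 x)"
      unfolding W2_def
    proof (intro openin_diff openin_topspace closedin_Union)
      fix S assume "S \<in> (\<lambda>i. \<Union>y\<in>{y \<in> topspace X. x \<notin> X closure_of U i y}. X closure_of U i y) ` {1..n}"
      then obtain i where i: "i \<in> {1..n}" "S = (\<Union>y\<in>{y \<in> topspace X. x \<notin> X closure_of U i y}. X closure_of U i y)"
        by blast
      have "locally_finite_family X {y \<in> topspace X. x \<notin> X closure_of U i y} (\<lambda>y. X closure_of U i y)"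
        using locally_finite_family_closure[OF lf[OF i(1)]] unfolding locally_finite_family_def
        by (auto elim!: ballE intro: rev_finite_subset)
      then show "closedin X S" unfolding i(2) by (rule closedin_locally_finite_family_Union) simp
    qed simp
    ultimately show "openin X (W1 x \<inter> W2 x)" by (rule openin_Int)
  qed
  have Wx: "x \<in> W1 x \<inter> W2 x" if x: "x \<in> topspace X" for x
  proof
    have "h x ` simplex_on (insert (v x) \<sigma>) \<subseteq> \<phi> (s + n) x" if "\<sigma> \<in> insert {} (K x)" for \<sigma>
      using continuous_map_image_subset_topspace[OF h_cont[OF x that]] by auto
    then show "x \<in> W1 x" unfolding W1_def using x by blast
    show "x \<in> W2 x" unfolding W2_def using x by blast
  qed
  have Wc: "topspace X \<subseteq> (\<Union>x\<in>topspace X. W1 x \<inter> W2 x)" using Wx by blast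
  obtain V where V: "\<forall>x\<in>topspace X. openin X (V x) \<and> X closure_of V x \<subseteq> W1 x \<inter> W2 x"
    "locally_finite_family X (topspace X) V" "topspace X = (\<Union>x\<in>topspace X. V x)"
    using locally_finite_shrinking[OF par reg W Wc] by (elim exE conjE) (rule that)
  define U' where "U' = (\<lambda>i. if i = Suc n then V else U i)"
  \<comment> \<open>A level simplex has at most one vertex of level \<open>n + 1\<close>, so on its
    points the choice is forced.\<close>
  define g' where "g' = (\<lambda>t. if \<exists>x. t (v x) \<noteq> 0 then h (SOME x. t (v x) \<noteq> 0) t else g t)"
  \<comment> \<open>Coning costs up to \<open>n\<close> steps, and \<open>1 + n * n + n\<close> is
    less than \<open>1 + (n + 1) * (n + 1)\<close>.\<close>
  have mono: "\<phi> (s + n) x \<subseteq> \<phi> (1 + Suc n * Suc n) x" "\<phi> s x \<subseteq> \<phi> (1 + Suc n * Suc n) x"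
    if "x \<in> topspace X" for x
    by (rule aspherical_mono[OF asph that]; simp add: s_def)+
  have "approximate_selection X Y \<phi> (Suc n) U' g'"
    unfolding approximate_selection_def
  proof (intro conjI ballI allI impI)
    fix i assume i: "i \<in> {1..Suc n}"
    show "locally_finite_family X (topspace X) (U' i)"
      unfolding U'_def using V(2) lf[of i] i by auto
    show "topspace X \<subseteq> (\<Union>x\<in>topspace X. U' i x)"
    proof (cases "i = Suc n")
      case True then show ?thesis unfolding U'_def using V(3) by simp
    next
      case False then show ?thesis using A i unfolding U'_def approximate_selection_def by simp
    qed
    show "openin X (U' i x)" if "x \<in> topspace X" for x
    proof (cases "i = Suc n")
      case True then show ?thesis unfolding U'_def using V(1) that by simp
    next
      case False then show ?thesis using A i that unfolding U'_def approximate_selection_def by simp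
    qed
  next
    fix \<sigma> x' assume asm: "level_simplex X (Suc n) \<sigma> \<and> x' \<in> topspace X \<and> (\<forall>p\<in>\<sigma>. x' \<in> X closure_of U' (fst p) (snd p))"
    then have \<sigma>: "level_simplex X (Suc n) \<sigma>" and x': "x' \<in> topspace X"
      and cl': "\<And>p. p \<in> \<sigma> \<Longrightarrow> x' \<in> X closure_of U' (fst p) (snd p)" by blast+
    have cl'': "x' \<in> cl p" if "p \<in> \<sigma>" "fst p \<noteq> Suc n" for p
      using cl'[OF that(1)] that(2) unfolding U'_def cl_def by simp
    show "simplex_map \<sigma> Y (\<phi> (1 + Suc n * Suc n) x') g'"
    proof (cases "\<exists>x. v x \<in> \<sigma>")
      case False
      have lev: "fst p \<in> {1..n}" if "p \<in> \<sigma>" for p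
      proof -
        have "fst p \<in> {1..Suc n}" using \<sigma> that unfolding level_simplex_def by auto
        moreover have "fst p \<noteq> Suc n" using False that unfolding v_def by (metis prod.collapse)
        ultimately show ?thesis by auto
      qed
      then have "\<sigma> \<subseteq> {1..n} \<times> topspace X" using \<sigma> unfolding level_simplex_def by fastforce
      then have "level_simplex X n \<sigma>" using \<sigma> unfolding level_simplex_def by blast
      moreover have "\<forall>p\<in>\<sigma>. x' \<in> cl p" using cl'' lev by fastforce
      ultimately have "simplex_map \<sigma> Y (\<phi> s x') g" using x' by (intro g)
      then have 1: "simplex_map \<sigma> Y (\<phi> (1 + Suc n * Suc n) x') g"
        by (rule continuous_map_into_subtopology_mono[OF _ mono(2)[OF x']])
      show ?thesis
      proof (rule continuous_map_eq[OF 1])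
        fix t assume "t \<in> topspace (simplex_topology \<sigma>)"
        then have "\<forall>p. p \<notin> \<sigma> \<longrightarrow> t p = 0" unfolding simplex_on_def topspace_subtopology by blast
        then have "t (v x) = 0" for x using False by blast
        then show "g t = g' t" unfolding g'_def by simp
      qed
    next
      case True
      then obtain x where x: "v x \<in> \<sigma>" by blast
      then have xX: "x \<in> topspace X" using \<sigma> unfolding level_simplex_def v_def by auto
      define \<tau> where "\<tau> = \<sigma> - {v x}"
      have \<sigma>\<tau>: "\<sigma> = insert (v x) \<tau>" unfolding \<tau>_def using x by blast
      have inj: "inj_on fst \<sigma>" using \<sigma> unfolding level_simplex_def by blast
      have uniq: "p = v x" if "p \<in> \<sigma>" "fst p = Suc n" for p
        using inj_onD[OF inj _ that(1) x] that(2) unfolding v_def by simp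
      have "x' \<in> X closure_of V x" using cl'[OF x] unfolding U'_def v_def by simp
      then have x'W: "x' \<in> W1 x" "x' \<in> W2 x" using V(1) xX by blast+
      have \<tau>F: "p \<in> F x" if p: "p \<in> \<tau>" for p
      proof -
        have ne: "p \<in> \<sigma>" "fst p \<noteq> Suc n" using p uniq unfolding \<tau>_def by blast+
        then have pP: "p \<in> P" using \<sigma> unfolding level_simplex_def P_def by (cases p) auto
        have "x \<in> cl p"
        proof (rule ccontr)
          assume "x \<notin> cl p"
          moreover have "fst p \<in> {1..n}" "snd p \<in> topspace X" using pP unfolding P_def by auto
          ultimately have "cl p \<inter> W2 x = {}" unfolding W2_def cl_def by blast
          then show False using cl''[OF ne] x'W(2) by blast
        qed
        then show ?thesis unfolding F_def using pP by blast
      qed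
      have \<tau>K: "\<tau> \<in> insert {} (K x)"
      proof (cases "\<tau> = {}")
        case False
        have "\<tau> \<subseteq> F x" using \<tau>F by blast
        moreover have "level_simplex X n \<tau>"
          using \<sigma> False \<open>\<tau> \<subseteq> F x\<close> unfolding level_simplex_def \<tau>_def F_def P_def
          by (auto intro: inj_on_subset)
        ultimately show ?thesis unfolding K_def by blast
      qed simp
      have "h x ` simplex_on \<sigma> \<subseteq> \<phi> (s + n) x'"
        using x'W(1) \<tau>K unfolding W1_def \<sigma>\<tau> by blast
      moreover have "continuous_map (simplex_topology \<sigma>) Y (h x)"
        using h_cont[OF xX \<tau>K] unfolding \<sigma>\<tau> continuous_map_in_subtopology by blast
      ultimately have 1: "simplex_map \<sigma> Y (\<phi> (1 + Suc n * Suc n) x') (h x)"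
        using mono(1)[OF x'] unfolding continuous_map_in_subtopology by auto
      show ?thesis
      proof (rule continuous_map_eq[OF 1])
        fix t assume "t \<in> topspace (simplex_topology \<sigma>)"
        then have t0: "\<forall>p. p \<notin> \<sigma> \<longrightarrow> t p = 0" unfolding simplex_on_def topspace_subtopology by blast
        have t: "t p = 0" if "p \<notin> \<sigma>" for p using t0 that by blast
        have eq: "z = x" if "t (v z) \<noteq> 0" for z
          using uniq[of "v z"] t[of "v z"] that unfolding v_def by auto
        show "h x t = g' t"
        proof (cases "t (v x) = 0")
          case True
          then have "\<nexists>z. t (v z) \<noteq> 0" using eq by blast
          then show ?thesis unfolding g'_def using h_g[of x t, OF xX True] by simp
        next
          case False
          then have "(SOME z. t (v z) \<noteq> 0) = x" using eq by (metis (mono_tags, lifting) someI_ex)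
          then show ?thesis unfolding g'_def using False by auto
        qed
      qed
    qed
  qed
  moreover have "\<forall>i\<in>{1..n}. U' i = U i" unfolding U'_def by simp
  ultimately show ?thesis by (intro exI[of _ U'] exI[of _ g'] conjI)
qed

text \<open>Disjointness within each level leaves at most one vertex per level with nonzero weight
  at \<open>x\<close>. The support at \<open>x\<close> is thus a level simplex, on which
  \<open>g\<close> takes values in the required set.\<close>

lemma approximate_selection_imp_continuous_selection:
  assumes par: "paracompact_space X" and reg: "regular_space X"
    and A: "approximate_selection X Y \<phi> k U g"
    and \<gamma>: "\<forall>n\<in>{1..k}. disjoint_refinement X (\<gamma> n) (U n ` topspace X)"
      "topspace X \<subseteq> (\<Union>n\<in>{1..k}. \<Union>(\<gamma> n))"
  shows "\<exists>f. continuous_selection X Y (\<phi> (1 + k * k)) f"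
proof -
  define P where "P = {1..k} \<times> topspace X"
  have "\<forall>n V. \<exists>x. n \<in> {1..k} \<and> V \<in> \<gamma> n \<longrightarrow> x \<in> topspace X \<and> V \<subseteq> U n x"
    using \<gamma>(1) unfolding disjoint_refinement_def refines_def by blast
  then obtain c where c: "n \<in> {1..k} \<and> V \<in> \<gamma> n \<longrightarrow> c n V \<in> topspace X \<and> V \<subseteq> U n (c n V)" for n V
    by metis
  \<comment> \<open>Members assigned to the same centre are united, so that the cover is indexed by
    vertices; sets of one level remain disjoint.\<close>
  define W where "W = (\<lambda>p. \<Union>{V \<in> \<gamma> (fst p). c (fst p) V = snd p})"
  have Wo: "\<forall>p\<in>P. openin X (W p)"
    using \<gamma>(1) unfolding W_def P_def disjoint_refinement_def by (auto intro!: openin_Union)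
  have Wc: "topspace X \<subseteq> (\<Union>p\<in>P. W p)"
  proof
    fix x assume "x \<in> topspace X"
    then obtain n V where n: "n \<in> {1..k}" "V \<in> \<gamma> n" "x \<in> V" using \<gamma>(2) by blast
    then have "x \<in> W (n, c n V)" "(n, c n V) \<in> P" unfolding W_def P_def using c by auto
    then show "x \<in> (\<Union>p\<in>P. W p)" by blast
  qed
  have W_U: "W p \<subseteq> U (fst p) (snd p)" if "p \<in> P" for p
    using that c unfolding W_def P_def by fastforce
  have W_inj: "p = q" if pq: "p \<in> P" "q \<in> P" "fst p = fst q" "x \<in> W p" "x \<in> W q" for p q x
  proof -
    obtain V where V: "V \<in> \<gamma> (fst p)" "c (fst p) V = snd p" "x \<in> V" using pq(4) unfolding W_def by blast
    obtain V' where V': "V' \<in> \<gamma> (fst p)" "c (fst p) V' = snd q" "x \<in> V'" using pq(3,5) unfolding W_def by auto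
    have "fst p \<in> {1..k}" using pq(1) unfolding P_def by auto
    then have "pairwise disjnt (\<gamma> (fst p))" using \<gamma>(1) unfolding disjoint_refinement_def by blast
    then have "V = V'" using V V' unfolding pairwise_def disjnt_def by blast
    then show ?thesis using V V' pq(3) by (simp add: prod_eq_iff)
  qed
  obtain l where l: "partition_of_unity X P l" "\<forall>p\<in>P. \<forall>x\<in>topspace X. l p x \<noteq> 0 \<longrightarrow> x \<in> W p"
    using partition_of_unity_exists[OF par reg Wo Wc] by (elim exE conjE) (rule that)
  define L where "L = (\<lambda>x p. if p \<in> P then l p x else 0)"
  define \<sigma> where "\<sigma> = (\<lambda>x. {p \<in> P. l p x \<noteq> 0})"
  have L0: "0 \<le> L x p" if "x \<in> topspace X" for x p
    using l(1) that unfolding L_def partition_of_unity_def by simp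
  have \<sigma>_fin: "finite (\<sigma> x)" if "x \<in> topspace X" for x
    unfolding \<sigma>_def by (rule partition_of_unity_finite[OF l(1) that])
  have L1: "(\<Sum>p\<in>\<sigma> x. L x p) = 1" if "x \<in> topspace X" for x
  proof -
    have "(\<Sum>p\<in>\<sigma> x. L x p) = (\<Sum>p\<in>\<sigma> x. l p x)" unfolding L_def \<sigma>_def by (intro sum.cong) auto
    then show ?thesis using l(1) that unfolding partition_of_unity_def \<sigma>_def by simp
  qed
  have L_simplex: "L x \<in> simplex_on s" if "x \<in> topspace X" "finite s" "\<sigma> x \<subseteq> s" for x s
  proof -
    have "L x \<in> simplex_on (\<sigma> x)"
      unfolding simplex_on_def using L0[OF that(1)] L1[OF that(1)] unfolding \<sigma>_def L_def by auto
    then show ?thesis using simplex_on_mono[OF that(3,2)] by blast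
  qed
  have g: "simplex_map (\<sigma> x) Y (\<phi> (1 + k * k) x) g" if x: "x \<in> topspace X" for x
  proof -
    have "\<sigma> x \<noteq> {}" using L1[OF x] by force
    moreover have "inj_on fst (\<sigma> x)"
    proof (rule inj_onI)
      fix p q assume "p \<in> \<sigma> x" "q \<in> \<sigma> x" "fst p = fst q"
      then show "p = q" using W_inj[of p q x] l(2) x unfolding \<sigma>_def by blast
    qed
    moreover have "\<sigma> x \<subseteq> {1..k} \<times> topspace X" unfolding \<sigma>_def P_def by blast
    ultimately have "level_simplex X k (\<sigma> x)" unfolding level_simplex_def using \<sigma>_fin[OF x] by blast
    moreover have "\<forall>p\<in>\<sigma> x. x \<in> X closure_of U (fst p) (snd p)"
    proof
      fix p assume p: "p \<in> \<sigma> x"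
      then have "p \<in> P" "x \<in> U (fst p) (snd p)" using W_U l(2) x unfolding \<sigma>_def by blast+
      moreover have "openin X (U (fst p) (snd p))"
        using A \<open>p \<in> P\<close> unfolding approximate_selection_def P_def by auto
      ultimately show "x \<in> X closure_of U (fst p) (snd p)" using closure_of_subset[OF openin_subset] by blast
    qed
    ultimately show ?thesis using A x unfolding approximate_selection_def by blast
  qed
  have "continuous_map X Y (\<lambda>x. g (L x))"
  proof (rule continuous_map_locally)
    fix x0 assume x0: "x0 \<in> topspace X"
    then obtain N where N: "openin X N" "x0 \<in> N" "finite {p \<in> P. {x \<in> topspace X. l p x \<noteq> 0} \<inter> N \<noteq> {}}"
      using l(1) unfolding partition_of_unity_def locally_finite_family_def by blast
    define J where "J = {p \<in> P. {x \<in> topspace X. l p x \<noteq> 0} \<inter> N \<noteq> {}}"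
    have NX: "N \<subseteq> topspace X" using N(1) openin_subset by blast
    have \<sigma>J: "\<sigma> x \<subseteq> J" if "x \<in> N" for x using that NX unfolding \<sigma>_def J_def by blast
    \<comment> \<open>\<open>g\<close> is known to be continuous only on single simplices. On
      \<open>T s\<close> the coordinates stay in the simplex on \<open>s\<close>, and near
      \<open>x0\<close> only finitely many supports occur, so finitely many closed pieces are
      pasted.\<close>
    define T where "T = (\<lambda>s. {x \<in> N. \<sigma> x \<subseteq> s})"
    have tN: "topspace (subtopology X N) = N" using NX by auto
    have "continuous_map (subtopology X N) Y (\<lambda>x. g (L x))"
    proof (rule pasting_lemma_closed[where I = "\<sigma> ` N" and X = "subtopology X N" and T = T and Y = Y and
        f = "\<lambda>_ x. g (L x)" and g = "\<lambda>x. g (L x)"])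
      show "finite (\<sigma> ` N)" by (rule finite_subset[of _ "Pow J"]) (use \<sigma>J N(3) in \<open>auto simp: J_def\<close>)
    next
      fix s assume "s \<in> \<sigma> ` N"
      then obtain z where z: "z \<in> N" "s = \<sigma> z" by blast
      have eq: "T s = N \<inter> (\<Inter>p\<in>J - s. {x \<in> topspace (subtopology X N). l p x \<in> {0}})"
      proof (intro subset_antisym subsetI)
        fix x assume "x \<in> T s"
        then show "x \<in> N \<inter> (\<Inter>p\<in>J - s. {x \<in> topspace (subtopology X N). l p x \<in> {0}})"
          unfolding T_def tN \<sigma>_def J_def by blast
      next
        fix x assume "x \<in> N \<inter> (\<Inter>p\<in>J - s. {x \<in> topspace (subtopology X N). l p x \<in> {0}})"
        then show "x \<in> T s" unfolding T_def using \<sigma>J[of x] unfolding \<sigma>_def by blast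
      qed
      have lc: "continuous_map (subtopology X N) euclideanreal (l p)" if "p \<in> P" for p
        using l(1) that unfolding partition_of_unity_def by (simp add: continuous_map_from_subtopology)
      show "closedin (subtopology X N) (T s)"
      proof (cases "J - s = {}")
        case True
        then have "T s = topspace (subtopology X N)" unfolding eq tN by auto
        then show ?thesis by (simp only: closedin_topspace)
      next
        case False
        then have "T s = (\<Inter>p\<in>J - s. {x \<in> topspace (subtopology X N). l p x \<in> {0}})"
          unfolding eq using tN by auto
        moreover have "closedin (subtopology X N) {x \<in> topspace (subtopology X N). l p x \<in> {0}}" if "p \<in> J - s" for p
          by (rule closedin_continuous_map_preimage[OF lc]) (use that in \<open>auto simp: J_def\<close>)
        ultimately show ?thesis using False by (auto intro!: closedin_Inter)
      qed
      have fin: "finite s" using \<sigma>_fin z NX by blast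
      have "continuous_map (subtopology (subtopology X N) (T s)) (simplex_topology s) L"
        unfolding continuous_map_in_subtopology continuous_map_componentwise_UNIV
      proof (intro conjI allI)
        fix p
        have "continuous_map (subtopology X N) euclideanreal (\<lambda>x. L x p)"
          unfolding L_def using lc by (cases "p \<in> P") auto
        then show "continuous_map (subtopology (subtopology X N) (T s)) euclideanreal (\<lambda>x. L x p)"
          by (rule continuous_map_from_subtopology)
      next
        show "L \<in> topspace (subtopology (subtopology X N) (T s)) \<rightarrow> simplex_on s"
          using L_simplex[OF _ fin] unfolding T_def by auto
      qed
      moreover have "continuous_map (simplex_topology s) Y g"
        using g[of z] z NX unfolding continuous_map_in_subtopology by blast
      ultimately have "continuous_map (subtopology (subtopology X N) (T s)) Y (g \<circ> L)"
        by (rule continuous_map_compose)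
      then show "continuous_map (subtopology (subtopology X N) (T s)) Y (\<lambda>x. g (L x))" by (simp add: o_def)
    next
      fix x assume "x \<in> topspace (subtopology X N)"
      then have "x \<in> N" using tN by simp
      then show "\<exists>j. j \<in> \<sigma> ` N \<and> x \<in> T j \<and> g (L x) = g (L x)" unfolding T_def by blast
    qed simp
    then show "\<exists>N. openin X N \<and> x0 \<in> N \<and> continuous_map (subtopology X N) Y (\<lambda>x. g (L x))"
      using N by blast
  qed
  moreover have "g (L x) \<in> \<phi> (1 + k * k) x" if x: "x \<in> topspace X" for x
  proof -
    have "L x \<in> topspace (simplex_topology (\<sigma> x))" using L_simplex[OF x \<sigma>_fin[OF x]] by simp
    then show ?thesis using continuous_map_image_subset_topspace[OF g[OF x]] by auto
  qed
  ultimately show ?thesis unfolding continuous_selection_def by blast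
qed

lemma finite_C_space_imp_slsc_selection:
  assumes fin: "finite_C_space X" and par: "paracompact_space X" and reg: "regular_space X"
  shows "slsc_selection_property X Y"
  unfolding slsc_selection_property_def
proof (intro allI impI, elim conjE)
  fix \<phi> :: "nat \<Rightarrow> 'a \<Rightarrow> 'b set"
  assume asm: "\<forall>n\<ge>1. setvalued_map X Y (\<phi> n) \<and> strongly_lsc X Y (\<phi> n)" and asph: "aspherical X Y \<phi>"
  then have sv: "setvalued_map X Y (\<phi> n)" and lsc: "strongly_lsc X Y (\<phi> n)" if "n \<ge> 1" for n
    using that by simp_all
  \<comment> \<open>The link between consecutive stages keeps the earlier covers but leaves the map
    free to change.\<close>
  have "\<exists>f. \<forall>n. (\<lambda>n (U, g). approximate_selection X Y \<phi> n U g) n (f n) \<and>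
      (\<lambda>n p q. \<forall>i\<in>{1..n}. fst q i = fst p i) n (f n) (f (Suc n))"
  proof (rule dependent_nat_choice)
    have "approximate_selection X Y \<phi> 0 U g" for U g
      unfolding approximate_selection_def level_simplex_def by simp
    then show "\<exists>p. case p of (U, g) \<Rightarrow> approximate_selection X Y \<phi> 0 U g" by auto
  next
    fix p :: "(nat \<Rightarrow> 'a \<Rightarrow> 'a set) \<times> ((nat \<times> 'a \<Rightarrow> real) \<Rightarrow> 'b)" and n
    assume "case p of (U, g) \<Rightarrow> approximate_selection X Y \<phi> n U g"
    then obtain U' g' where "approximate_selection X Y \<phi> (Suc n) U' g'" "\<forall>i\<in>{1..n}. U' i = fst p i"
      using approximate_selection_Suc[OF par reg sv lsc asph, of n "fst p" "snd p"] by (auto simp: split_beta)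
    then show "\<exists>q. (case q of (U, g) \<Rightarrow> approximate_selection X Y \<phi> (Suc n) U g) \<and> (\<forall>i\<in>{1..n}. fst q i = fst p i)"
      by (intro exI[of _ "(U', g')"]) simp
  qed
  then obtain f where f0: "\<forall>n. approximate_selection X Y \<phi> n (fst (f n)) (snd (f n)) \<and>
      (\<forall>i\<in>{1..n}. fst (f (Suc n)) i = fst (f n) i)"
    unfolding split_beta by (elim exE) (rule that)
  then have f: "approximate_selection X Y \<phi> n (fst (f n)) (snd (f n))" for n by blast
  have f_eq: "fst (f (Suc n)) i = fst (f n) i" if "i \<in> {1..n}" for n i using f0 that by blast
  \<comment> \<open>The diagonal of the construction: all stages from \<open>n\<close> on share this
    \<open>n\<close>-th cover.\<close>
  define V where "V = (\<lambda>n. fst (f n) n)"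
  have f_V: "fst (f n) i = V i" if i: "1 \<le> i" "i \<le> n" for n i
    using i(2)
  proof (induction rule: dec_induct)
    case (step m)
    then show ?case using f_eq[of i m] i(1) by simp
  qed (simp add: V_def)
  have Vc: "(\<forall>U\<in>V n ` topspace X. openin X U) \<and> topspace X \<subseteq> \<Union>(V n ` topspace X)" if "n \<ge> 1" for n
    using f[of n] that unfolding approximate_selection_def V_def by simp
  have "\<exists>k \<gamma>. (\<forall>n\<in>{1..k}. disjoint_refinement X (\<gamma> n) (V n ` topspace X)) \<and>
      topspace X \<subseteq> (\<Union>n\<in>{1..k}. \<Union>(\<gamma> n))"
    by (rule finite_C_space_open_covers[OF fin par reg]) (rule Vc)
  then obtain k \<gamma> where \<gamma>: "\<forall>n\<in>{1..k}. disjoint_refinement X (\<gamma> n) (V n ` topspace X)"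
    "topspace X \<subseteq> (\<Union>n\<in>{1..k}. \<Union>(\<gamma> n))" by blast
  have "\<forall>n\<in>{1..k}. disjoint_refinement X (\<gamma> n) (fst (f k) n ` topspace X)"
    using \<gamma>(1) f_V by simp
  from approximate_selection_imp_continuous_selection[OF par reg f this \<gamma>(2)]
  show "\<exists>m\<ge>1. \<exists>f. continuous_selection X Y (\<phi> m) f" by (metis le_add1)
qed

section \<open>Open graphs and strong lower semicontinuity\<close>

text \<open>The tube lemma applied to the compact slice \<open>{x} \<times> K\<close> of the open
  graph.\<close>

lemma open_graph_imp_strongly_lsc:
  assumes "setvalued_map X Y \<theta>" "open_graph X Y \<theta>"
  shows "strongly_lsc X Y \<theta>"
  unfolding strongly_lsc_def
proof (intro allI impI)
  fix K assume K: "compactin Y K"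
  define G where "G = {(x, y). x \<in> topspace X \<and> y \<in> topspace Y \<and> y \<in> \<theta> x}"
  have G: "openin (prod_topology X Y) G" using assms(2) unfolding open_graph_def G_def .
  show "openin X {x \<in> topspace X. K \<subseteq> \<theta> x}"
  proof (subst openin_subopen, intro ballI)
    fix x assume x: "x \<in> {x \<in> topspace X. K \<subseteq> \<theta> x}"
    have "{x} \<times> K \<subseteq> G" using x compactin_subset_topspace[OF K] unfolding G_def by auto
    then obtain U V where UV: "openin X U" "x \<in> U" "K \<subseteq> V" "U \<times> V \<subseteq> G"
      using tube_lemma_right[OF G K, of x] x by blast
    have "U \<subseteq> {x \<in> topspace X. K \<subseteq> \<theta> x}"
      using UV(3,4) openin_subset[OF UV(1)] unfolding G_def by blast
    then show "\<exists>T. openin X T \<and> x \<in> T \<and> T \<subseteq> {x \<in> topspace X. K \<subseteq> \<theta> x}" using UV by blast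
  qed
qed

lemma slsc_imp_open_graph_selection_property:
  assumes "slsc_selection_property X Y" shows "open_graph_selection_property X Y"
  unfolding open_graph_selection_property_def
proof (intro allI impI, elim conjE)
  fix \<phi> :: "nat \<Rightarrow> 'a \<Rightarrow> 'b set"
  assume "\<forall>n\<ge>1. setvalued_map X Y (\<phi> n) \<and> open_graph X Y (\<phi> n)" "aspherical X Y \<phi>"
  then have "(\<forall>n\<ge>1. setvalued_map X Y (\<phi> n) \<and> strongly_lsc X Y (\<phi> n)) \<and> aspherical X Y \<phi>"
    using open_graph_imp_strongly_lsc by blast
  then show "\<exists>m\<ge>1. \<exists>f. continuous_selection X Y (\<phi> m) f"
    using assms unfolding slsc_selection_property_def by simp
qed

section \<open>From selections to disjoint refinements\<close>

text \<open>Covers the case in which the type \<open>'a set\<close>, which indexes the coordinates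
  of the test space, may be finite. The space is discrete, and singletons refine the first
  cover.\<close>

lemma finite_Hausdorff_imp_finite_C_space:
  assumes "Hausdorff_space X" "finite (topspace X)"
  shows "finite_C_space X"
  unfolding finite_C_space_def
proof (intro allI impI)
  fix \<omega> :: "nat \<Rightarrow> 'a set set"
  assume \<omega>: "\<forall>n\<ge>1. finite (\<omega> n) \<and> (\<forall>U\<in>\<omega> n. functionally_open X U) \<and> \<Union>(\<omega> n) = topspace X"
  have X: "X = discrete_topology (topspace X)"
    using finite_t1_space_imp_discrete_topology[OF refl assms(2) Hausdorff_imp_t1_space[OF assms(1)]] .
  define \<gamma> where "\<gamma> = (\<lambda>n::nat. (\<lambda>x. {x}) ` topspace X)"
  have fo: "functionally_open X {x}" if "x \<in> topspace X" for x
  proof -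
    have "continuous_map X euclideanreal (\<lambda>z. if z = x then 1 else 0)" by (subst X) simp
    moreover have "{x} = {z \<in> topspace X. (if z = x then 1 else 0 :: real) \<noteq> 0}" using that by auto
    ultimately show ?thesis unfolding functionally_open_def by blast
  qed
  have "\<Union>(\<omega> 1) = topspace X" using \<omega> by simp
  then have "refines (\<gamma> 1) (\<omega> 1)" unfolding refines_def \<gamma>_def by blast
  moreover have "pairwise disjnt (\<gamma> 1)" unfolding \<gamma>_def pairwise_def disjnt_def by auto
  moreover have "finite (\<gamma> 1)" "\<forall>V\<in>\<gamma> 1. functionally_open X V" "topspace X \<subseteq> \<Union>(\<gamma> 1)"
    unfolding \<gamma>_def using assms(2) fo by auto
  ultimately show "\<exists>k \<gamma>. (\<forall>n\<in>{1..k}. finite (\<gamma> n) \<and> (\<forall>V\<in>\<gamma> n. functionally_open X V) \<and>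
      pairwise disjnt (\<gamma> n) \<and> refines (\<gamma> n) (\<omega> n)) \<and> topspace X \<subseteq> (\<Union>n\<in>{1..k}. \<Union>(\<gamma> n))"
    by (intro exI[of _ 1] exI[of _ \<gamma>]) simp
qed

lemma levelled_labelling_exists:
  assumes "infinite (UNIV :: 'c set)" and fin: "\<And>n. n \<ge> 1 \<Longrightarrow> finite (\<omega> n)"
  shows "\<exists>(lvl :: 'c \<Rightarrow> nat) lab. \<forall>n\<ge>1. finite {p. lvl p = n} \<and> lab ` {p. lvl p = n} = \<omega> n"
proof -
  obtain e :: "nat \<Rightarrow> 'c" where e: "inj e" using infinite_countable_subset[OF assms(1)] by blast
  have "\<exists>h. n \<ge> 1 \<longrightarrow> bij_betw h {0..<card (\<omega> n)} (\<omega> n)" for n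
    using ex_bij_betw_nat_finite[OF fin] by blast
  then obtain h where h: "n \<ge> 1 \<Longrightarrow> bij_betw (h n) {0..<card (\<omega> n)} (\<omega> n)" for n by metis
  define d where "d = (\<lambda>p. prod_decode (inv e p))"
  define lvl where "lvl = (\<lambda>p. if p \<in> range e \<and> snd (d p) < card (\<omega> (fst (d p))) then fst (d p) else 0)"
  define lab where "lab = (\<lambda>p. h (fst (d p)) (snd (d p)))"
  have eq: "{p. lvl p = n} = (\<lambda>j. e (prod_encode (n, j))) ` {0..<card (\<omega> n)}" if n: "n \<ge> 1" for n
  proof (intro subset_antisym subsetI)
    fix p assume "p \<in> {p. lvl p = n}"
    then have "p \<in> range e" "snd (d p) < card (\<omega> (fst (d p)))" "fst (d p) = n"
      using n unfolding lvl_def by (auto split: if_splits)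
    moreover from this have "e (prod_encode (n, snd (d p))) = p"
      unfolding d_def by (metis f_inv_into_f prod.collapse prod_decode_inverse)
    ultimately show "p \<in> (\<lambda>j. e (prod_encode (n, j))) ` {0..<card (\<omega> n)}"
      by (intro image_eqI[of _ _ "snd (d p)"]) auto
  next
    fix p assume "p \<in> (\<lambda>j. e (prod_encode (n, j))) ` {0..<card (\<omega> n)}"
    then obtain j where "j < card (\<omega> n)" "p = e (prod_encode (n, j))" by auto
    then show "p \<in> {p. lvl p = n}" unfolding lvl_def d_def using e by simp
  qed
  have "finite {p. lvl p = n} \<and> lab ` {p. lvl p = n} = \<omega> n" if n: "n \<ge> 1" for n
  proof
    show "finite {p. lvl p = n}" unfolding eq[OF n] by simp
    have "lab ` {p. lvl p = n} = h n ` {0..<card (\<omega> n)}"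
      unfolding eq[OF n] image_image lab_def d_def using e by simp
    then show "lab ` {p. lvl p = n} = \<omega> n" using h[OF n] unfolding bij_betw_def by simp
  qed
  then show ?thesis by blast
qed

section \<open>Joins of finite discrete sets in a product of lines\<close>

lemma homotopic_with_powertop_real_linear:
  assumes f: "continuous_map Z (powertop_real UNIV) f" and g: "continuous_map Z (powertop_real UNIV) g"
    and seg: "\<And>z t. z \<in> topspace Z \<Longrightarrow> t \<in> {0..1} \<Longrightarrow> (\<lambda>p. (1 - t) * f z p + t * g z p) \<in> A"
  shows "homotopic_with (\<lambda>h. True) Z (subtopology (powertop_real UNIV) A) f g"
  unfolding homotopic_with_def
proof (intro exI[of _ "\<lambda>(t, z) p. (1 - t) * f z p + t * g z p"] conjI)
  let ?T = "prod_topology (top_of_set {0..1::real}) Z"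
  show "continuous_map ?T (subtopology (powertop_real UNIV) A) (\<lambda>(t, z) p. (1 - t) * f z p + t * g z p)"
    unfolding continuous_map_in_subtopology continuous_map_componentwise_UNIV
  proof (intro conjI allI)
    fix p
    have t: "continuous_map ?T euclideanreal fst"
      using continuous_map_fst[of "top_of_set {0..1::real}" Z] unfolding continuous_map_in_subtopology by blast
    have "continuous_map ?T euclideanreal (\<lambda>q. f (snd q) p)" "continuous_map ?T euclideanreal (\<lambda>q. g (snd q) p)"
      using continuous_map_compose[OF continuous_map_snd, of Z euclideanreal "\<lambda>z. f z p" "top_of_set {0..1::real}"]
        continuous_map_compose[OF continuous_map_snd, of Z euclideanreal "\<lambda>z. g z p" "top_of_set {0..1::real}"]
        f g unfolding continuous_map_componentwise_UNIV by (simp_all add: o_def)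
    then show "continuous_map ?T euclideanreal (\<lambda>x. (case x of (t, z) \<Rightarrow> \<lambda>p. (1 - t) * f z p + t * g z p) p)"
      unfolding split_beta using t
      by (intro continuous_map_add continuous_map_real_mult continuous_map_diff) simp_all
  qed (use seg in auto)
qed auto

text \<open>The coordinates are arranged in finite levels; on each level at most one coordinate is nonzero, so the
  carrier is the join of the levels. The bound \<open>1 / lvl p\<close> makes every point attain its maximum and keeps
  the set of nearly maximal coordinates upper semicontinuous in the product topology.\<close>

definition join_carrier :: "('c \<Rightarrow> nat) \<Rightarrow> ('c \<Rightarrow> real) set" where
  "join_carrier lvl = {y. (\<forall>p. 0 \<le> y p \<and> y p * real (lvl p) \<le> 1) \<and> (\<forall>p. lvl p = 0 \<longrightarrow> y p = 0) \<and>
     (\<forall>p q. lvl p = lvl q \<and> p \<noteq> q \<longrightarrow> y p = 0 \<or> y q = 0) \<and> (\<exists>p. y p \<noteq> 0)}"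

text \<open>At points whose maximum is attained: the coordinate is at least half of the maximum. A
  coordinate that fails this fails it strictly and so keeps failing under small changes.\<close>

definition dominant :: "('c \<Rightarrow> real) \<Rightarrow> 'c \<Rightarrow> bool" where
  "dominant y p \<longleftrightarrow> (\<forall>q. y q \<le> 2 * y p)"

text \<open>The join over \<open>x\<close>, thickened: small coordinates may have a wrong label or
  too high a level.\<close>

definition join_map :: "('c \<Rightarrow> nat) \<Rightarrow> ('c \<Rightarrow> 'a set) \<Rightarrow> nat \<Rightarrow> 'a \<Rightarrow> ('c \<Rightarrow> real) set" where
  "join_map lvl lab n x = {y \<in> join_carrier lvl. \<forall>p. dominant y p \<longrightarrow> lvl p \<le> n \<and> x \<in> lab p}"

lemma finite_levels:
  fixes lvl :: "'c \<Rightarrow> nat"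
  assumes "\<And>n. n \<ge> 1 \<Longrightarrow> finite {p. lvl p = n}"
  shows "finite {p. 1 \<le> lvl p \<and> real (lvl p) \<le> r}"
proof -
  have "{p. 1 \<le> lvl p \<and> real (lvl p) \<le> r} \<subseteq> (\<Union>n\<in>{1..nat \<lceil>r\<rceil>}. {p. lvl p = n})"
    by (auto simp: le_nat_iff) linarith
  then show ?thesis using assms by (meson atLeastAtMost_iff finite_UN_I finite_atLeastAtMost finite_subset)
qed

text \<open>A coordinate with value at least \<open>y p0\<close> has level at most
  \<open>1 / y p0\<close>, which leaves finitely many candidates for the maximum.\<close>

lemma join_carrier_max:
  assumes fin: "\<And>n. n \<ge> 1 \<Longrightarrow> finite {p. lvl p = n}" and y: "y \<in> join_carrier lvl"
  shows "\<exists>p. 0 < y p \<and> (\<forall>q. y q \<le> y p)"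
proof -
  obtain p0 where "y p0 \<noteq> 0" using y unfolding join_carrier_def by blast
  then have p0: "0 < y p0" using y unfolding join_carrier_def by (simp add: less_le)
  define S where "S = {q. y p0 \<le> y q}"
  have "S \<subseteq> {q. 1 \<le> lvl q \<and> real (lvl q) \<le> 1 / y p0}"
  proof
    fix q assume "q \<in> S"
    then have q: "y p0 \<le> y q" unfolding S_def by simp
    then have "lvl q \<noteq> 0" using y p0 unfolding join_carrier_def by force
    have "y p0 * real (lvl q) \<le> y q * real (lvl q)" using q by (intro mult_right_mono) simp_all
    also have "\<dots> \<le> 1" using y unfolding join_carrier_def by simp
    finally have "real (lvl q) \<le> 1 / y p0" using p0 by (simp add: field_simps)
    then show "q \<in> {q. 1 \<le> lvl q \<and> real (lvl q) \<le> 1 / y p0}" using \<open>lvl q \<noteq> 0\<close> by simp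
  qed
  then have S: "finite S" using finite_levels[OF fin] finite_subset by blast
  have "p0 \<in> S" unfolding S_def by simp
  then have "Max (y ` S) \<in> y ` S" using S by (intro Max_in) auto
  then obtain p where p: "p \<in> S" "Max (y ` S) = y p" by blast
  have "y q \<le> y p" for q
  proof (cases "q \<in> S")
    case True then show ?thesis using p(2) S by (metis Max_ge finite_imageI imageI)
  next
    case False then show ?thesis using p(1) unfolding S_def by simp
  qed
  moreover have "0 < y p" using p(1) p0 unfolding S_def by simp
  ultimately show ?thesis by blast
qed

lemma dominant_pos:
  assumes "y \<in> join_carrier lvl" "dominant y p" shows "0 < y p"
proof -
  obtain q where "y q \<noteq> 0" using assms(1) unfolding join_carrier_def by blast
  then have "0 < y q" using assms(1) unfolding join_carrier_def by (simp add: less_le)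
  moreover have "y q \<le> 2 * y p" using assms(2) unfolding dominant_def by blast
  ultimately show ?thesis by linarith
qed

lemma join_map_vertex:
  assumes "lvl p = n" "1 \<le> n" "x \<in> lab p"
  shows "(\<lambda>q. if q = p then 1 / real n else 0) \<in> join_map lvl lab n x" (is "?y \<in> _")
proof -
  have "?y \<in> join_carrier lvl" unfolding join_carrier_def using assms by auto
  moreover have "q = p" if "dominant ?y q" for q
    using dominant_pos[OF calculation that] by (simp split: if_splits)
  ultimately show ?thesis unfolding join_map_def using assms by auto
qed

text \<open>The largest coordinate is dominant, so its level is at most \<open>n\<close> and it is
  left alone. Since the maximum is unchanged and no coordinate grows, no new coordinate becomes
  dominant.\<close>

lemma join_map_truncate:
  assumes fin: "\<And>n. n \<ge> 1 \<Longrightarrow> finite {p. lvl p = n}"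
    and y: "y \<in> join_map lvl lab n x" and t: "0 \<le> t" "t \<le> 1"
  shows "(\<lambda>p. if lvl p \<le> n then y p else t * y p) \<in> join_map lvl lab n x" (is "?z \<in> _")
proof -
  have yC: "y \<in> join_carrier lvl" using y unfolding join_map_def by blast
  then have y0: "0 \<le> y p" for p unfolding join_carrier_def by blast
  have z_le: "0 \<le> ?z p" "?z p \<le> y p" for p
    using y0[of p] t mult_left_le_one_le[of "y p" t] by auto
  obtain m where m: "0 < y m" "\<forall>q. y q \<le> y m" using join_carrier_max[OF fin yC] by blast
  have "y q \<le> 2 * y m" for q using m(2)[rule_format, of q] m(1) by linarith
  then have "dominant y m" unfolding dominant_def by blast
  then have lm: "lvl m \<le> n" using y unfolding join_map_def by blast
  have "?z p * real (lvl p) \<le> 1" for p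
    using mult_right_mono[OF z_le(2)[of p], of "real (lvl p)"] yC unfolding join_carrier_def
    by (auto intro: order_trans)
  moreover have "\<exists>p. ?z p \<noteq> 0" using lm m(1) by (intro exI[of _ m]) simp
  moreover have "?z p = 0 \<or> ?z q = 0" if "lvl p = lvl q" "p \<noteq> q" for p q
    using yC that unfolding join_carrier_def by auto
  moreover have "?z p = 0" if "lvl p = 0" for p using yC that unfolding join_carrier_def by auto
  ultimately have "?z \<in> join_carrier lvl" unfolding join_carrier_def using z_le by auto
  moreover have "dominant y p" if p: "dominant ?z p" for p
  proof -
    have "y q \<le> 2 * y p" for q
    proof -
      have "y q \<le> ?z m" using m(2) lm by simp
      also have "\<dots> \<le> 2 * ?z p" using p unfolding dominant_def by blast
      also have "\<dots> \<le> 2 * y p" using z_le(2)[of p] by linarith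
      finally show ?thesis .
    qed
    then show ?thesis unfolding dominant_def by blast
  qed
  ultimately show ?thesis using y unfolding join_map_def by blast
qed

text \<open>The segment from \<open>y\<close> to the vertex \<open>a\<close> stays in the carrier
  because \<open>y\<close> vanishes on level \<open>n + 1\<close>. Scaling by \<open>1 - t\<close>
  preserves comparisons among the other coordinates, so those dominant on the segment were dominant
  in \<open>y\<close>.\<close>

lemma join_map_cone:
  assumes y: "y \<in> join_map lvl lab n x" "\<And>p. n < lvl p \<Longrightarrow> y p = 0"
    and a: "lvl a = Suc n" "x \<in> lab a" and t: "0 \<le> t" "t \<le> 1"
  shows "(\<lambda>p. (1 - t) * y p + t * (if p = a then 1 / real (Suc n) else 0)) \<in> join_map lvl lab (Suc n) x" (is "?z \<in> _")
proof -
  have yC: "y \<in> join_carrier lvl" using y unfolding join_map_def by blast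
  then have y0: "0 \<le> y p" "y p * real (lvl p) \<le> 1" for p unfolding join_carrier_def by blast+
  have ya: "y a = 0" using y(2)[of a] a(1) by simp
  have za: "?z a = t / real (Suc n)" using ya by simp
  have zp: "?z p = (1 - t) * y p" if "p \<noteq> a" for p using that by simp
  have "0 \<le> ?z p" for p using y0(1)[of p] t by simp
  moreover have "?z p * real (lvl p) \<le> 1" for p
  proof (cases "p = a")
    case True
    have "?z a * real (lvl a) = t" unfolding za a(1) by simp
    then show ?thesis using True t by simp
  next
    case False
    have "(1 - t) * (y p * real (lvl p)) \<le> 1" 
      using mult_left_le_one_le[of "y p * real (lvl p)" "1 - t"] y0[of p] t by simp
    then show ?thesis unfolding zp[OF False] by (simp only: mult.assoc)
  qed
  moreover have "?z p = 0" if p: "lvl p = 0" for p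
  proof -
    have "p \<noteq> a" using p a(1) by auto
    moreover have "y p = 0" using yC p unfolding join_carrier_def by blast
    ultimately show ?thesis by simp
  qed
  moreover have "?z p = 0 \<or> ?z q = 0" if pq: "lvl p = lvl q" "p \<noteq> q" for p q
  proof (cases "lvl p = Suc n")
    case True
    then have "y p = 0" "y q = 0" using y(2) pq(1) by auto
    then show ?thesis using pq(2) by (cases "p = a") simp_all
  next
    case False
    then have "p \<noteq> a" "q \<noteq> a" using a(1) pq(1) by auto
    moreover have "y p = 0 \<or> y q = 0" using yC pq unfolding join_carrier_def by blast
    ultimately show ?thesis by auto
  qed
  moreover have "\<exists>p. ?z p \<noteq> 0"
  proof (cases "t = 0")
    case True
    then show ?thesis using yC unfolding join_carrier_def by simp
  next
    case False
    then have "?z a \<noteq> 0" unfolding za by simp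
    then show ?thesis by blast
  qed
  ultimately have zC: "?z \<in> join_carrier lvl" unfolding join_carrier_def by blast
  moreover have "lvl p \<le> Suc n \<and> x \<in> lab p" if p: "dominant ?z p" for p
  proof (cases "p = a")
    case False
    \<comment> \<open>Dominant coordinates are positive. This excludes \<open>t = 1\<close>, so the
      factor \<open>1 - t\<close> can be cancelled.\<close>
    have pos: "0 < (1 - t) * y p" using dominant_pos[OF zC p] unfolding zp[OF False] .
    then have t1: "0 < 1 - t" using t y0(1)[of p] by (simp add: zero_less_mult_iff)
    have "y q \<le> 2 * y p" for q
    proof (cases "q = a")
      case True
      then show ?thesis using ya y0(1)[of p] by simp
    next
      case qa: False
      have "?z q \<le> 2 * ?z p" using p unfolding dominant_def by blast
      then have "(1 - t) * y q \<le> (1 - t) * (2 * y p)" unfolding zp[OF False] zp[OF qa] by simp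
      then show ?thesis using t1 by simp
    qed
    then have "dominant y p" unfolding dominant_def by blast
    then show ?thesis using y(1) unfolding join_map_def by auto
  qed (use a in auto)
  ultimately show ?thesis unfolding join_map_def by blast
qed

lemma tychonoff_space_subtopology_powertop_real:
  "tychonoff_space (subtopology (powertop_real UNIV) A)"
  unfolding tychonoff_space_def
  by (intro conjI completely_regular_space_subtopology Hausdorff_space_subtopology)
    (simp_all add: completely_regular_space_product_topology Hausdorff_space_product_topology
      metrizable_imp_completely_regular_space metrizable_space_euclidean)

text \<open>Near \<open>y0\<close> no coordinate is dominant that is not dominant at
  \<open>y0\<close>, and the finitely many coordinates dominant at \<open>y0\<close> have open
  labels.\<close>

lemma open_graph_join_map:
  assumes fin: "\<And>n. n \<ge> 1 \<Longrightarrow> finite {p. lvl p = n}"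
    and lab: "\<And>p. 1 \<le> lvl p \<Longrightarrow> openin X (lab p)"
  shows "open_graph X (subtopology (powertop_real UNIV) (join_carrier lvl)) (join_map lvl lab n)"
  unfolding open_graph_def
proof (subst openin_subopen, intro ballI)
  let ?Y = "subtopology (powertop_real UNIV) (join_carrier lvl)"
  let ?G = "{(x, y). x \<in> topspace X \<and> y \<in> topspace ?Y \<and> y \<in> join_map lvl lab n x}"
  fix q assume "q \<in> ?G"
  then obtain x0 y0 where q: "q = (x0, y0)" "x0 \<in> topspace X" "y0 \<in> join_map lvl lab n x0" by blast
  have y0C: "y0 \<in> join_carrier lvl" using q(3) unfolding join_map_def by blast
  obtain m where m: "0 < y0 m" "\<forall>p. y0 p \<le> y0 m" using join_carrier_max[OF fin y0C] by blast
  \<comment> \<open>For \<open>y\<close> near \<open>y0\<close> the coordinate \<open>m\<close>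
    exceeds \<open>y0 m / 2\<close>, so a dominant one exceeds \<open>y0 m / 4\<close>; the carrier
    then bounds its level by \<open>4 / y0 m\<close>.\<close>
  define Q where "Q = {p. 1 \<le> lvl p \<and> real (lvl p) \<le> 4 / y0 m}"
  have Q: "finite Q" unfolding Q_def by (rule finite_levels[OF fin])
  define D where "D = {p \<in> Q. dominant y0 p}"
  have D: "finite D" "D \<subseteq> Q" unfolding D_def using Q by auto
  define U where "U = (\<Inter>p\<in>D. lab p) \<inter> topspace X"
  define V where "V = {y \<in> topspace ?Y. y0 m / 2 < y m} \<inter> ((\<Inter>p\<in>Q - D. {y \<in> topspace ?Y. 2 * y p < y m}) \<inter> topspace ?Y)"
  have coord: "continuous_map ?Y euclideanreal (\<lambda>y. y p)" for p
    by (rule continuous_map_coordinate_subtopology)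
  have "openin X U" unfolding U_def
    by (rule openin_INT[OF D(1)], rule lab) (use D(2) in \<open>auto simp: Q_def\<close>)
  moreover have "openin ?Y V"
  proof -
    have "openin ?Y {y \<in> topspace ?Y. y0 m / 2 < y m}"
      by (rule openin_Collect_less_real) (simp_all add: coord)
    moreover have "openin ?Y ((\<Inter>p\<in>Q - D. {y \<in> topspace ?Y. 2 * y p < y m}) \<inter> topspace ?Y)"
      by (rule openin_INT, use Q in blast, rule openin_Collect_less_real)
        (intro continuous_map_real_mult_left coord)+
    ultimately show ?thesis unfolding V_def by (rule openin_Int)
  qed
  ultimately have "openin (prod_topology X ?Y) (U \<times> V)" by (simp add: openin_prod_Times_iff)
  moreover have "x0 \<in> U" unfolding U_def using q(2,3) unfolding D_def join_map_def by blast
  moreover have "y0 \<in> V"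
  proof -
    have "2 * y0 p < y0 m" if "p \<in> Q - D" for p
    proof -
      have "\<not> dominant y0 p" using that unfolding D_def by blast
      then obtain r where "2 * y0 p < y0 r" unfolding dominant_def by (auto simp: not_le)
      then show ?thesis using m(2)[rule_format, of r] by linarith
    qed
    then show ?thesis unfolding V_def using y0C m(1) by simp
  qed
  moreover have "U \<times> V \<subseteq> ?G"
  proof (clarify, intro conjI)
    fix x y assume x: "x \<in> U" and y: "y \<in> V"
    show "x \<in> topspace X" "y \<in> topspace ?Y" using x y unfolding U_def V_def by blast+
    then have yC: "y \<in> join_carrier lvl" by simp
    have "p \<in> D" if p: "dominant y p" for p
    proof -
      have ym: "y0 m / 2 < y m" using y unfolding V_def by blast
      have 1: "y m \<le> 2 * y p" using p unfolding dominant_def by blast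
      have "lvl p \<noteq> 0" using dominant_pos[OF yC p] yC unfolding join_carrier_def by force
      moreover have "real (lvl p) \<le> 4 / y0 m"
      proof -
        have "y0 m / 4 * real (lvl p) \<le> y p * real (lvl p)"
          by (rule mult_right_mono) (use ym 1 in linarith, simp)
        also have "\<dots> \<le> 1" using yC unfolding join_carrier_def by blast
        finally show ?thesis using m(1) by (simp add: field_simps)
      qed
      ultimately have "p \<in> Q" unfolding Q_def by simp
      moreover have "p \<in> Q - D \<Longrightarrow> 2 * y p < y m" using y unfolding V_def by blast
      ultimately show ?thesis using 1 by force
    qed
    moreover have "lvl p \<le> n" if "p \<in> D" for p using that q(3) unfolding D_def join_map_def by blast
    moreover have "x \<in> lab p" if "p \<in> D" for p using that x unfolding U_def by blast
    ultimately show "y \<in> join_map lvl lab n x" unfolding join_map_def using yC by blast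
  qed
  ultimately show "\<exists>T. openin (prod_topology X ?Y) T \<and> q \<in> T \<and> T \<subseteq> ?G"
    unfolding q(1) by (intro exI[of _ "U \<times> V"]) blast
qed

text \<open>A sphere in the \<open>n\<close>-th value is first pushed into the levels up to \<open>n\<close> and then contracted to a vertex of
  level \<open>n + 1\<close>.\<close>

lemma aspherical_join_map:
  assumes fin: "\<And>n. n \<ge> 1 \<Longrightarrow> finite {p. lvl p = n}"
    and lab: "\<And>n x. n \<ge> 1 \<Longrightarrow> x \<in> topspace X \<Longrightarrow> \<exists>p. lvl p = n \<and> x \<in> lab p"
  shows "aspherical X (subtopology (powertop_real UNIV) (join_carrier lvl)) (join_map lvl lab)"
  unfolding aspherical_def
proof (intro allI impI ballI conjI)
  let ?Y = "subtopology (powertop_real UNIV) (join_carrier lvl)"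
  fix n x assume n: "(n::nat) \<ge> 1" and x: "x \<in> topspace X"
  show sub: "join_map lvl lab n x \<subseteq> join_map lvl lab (Suc n) x" unfolding join_map_def by auto
  have Yj: "subtopology ?Y (join_map lvl lab k x) = subtopology (powertop_real UNIV) (join_map lvl lab k x)" for k
  proof -
    have "join_carrier lvl \<inter> join_map lvl lab k x = join_map lvl lab k x" unfolding join_map_def by blast
    then show ?thesis by (simp add: subtopology_subtopology)
  qed
  obtain a where a: "lvl a = Suc n" "x \<in> lab a" using lab[of "Suc n" x] x by auto
  define c where "c = (\<lambda>p. if p = a then 1 / real (Suc n) else 0)"
  have c: "c \<in> join_map lvl lab (Suc n) x"
    unfolding c_def by (rule join_map_vertex[of lvl a "Suc n" x lab, OF a(1) _ a(2)]) simp
  show "C_embedded (n - 1) ?Y (join_map lvl lab n x) (join_map lvl lab (Suc n) x)"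
    unfolding C_embedded_def
  proof (intro allI impI)
    fix k f assume "k \<le> n - 1" and "continuous_map (nsphere k) (subtopology ?Y (join_map lvl lab n x)) f"
    then have f: "continuous_map (nsphere k) (powertop_real UNIV) f"
      "\<And>z. z \<in> topspace (nsphere k) \<Longrightarrow> f z \<in> join_map lvl lab n x"
      unfolding Yj continuous_map_in_subtopology by auto
    define f' where "f' = (\<lambda>z p. if lvl p \<le> n then f z p else 0)"
    have f'_cont: "continuous_map (nsphere k) (powertop_real UNIV) f'"
      unfolding continuous_map_componentwise_UNIV
    proof
      fix p show "continuous_map (nsphere k) euclideanreal (\<lambda>z. f' z p)"
        using f(1) unfolding f'_def continuous_map_componentwise_UNIV by (cases "lvl p \<le> n") simp_all
    qed
    have f'_in: "f' z \<in> join_map lvl lab n x" if "z \<in> topspace (nsphere k)" for z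
      using join_map_truncate[OF fin f(2)[OF that], of 0] unfolding f'_def by (simp cong: if_cong)
    have "homotopic_with (\<lambda>h. True) (nsphere k) (subtopology ?Y (join_map lvl lab (Suc n) x)) f f'"
      unfolding Yj
    proof (rule homotopic_with_powertop_real_linear[OF f(1) f'_cont])
      fix z and t :: real assume z: "z \<in> topspace (nsphere k)" and t: "t \<in> {0..1}"
      have "(\<lambda>p. (1 - t) * f z p + t * f' z p) = (\<lambda>p. if lvl p \<le> n then f z p else (1 - t) * f z p)"
        unfolding f'_def by (auto simp: algebra_simps)
      then show "(\<lambda>p. (1 - t) * f z p + t * f' z p) \<in> join_map lvl lab (Suc n) x"
        using join_map_truncate[OF fin f(2)[OF z], of "1 - t"] t sub by auto
    qed
    moreover have "homotopic_with (\<lambda>h. True) (nsphere k) (subtopology ?Y (join_map lvl lab (Suc n) x)) f' (\<lambda>z. c)"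
      unfolding Yj
    proof (rule homotopic_with_powertop_real_linear[OF f'_cont])
      show "continuous_map (nsphere k) (powertop_real UNIV) (\<lambda>z. c)" by simp
      fix z and t :: real assume z: "z \<in> topspace (nsphere k)" and t: "t \<in> {0..1}"
      show "(\<lambda>p. (1 - t) * f' z p + t * c p) \<in> join_map lvl lab (Suc n) x"
        unfolding c_def by (rule join_map_cone[OF f'_in[OF z] _ a]) (use t in \<open>auto simp: f'_def\<close>)
    qed
    ultimately have "homotopic_with (\<lambda>h. True) (nsphere k) (subtopology ?Y (join_map lvl lab (Suc n) x)) f (\<lambda>z. c)"
      by (rule homotopic_with_trans)
    with c show "\<exists>c\<in>join_map lvl lab (Suc n) x.
        homotopic_with (\<lambda>h. True) (nsphere k) (subtopology ?Y (join_map lvl lab (Suc n) x)) f (\<lambda>z. c)" by blast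
  qed
qed

text \<open>The member for \<open>p\<close> is the set where \<open>f x p\<close> exceeds half of
  the maximum. There \<open>p\<close> is dominant, so the label contains the set, and two
  coordinates of one level are never both positive.\<close>

lemma join_map_selection_imp_disjoint_refinements:
  assumes fin: "\<And>n. n \<ge> 1 \<Longrightarrow> finite {p. lvl p = n}"
    and sel: "continuous_selection X (subtopology (powertop_real UNIV) (join_carrier lvl)) (join_map lvl lab k) f"
  shows "\<exists>\<gamma>. (\<forall>n\<in>{1..k}. finite (\<gamma> n) \<and> (\<forall>V\<in>\<gamma> n. functionally_open X V) \<and> pairwise disjnt (\<gamma> n) \<and>
      refines (\<gamma> n) (lab ` {p. lvl p = n})) \<and> topspace X \<subseteq> (\<Union>n\<in>{1..k}. \<Union>(\<gamma> n))"
proof (cases "topspace X = {}")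
  case True
  then show ?thesis by (intro exI[of _ "\<lambda>n. {}"]) (simp add: refines_def)
next
  case False
  define Q where "Q = {p. lvl p \<in> {1..k}}"
  have Q: "finite Q"
  proof -
    have "Q = (\<Union>n\<in>{1..k}. {p. lvl p = n})" unfolding Q_def by auto
    then show ?thesis using fin by simp
  qed
  have fj: "f x \<in> join_map lvl lab k x" if "x \<in> topspace X" for x
    using sel that unfolding continuous_selection_def by blast
  then have fC: "f x \<in> join_carrier lvl" if "x \<in> topspace X" for x
    using that unfolding join_map_def by blast
  have f_cont: "continuous_map X euclideanreal (\<lambda>x. f x p)" for p
    using sel unfolding continuous_selection_def continuous_map_in_subtopology continuous_map_componentwise_UNIV
    by blast
  have max: "\<exists>p\<in>Q. 0 < f x p \<and> (\<forall>q. f x q \<le> f x p)" if x: "x \<in> topspace X" for x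
  proof -
    obtain p where p: "0 < f x p" "\<forall>q. f x q \<le> f x p" using join_carrier_max[OF fin fC[OF x]] by blast
    have "f x q \<le> 2 * f x p" for q using p(2)[rule_format, of q] p(1) by linarith
    then have "dominant (f x) p" unfolding dominant_def by blast
    then have "lvl p \<le> k" using fj[OF x] unfolding join_map_def by blast
    moreover have "lvl p \<noteq> 0" using fC[OF x] p(1) unfolding join_carrier_def by force
    ultimately have "p \<in> Q" unfolding Q_def by simp
    then show ?thesis using p by blast
  qed
  then have Q_ne: "Q \<noteq> {}" using False by blast
  define M where "M = (\<lambda>x. Max ((\<lambda>p. f x p) ` Q))"
  have M_cont: "continuous_map X euclideanreal M"
    unfolding M_def by (rule continuous_map_Max_real[OF Q Q_ne f_cont])
  have M_max: "0 < M x \<and> (\<forall>q. f x q \<le> M x) \<and> (\<exists>p\<in>Q. f x p = M x)" if x: "x \<in> topspace X" for x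
  proof -
    obtain p where p: "p \<in> Q" "0 < f x p" "\<forall>q. f x q \<le> f x p" using max[OF x] by blast
    then have "M x = f x p" unfolding M_def using Q by (intro Max_eqI) auto
    then show ?thesis using p by auto
  qed
  \<comment> \<open>\<open>M\<close> is a maximum over the finite set \<open>Q\<close>, hence
    continuous; the positive part makes the set \<open>M x < 2 * f x p\<close> a cozero set.\<close>
  define V where "V = (\<lambda>p. {x \<in> topspace X. max 0 (2 * f x p - M x) \<noteq> 0})"
  have V: "M x < 2 * f x p" if "x \<in> V p" for x p
    using that unfolding V_def by (auto simp: max_def split: if_splits)
  have V_dom: "dominant (f x) p" if "x \<in> V p" for x p
    unfolding dominant_def
  proof
    fix q
    have "x \<in> topspace X" using that unfolding V_def by blast
    then have "f x q \<le> M x" using M_max by blast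
    then show "f x q \<le> 2 * f x p" using V[OF that] by linarith
  qed
  define \<gamma> where "\<gamma> = (\<lambda>n. V ` {p. lvl p = n})"
  show ?thesis
  proof (intro exI[of _ \<gamma>] conjI ballI)
    fix n assume n: "n \<in> {1..k}"
    show "finite (\<gamma> n)" unfolding \<gamma>_def using fin n by simp
    show "pairwise disjnt (\<gamma> n)" unfolding pairwise_def
    proof (intro ballI impI)
      fix A B assume "A \<in> \<gamma> n" "B \<in> \<gamma> n" "A \<noteq> B"
      then obtain p q where "A = V p" "lvl p = n" "B = V q" "lvl q = n" unfolding \<gamma>_def by blast
      with \<open>A \<noteq> B\<close> have pq: "A = V p" "B = V q" "lvl p = lvl q" "p \<noteq> q" by auto
      { fix x assume x: "x \<in> V p" "x \<in> V q"
        then have xX: "x \<in> topspace X" unfolding V_def by blast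
        have "0 < f x p" "0 < f x q" using dominant_pos[OF fC[OF xX]] V_dom x by blast+
        moreover have "f x p = 0 \<or> f x q = 0" using fC[OF xX] pq(3,4) unfolding join_carrier_def by blast
        ultimately have False by auto }
      then show "disjnt A B" unfolding pq disjnt_def by blast
    qed
    show "refines (\<gamma> n) (lab ` {p. lvl p = n})" unfolding refines_def
    proof
      fix A assume "A \<in> \<gamma> n"
      then obtain p where p: "A = V p" "lvl p = n" unfolding \<gamma>_def by blast
      have "V p \<subseteq> lab p"
      proof
        fix x assume x: "x \<in> V p"
        then have "x \<in> topspace X" unfolding V_def by blast
        from fj[OF this] show "x \<in> lab p" using V_dom[OF x] unfolding join_map_def by blast
      qed
      then show "\<exists>U\<in>lab ` {p. lvl p = n}. A \<subseteq> U" using p by blast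
    qed
    fix A assume "A \<in> \<gamma> n"
    then obtain p where p: "A = V p" unfolding \<gamma>_def by blast
    have "continuous_map X euclideanreal (\<lambda>x. max 0 (2 * f x p - M x))"
      by (intro continuous_map_real_max continuous_map_diff continuous_map_real_mult_left f_cont M_cont) simp
    then show "functionally_open X A" unfolding p V_def functionally_open_def by blast
  next
    show "topspace X \<subseteq> (\<Union>n\<in>{1..k}. \<Union>(\<gamma> n))"
    proof
      fix x assume x: "x \<in> topspace X"
      obtain p where p: "p \<in> Q" "f x p = M x" "0 < M x" using M_max[OF x] by blast
      then have "x \<in> V p" unfolding V_def using x by simp
      then have "x \<in> \<Union>(\<gamma> (lvl p))" unfolding \<gamma>_def by blast
      moreover have "lvl p \<in> {1..k}" using p(1) unfolding Q_def by simp
      ultimately show "x \<in> (\<Union>n\<in>{1..k}. \<Union>(\<gamma> n))" by blast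
    qed
  qed
qed

text \<open>For given covers a single test space is used. It has finitely many coordinates on each
  of countably many levels, and the infinite index type makes room for them.\<close>

lemma open_graph_selection_imp_finite_C_space:
  fixes X :: "'a topology"
  assumes inf: "infinite (UNIV :: 'c set)"
    and sel: "\<And>Y :: ('c \<Rightarrow> real) topology. tychonoff_space Y \<Longrightarrow> open_graph_selection_property X Y"
  shows "finite_C_space X"
  unfolding finite_C_space_def
proof (intro allI impI)
  fix \<omega> :: "nat \<Rightarrow> 'a set set"
  assume \<omega>: "\<forall>n\<ge>1. finite (\<omega> n) \<and> (\<forall>U\<in>\<omega> n. functionally_open X U) \<and> \<Union>(\<omega> n) = topspace X"
  then have \<omega>_fin: "finite (\<omega> n)" if "n \<ge> 1" for n using that by simp
  obtain lvl :: "'c \<Rightarrow> nat" and lab where lvl_lab: "\<forall>n\<ge>1. finite {p. lvl p = n} \<and> lab ` {p. lvl p = n} = \<omega> n"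
    using levelled_labelling_exists[OF inf, of \<omega>] \<omega>_fin by blast
  then have fin: "finite {p. lvl p = n}" and lab: "lab ` {p. lvl p = n} = \<omega> n" if "n \<ge> 1" for n
    using that by simp_all
  have lab_cover: "\<exists>p. lvl p = n \<and> x \<in> lab p" if "n \<ge> 1" "x \<in> topspace X" for n x
  proof -
    have "x \<in> \<Union>(\<omega> n)" using \<omega> that by simp
    then show ?thesis unfolding lab[OF that(1), symmetric] by blast
  qed
  have lab_open: "openin X (lab p)" if "1 \<le> lvl p" for p
  proof -
    have "lab p \<in> \<omega> (lvl p)" using lab[OF that] by blast
    then show ?thesis using \<omega> that functionally_open_imp_openin by blast
  qed
  let ?Y = "subtopology (powertop_real UNIV) (join_carrier lvl)"
  have "setvalued_map X ?Y (join_map lvl lab n) \<and> open_graph X ?Y (join_map lvl lab n)" if n: "n \<ge> 1" for n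
  proof
    show "setvalued_map X ?Y (join_map lvl lab n)" unfolding setvalued_map_def
    proof (intro ballI conjI)
      fix x assume "x \<in> topspace X"
      then obtain p where "lvl p = n" "x \<in> lab p" using lab_cover[OF n] by blast
      then show "join_map lvl lab n x \<noteq> {}" using join_map_vertex[of lvl p n x lab] n by blast
      show "join_map lvl lab n x \<subseteq> topspace ?Y" unfolding join_map_def by auto
    qed
    show "open_graph X ?Y (join_map lvl lab n)" by (rule open_graph_join_map[OF fin lab_open])
  qed
  moreover have "aspherical X ?Y (join_map lvl lab)" by (rule aspherical_join_map[OF fin lab_cover])
  ultimately obtain k f where f: "continuous_selection X ?Y (join_map lvl lab k) f"
    using sel[OF tychonoff_space_subtopology_powertop_real, of "join_carrier lvl"]
    unfolding open_graph_selection_property_def by blast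
  have "\<exists>\<gamma>. (\<forall>n\<in>{1..k}. finite (\<gamma> n) \<and> (\<forall>V\<in>\<gamma> n. functionally_open X V) \<and> pairwise disjnt (\<gamma> n) \<and>
      refines (\<gamma> n) (lab ` {p. lvl p = n})) \<and> topspace X \<subseteq> (\<Union>n\<in>{1..k}. \<Union>(\<gamma> n))"
    by (rule join_map_selection_imp_disjoint_refinements[OF _ f]) (rule fin)
  then obtain \<gamma> where
    \<gamma>: "\<forall>n\<in>{1..k}. finite (\<gamma> n) \<and> (\<forall>V\<in>\<gamma> n. functionally_open X V) \<and> pairwise disjnt (\<gamma> n) \<and>
      refines (\<gamma> n) (lab ` {p. lvl p = n})" "topspace X \<subseteq> (\<Union>n\<in>{1..k}. \<Union>(\<gamma> n))"
    by (elim exE conjE) (rule that)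
  have "\<forall>n\<in>{1..k}. finite (\<gamma> n) \<and> (\<forall>V\<in>\<gamma> n. functionally_open X V) \<and> pairwise disjnt (\<gamma> n) \<and>
      refines (\<gamma> n) (\<omega> n)" using \<gamma>(1) lab by simp
  with \<gamma>(2) show "\<exists>k \<gamma>. (\<forall>n\<in>{1..k}. finite (\<gamma> n) \<and> (\<forall>V\<in>\<gamma> n. functionally_open X V) \<and>
      pairwise disjnt (\<gamma> n) \<and> refines (\<gamma> n) (\<omega> n)) \<and> topspace X \<subseteq> (\<Union>n\<in>{1..k}. \<Union>(\<gamma> n))" by blast
qed

text \<open>A formula cannot quantify over the type of the points of \<open>Y\<close>. This type is
  therefore free in the implications from (a), while the converses assume selections only for spaces
  on the single type \<open>'a set \<Rightarrow> real\<close>, which is a weaker premise.\<close>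

theorem theorem1p1:
  fixes X :: "'a topology"
  assumes "tychonoff_space X" and "paracompact_space X"
  shows "(finite_C_space X \<longrightarrow>
            (\<forall>Y :: 'b topology. tychonoff_space Y \<longrightarrow>
                slsc_selection_property X Y \<and> open_graph_selection_property X Y))
       \<and> ((\<forall>Y :: ('a set \<Rightarrow> real) topology. tychonoff_space Y \<longrightarrow> slsc_selection_property X Y)
            \<longrightarrow> finite_C_space X)
       \<and> ((\<forall>Y :: ('a set \<Rightarrow> real) topology. tychonoff_space Y \<longrightarrow> open_graph_selection_property X Y)
            \<longrightarrow> finite_C_space X)"
proof -
  have reg: "regular_space X" and Haus: "Hausdorff_space X"
    using assms(1) completely_regular_imp_regular_space unfolding tychonoff_space_def by blast+
  have slsc: "slsc_selection_property X Y" if "finite_C_space X" for Y :: "'b topology"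
    by (rule finite_C_space_imp_slsc_selection[OF that assms(2) reg])
  have fin: "finite_C_space X"
    if sel: "\<forall>Y :: ('a set \<Rightarrow> real) topology. tychonoff_space Y \<longrightarrow> open_graph_selection_property X Y"
  proof (cases "finite (topspace X)")
    case True
    then show ?thesis by (rule finite_Hausdorff_imp_finite_C_space[OF Haus])
  next
    case False
    then have "infinite (UNIV :: 'a set set)"
      by (metis Finite_Set.finite_set finite_subset subset_UNIV)
    then show ?thesis by (rule open_graph_selection_imp_finite_C_space) (use sel in blast)
  qed
  show ?thesis
  proof (intro conjI impI allI)
    fix Y :: "'b topology"
    assume "finite_C_space X"
    then show "slsc_selection_property X Y" by (rule slsc)
    then show "open_graph_selection_property X Y" by (rule slsc_imp_open_graph_selection_property)
  next
    assume sel: "\<forall>Y :: ('a set \<Rightarrow> real) topology. tychonoff_space Y \<longrightarrow> slsc_selection_property X Y"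
    show "finite_C_space X"
      by (rule fin) (use sel slsc_imp_open_graph_selection_property in blast)
  qed (rule fin)
qed

end
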